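(* Let $d\geq2$ be an integer and let $\nu$ be the arclength measure on the moment curve $V^d=\{(t,t^2/2,\dots,t^d/d!):t\in[0,1]\}\subseteq\mathbb{R}^d$, that is, the pushforward of Lebesgue measure on $[0,1]$ under $t\mapsto(t,t^2/2,\dots,t^d/d!)$. Then for all $\theta\in[0,1]$, $$\dim^\theta_{\mathrm F}\nu=\min_{k=2,\dots,d}\ \Big(\frac2k+\frac{k^2-k-2}{2k}\,\theta\Big).$$ In particular, $\dim_{\mathrm F}\nu=2/d$, the Fourier spectrum coincides with the Hausdorff dimension of the curve (namely $1$) for $\theta\geq1/2$, and the Fourier spectrum has $d-2$ phase transitions, occurring at $$\theta=\frac{4}{k^2-k+2}\qquad(k=3,\dots,d).$$ Finally, $\dim^\theta_{\mathrm F}\nu>d\theta$ holds for all $$0\leq\theta<\frac{4}{d^2+d+2}.$$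
   Context: For a finite compactly supported Borel measure $\mu$ on $\mathbb{R}^d$, $\widehat\mu(\xi)=\int e^{-2\pi i\xi\cdot x}\,d\mu(x)$. Fourier spectrum: for $\theta\in(0,1]$ let $\mathcal{J}_{s,\theta}(\mu)=\Big(\int_{\mathbb{R}^d}|\widehat\mu(\xi)|^{2/\theta}|\xi|^{s/\theta-d}\,d\xi\Big)^\theta$ and for $\theta=0$ let $\mathcal{J}_{s,0}(\mu)=\sup_{\xi\in\mathbb{R}^d}|\widehat\mu(\xi)|^2|\xi|^s$. Then $\dim^\theta_{\mathrm F}\mu=\sup\{s\in\mathbb{R}:\mathcal{J}_{s,\theta}(\mu)<\infty\}$, and the Fourier dimension is $\dim_{\mathrm F}\mu=\dim^0_{\mathrm F}\mu$. A phase transition is a point where the function $\theta\mapsto\dim^\theta_{\mathrm F}\mu$ is not differentiable. *)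

theory Defs
  imports "HOL-Analysis.Analysis"
begin

section \<open>Fourier spectrum of a measure\<close>

definition fourier_transform :: "'a::euclidean_space measure \<Rightarrow> 'a \<Rightarrow> complex" where
  "fourier_transform \<mu> \<xi> =
     (\<integral>x. exp (- 2 * of_real pi * \<i> * of_real (\<xi> \<bullet> x)) \<partial>\<mu>)"

definition ennpowr :: "ennreal \<Rightarrow> real \<Rightarrow> ennreal" where
  "ennpowr x p = (if x = \<infinity> then \<infinity> else ennreal (enn2real x powr p))" \<comment> \<open>only used for \<open>p > 0\<close>\<close>

text \<open>
  The value \<open>0 powr a = 0\<close> of the factor \<open>norm \<xi> powr a\<close> at the origin is harmless: for
  \<open>\<theta> > 0\<close> the origin is a null set. For \<open>\<theta> = 0\<close> and \<open>s \<le> 0\<close>, the convention only concerns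
  \<open>\<xi> = 0\<close>, and the supremum is already determined by the points near the origin, because the
  Fourier transform of a finite compactly supported measure is continuous.
\<close>

definition fourier_energy :: "real \<Rightarrow> real \<Rightarrow> 'a::euclidean_space measure \<Rightarrow> ennreal" where
  "fourier_energy s \<theta> \<mu> =
     (if \<theta> = 0 then (SUP \<xi>. ennreal ((cmod (fourier_transform \<mu> \<xi>))\<^sup>2 * norm \<xi> powr s))
      else ennpowr
        (\<integral>\<^sup>+\<xi>. ennreal (cmod (fourier_transform \<mu> \<xi>) powr (2 / \<theta>)
                    * norm \<xi> powr (s / \<theta> - real DIM('a))) \<partial>lborel) \<theta>)"

definition fourier_spectrum :: "real \<Rightarrow> 'a::euclidean_space measure \<Rightarrow> ereal" where
  "fourier_spectrum \<theta> \<mu> = (SUP s \<in> {s::real. fourier_energy s \<theta> \<mu> < \<infinity>}. ereal s)"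

definition fourier_dim :: "'a::euclidean_space measure \<Rightarrow> ereal" where
  "fourier_dim \<mu> = fourier_spectrum 0 \<mu>"

text \<open>
  The spectrum is a function on \<open>[0,1]\<close>, so differentiability is one-sided at the two end points.
  The passage from \<open>ereal\<close> to \<open>real\<close> is meaningful only for measures with finite spectrum.
\<close>

definition phase_transitions :: "'a::euclidean_space measure \<Rightarrow> real set" where
  "phase_transitions \<mu> =
     {\<theta> \<in> {0..1}. \<not> (\<lambda>t. real_of_ereal (fourier_spectrum t \<mu>)) differentiable (at \<theta> within {0..1})}"


section \<open>Hausdorff dimension\<close>

text \<open>Conventions: the empty set has weight \<open>0\<close>, and \<open>0\<^sup>0 = 1\<close> for nonempty sets.\<close>

definition diam_weight :: "real \<Rightarrow> 'a::metric_space set \<Rightarrow> ennreal" where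
  "diam_weight s U =
     (if U = {} then 0 else if s = 0 then 1 else ennreal (diameter U powr s))"

text \<open>Boundedness is required explicitly because \<open>diameter\<close> is unspecified on unbounded sets.\<close>

definition hausdorff_premeasure :: "real \<Rightarrow> real \<Rightarrow> 'a::metric_space set \<Rightarrow> ennreal" where
  "hausdorff_premeasure s \<delta> A =
     (INF U \<in> {U :: nat \<Rightarrow> 'a set. A \<subseteq> (\<Union>i. U i) \<and> (\<forall>i. bounded (U i) \<and> diameter (U i) \<le> \<delta>)}.
        \<Sum>i. diam_weight s (U i))"

definition hausdorff_measure :: "real \<Rightarrow> 'a::metric_space set \<Rightarrow> ennreal" where
  "hausdorff_measure s A = (SUP \<delta> \<in> {0<..}. hausdorff_premeasure s \<delta> A)"

definition hausdorff_dim :: "'a::metric_space set \<Rightarrow> ereal" where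
  "hausdorff_dim A = (INF s \<in> {s::real. 0 \<le> s \<and> hausdorff_measure s A = 0}. ereal s)"


section \<open>The moment curve\<close>

text \<open>
  A finite index type carries no numbering of the coordinates, so the numbering
  \<open>idx\<close>, a bijection from \<open>'n\<close> onto \<open>{1..d}\<close>, is a parameter.
\<close>

definition moment_map :: "('n::finite \<Rightarrow> nat) \<Rightarrow> real \<Rightarrow> real ^ 'n" where
  "moment_map idx t = (\<chi> i. t ^ idx i / fact (idx i))"

definition moment_curve :: "('n::finite \<Rightarrow> nat) \<Rightarrow> (real ^ 'n) set" where
  "moment_curve idx = moment_map idx ` {0..1}"

definition moment_measure :: "('n::finite \<Rightarrow> nat) \<Rightarrow> (real ^ 'n) measure" where
  "moment_measure idx = distr (restrict_space lborel {0..1}) borel (moment_map idx)"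

end

(*
  Write P_xi(t) = xi . gamma(t) and let T_t xi be the vector of the derivatives of P_xi at t. The
  maps T_t form a unipotent one-parameter group, so they preserve Lebesgue measure, and T_t xi
  carries the local size of the phase at t.

  Lower bound for the spectrum. With N(eta) = max(1, |eta_j|^(1/j)), van der Corput's lemma gives
  |nu^(xi)| <= C / H, where H is the minimum of N(T_t xi) over [0,1]. As N(T_t xi) stays comparable to H
  on an interval of length 1/H, this yields |nu^(xi)|^p <= C int_0^1 N(T_t xi)^(1-p) dt. Integrating
  in xi and using the invariance, the energy is bounded by the integral of
  N(eta)^(1-p) max(1, |eta|)^a, which is dominated by a product of one-dimensional integrable functions
  exactly when the linear inequality s < 2/k + (k^2-k-2)/(2k) theta holds for all k.

  Upper bound. For each k, let B be the box |eta_k| ~ l, |eta_j| <= delta l^min(j/k,1) for j /= k.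
  If T_t xi lies in B then the k-th derivative dominates near t, and on average over eta_k the
  transform has size l^(-1/k); for fixed xi the set of such t has measure at most l^(-1/k). By
  Fubini the energy is at least a constant times a power of l, whose exponent is nonpositive only if
  s is at most the k-th line.
*)
theory Submission
  imports Defs
begin

section \<open>Oscillatory integrals with polynomial phase\<close>

text \<open>The two bounds meet because the sum of min(j, k) over j, which is k(k+1)/2 + (d-k)k,
  appears in both: it is k times the logarithmic volume of the box, and it is the quadratic term of
  the integrability condition at the point where the sup norm equals N^k. On a logarithmic scale the
  weight is piecewise linear with breaks exactly at these d ratios, so one box shape per k loses
  nothing. The obstacle in the upper bound is cancellation: the ends of [0,1] and the lower-order
  coordinates interfere with the resonance. Averaging the leading coefficient against a fixed
  piecewise linear weight turns the oscillation into a decaying cosine transform, against which both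
  disturbances become absolutely convergent errors. The weight is chosen so that the positivity of
  the main term follows from scaling alone. The case \<theta> = 0 is separate: the energy is a
  supremum, no volume enters, and only k = d matters.\<close>

text \<open>Integration by parts against 1/q': as q'' keeps its sign, 1/q' is monotone, so the
  remainder integral is at most its total variation. The two boundary values and this variation add
  up to 4/m.\<close>

lemma van_der_Corput_poly:
  fixes q :: "real poly"
  assumes ab: "a \<le> b" and m: "0 < m"
    and large: "\<And>t. t \<in> {a..b} \<Longrightarrow> m \<le> \<bar>poly (pderiv q) t\<bar>"
    and sgn: "(\<forall>t\<in>{a..b}. 0 \<le> poly (pderiv (pderiv q)) t) \<or> (\<forall>t\<in>{a..b}. poly (pderiv (pderiv q)) t \<le> 0)"
  shows "norm (integral {a..b} (\<lambda>t. cis (poly q t))) \<le> 4 / m"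
proof -
  define g1 where "g1 = poly (pderiv q)"
  define g2 where "g2 = poly (pderiv (pderiv q))"
  have nz: "g1 t \<noteq> 0" if "t \<in> {a..b}" for t
    using large[OF that] m by (auto simp: g1_def)
  have dg1: "(g1 has_real_derivative g2 t) (at t within S)" for t S
    unfolding g1_def g2_def by (rule has_field_derivative_at_within[OF poly_DERIV])
  have dg: "((\<lambda>t. poly q t) has_real_derivative g1 t) (at t within S)" for t S
    unfolding g1_def by (rule has_field_derivative_at_within[OF poly_DERIV])
  \<comment> \<open>Integration by parts: \<open>F\<close> is the boundary term and \<open>R\<close>
    the remainder, with F' = cis q + R.\<close>
  define F where "F t = - \<i> * cis (poly q t) * of_real (inverse (g1 t))" for t
  define R where "R t = \<i> * cis (poly q t) * of_real (g2 t / (g1 t)\<^sup>2)" for t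
  have dinv: "((\<lambda>t. inverse (g1 t)) has_real_derivative - (g2 t / (g1 t)\<^sup>2)) (at t within {a..b})"
    if "t \<in> {a..b}" for t
    using DERIV_inverse'[OF dg1 nz[OF that], of "{a..b}"] nz[OF that]
    by (simp add: field_simps power2_eq_square)
  have dcis: "((\<lambda>t. cis (poly q t)) has_vector_derivative (\<i> * of_real (g1 t) * cis (poly q t))) (at t within {a..b})" for t
  proof -
    have "((\<lambda>t. exp (\<i> * complex_of_real (poly q t))) has_vector_derivative (\<i> * of_real (g1 t)) * exp (\<i> * complex_of_real (poly q t))) (at t within {a..b})"
    proof -
      have "((\<lambda>t. \<i> * complex_of_real (poly q t)) has_vector_derivative (\<i> * of_real (g1 t))) (at t within {a..b})"
        using has_vector_derivative_mult_right[OF has_vector_derivative_of_real[OF dg[of t "{a..b}"]], of "\<i>"]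
        by simp
      from field_vector_diff_chain_within[OF this, of exp "exp (\<i> * complex_of_real (poly q t))"]
      show ?thesis by (simp add: o_def DERIV_exp[THEN has_field_derivative_at_within])
    qed
    then show ?thesis by (simp add: cis_conv_exp)
  qed
  have dF: "(F has_vector_derivative (cis (poly q t) - of_real (1) * (- R t))) (at t within {a..b})"
    if t: "t \<in> {a..b}" for t
  proof -
    have 1: "((\<lambda>t. complex_of_real (inverse (g1 t))) has_vector_derivative of_real (- (g2 t / (g1 t)\<^sup>2))) (at t within {a..b})"
      by (rule has_vector_derivative_of_real) (rule dinv[OF t])
    have 2: "((\<lambda>t. - \<i> * cis (poly q t)) has_vector_derivative (- \<i> * (\<i> * of_real (g1 t) * cis (poly q t)))) (at t within {a..b})"
      by (rule has_vector_derivative_mult_right[OF dcis])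
    have 3: "(F has_vector_derivative ((- \<i> * cis (poly q t)) * of_real (- (g2 t / (g1 t)\<^sup>2)) + (- \<i> * (\<i> * of_real (g1 t) * cis (poly q t))) * of_real (inverse (g1 t)))) (at t within {a..b})"
      unfolding F_def[abs_def] by (rule has_vector_derivative_mult[OF 2 1])
    have 4: "(- \<i> * (\<i> * of_real (g1 t) * cis (poly q t))) * of_real (inverse (g1 t)) = cis (poly q t)"
      using nz[OF t] by (simp add: field_simps of_real_inverse)
    show ?thesis
      by (rule has_vector_derivative_eq_rhs[OF 3]) (simp only: 4, simp add: R_def)
  qed
  have c1: "continuous_on {a..b} g1" unfolding g1_def by (intro continuous_intros)
  have c2: "continuous_on {a..b} g2" unfolding g2_def by (intro continuous_intros)
  have cc: "continuous_on {a..b} (\<lambda>t. cis (poly q t))"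
    unfolding cis_conv_exp by (intro continuous_intros)
  have cR: "continuous_on {a..b} R" unfolding R_def
    by (intro continuous_intros cc c1 c2) (use nz in auto)
  have "((\<lambda>t. cis (poly q t) - of_real (1) * (- R t)) has_integral (F b - F a)) {a..b}"
    by (rule fundamental_theorem_of_calculus[OF ab dF])
  then have "integral {a..b} (\<lambda>t. cis (poly q t) + R t) = F b - F a"
    by (simp add: integral_unique)
  moreover have "integral {a..b} (\<lambda>t. cis (poly q t) + R t) = integral {a..b} (\<lambda>t. cis (poly q t)) + integral {a..b} R"
    by (intro integral_add integrable_continuous_interval cc cR)
  ultimately have eq: "integral {a..b} (\<lambda>t. cis (poly q t)) = F b - F a - integral {a..b} R"
    by (simp add: algebra_simps)
  have inv: "\<bar>inverse (g1 t)\<bar> \<le> 1 / m" if "t \<in> {a..b}" for t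
    using large[OF that] m by (simp add: g1_def divide_inverse[symmetric] abs_inverse inverse_eq_divide frac_le)
  have nF: "norm (F t) \<le> 1 / m" if "t \<in> {a..b}" for t
    using inv[OF that] by (simp add: F_def norm_mult norm_inverse)
  have nR: "norm (R t) = \<bar>g2 t\<bar> / (g1 t)\<^sup>2" for t
    by (simp add: R_def norm_mult norm_divide norm_power)
  have "norm (integral {a..b} R) \<le> 2 / m"
  proof -
    \<comment> \<open>\<sigma> is the sign of q'', so -\<sigma>/q' is an antiderivative of
      |q''|/q'^2.\<close>
    obtain \<sigma> :: real where \<sigma>: "\<bar>\<sigma>\<bar> = 1" "\<And>t. t \<in> {a..b} \<Longrightarrow> \<bar>g2 t\<bar> = \<sigma> * g2 t"
      using sgn unfolding g2_def
      by (elim disjE) (metis abs_1 abs_of_nonneg mult_1, metis abs_1 abs_minus_cancel abs_of_nonpos mult_minus1)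
    have "((\<lambda>t. - \<sigma> * (- (g2 t / (g1 t)\<^sup>2))) has_integral (- \<sigma> * inverse (g1 b) - - \<sigma> * inverse (g1 a))) {a..b}"
      by (intro fundamental_theorem_of_calculus[OF ab] has_vector_derivative_mult_right
           dinv[unfolded has_real_derivative_iff_has_vector_derivative])
    then have hi: "((\<lambda>t. \<bar>g2 t\<bar> / (g1 t)\<^sup>2) has_integral (\<sigma> * inverse (g1 a) - \<sigma> * inverse (g1 b))) {a..b}"
      by (rule has_integral_eq_rhs[OF has_integral_eq, rotated]) (auto simp: \<sigma>)
    have "norm (integral {a..b} R) \<le> integral {a..b} (\<lambda>t. \<bar>g2 t\<bar> / (g1 t)\<^sup>2)"
      by (rule integral_norm_bound_integral)
        (use hi nR integrable_continuous_interval[OF cR] in \<open>auto intro: has_integral_integrable\<close>)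
    also have "\<dots> = \<sigma> * inverse (g1 a) - \<sigma> * inverse (g1 b)"
      using hi by (rule integral_unique)
    also have "\<dots> \<le> \<bar>\<sigma> * inverse (g1 a)\<bar> + \<bar>\<sigma> * inverse (g1 b)\<bar>" by linarith
    also have "\<dots> = \<bar>inverse (g1 a)\<bar> + \<bar>inverse (g1 b)\<bar>" by (simp only: abs_mult \<sigma>(1) mult_1)
    also have "\<dots> \<le> 1/m + 1/m" by (intro add_mono inv) (use ab in auto)
    finally show ?thesis by simp
  qed
  moreover have "norm (F b) \<le> 1/m" "norm (F a) \<le> 1/m" using nF ab by auto
  ultimately have "norm (F b - F a - integral {a..b} R) \<le> 1/m + 1/m + 2/m"
    by (intro order_trans[OF norm_triangle_ineq4] add_mono) auto
  then show ?thesis unfolding eq by simp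
qed

lemma poly_mean_value:
  fixes q :: "real poly"
  assumes "a < b"
  obtains x where "a < x" "x < b" "poly q b - poly q a = (b - a) * poly (pderiv q) x"
  using MVT2[OF assms, of "poly q" "poly (pderiv q)"] poly_DERIV by blast

text \<open>Induction by thirds: points of the two outer thirds are at least a third apart, so by
  the mean value theorem the derivative one order lower stays above \<open>l * e / 2\<close> on one
  of these thirds. A level costs the factor 2 * 3^(n+1) \<le> 18^(2n+1), which the exponent (n+1)^2
  = n^2 + 2n + 1 absorbs.\<close>

lemma poly_large_of_higher_deriv_large:
  fixes q :: "real poly"
  assumes "a \<le> b" "0 \<le> l" "\<And>t. t \<in> {a..b} \<Longrightarrow> l \<le> \<bar>poly ((pderiv ^^ n) q) t\<bar>"
  shows "\<exists>x\<in>{a..b}. l * (b - a) ^ n / 18 ^ (n * n) \<le> \<bar>poly q x\<bar>"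
  using assms
proof (induction n arbitrary: a b l)
  case 0
  then show ?case by auto
next
  case (Suc n)
  define e where "e = (b - a) / 3"
  have e: "0 \<le> e" "b = a + 3 * e" using Suc.prems(1) by (auto simp: e_def field_simps)
  define r where "r = (pderiv ^^ n) q"
  have r': "l \<le> \<bar>poly (pderiv r) t\<bar>" if "t \<in> {a..b}" for t
    using Suc.prems(3)[OF that] by (simp add: r_def)
  have "\<exists>a'. a' \<in> {a..b - e} \<and> (\<forall>t\<in>{a'..a' + e}. l * e / 2 \<le> \<bar>poly r t\<bar>)"
  proof (cases "\<forall>t\<in>{a..a+e}. l * e / 2 \<le> \<bar>poly r t\<bar>")
    case True
    then show ?thesis using e by (intro exI[of _ a]) auto
  next
    case False
    then obtain x where x: "x \<in> {a..a+e}" "\<bar>poly r x\<bar> < l * e / 2" by force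
    have "l * e / 2 \<le> \<bar>poly r y\<bar>" if y: "y \<in> {b-e..b}" for y
    proof (cases "e = 0")
      case False
      then have "x < y" using x y e by auto
      from poly_mean_value[OF this, of r] obtain z
        where z: "x < z" "z < y" "poly r y - poly r x = (y - x) * poly (pderiv r) z" .
      have "e * l \<le> (y - x) * \<bar>poly (pderiv r) z\<bar>"
        by (intro mult_mono r') (use x y e z Suc.prems in auto)
      also have "\<dots> = \<bar>poly r y - poly r x\<bar>" using z by (simp add: abs_mult)
      finally show ?thesis using x by (simp add: mult.commute)
    qed auto
    then show ?thesis using e by (intro exI[of _ "b - e"]) auto
  qed
  then obtain a' where a': "a' \<in> {a..b - e}" "\<forall>t\<in>{a'..a' + e}. l * e / 2 \<le> \<bar>poly r t\<bar>" by blast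
  have "\<exists>x\<in>{a'..a' + e}. (l * e / 2) * (a' + e - a') ^ n / 18 ^ (n * n) \<le> \<bar>poly q x\<bar>"
    by (rule Suc.IH) (use a' e Suc.prems in \<open>auto simp: r_def\<close>)
  then obtain x where x: "x \<in> {a'..a' + e}" "(l * e / 2) * e ^ n / 18 ^ (n * n) \<le> \<bar>poly q x\<bar>" by auto
  have "2 * (3::real) ^ Suc n * 18 ^ (n*n) \<le> 18 ^ (Suc n * Suc n)"
  proof -
    have "2 * (3::real) ^ Suc n \<le> 18 ^ Suc (2 * n)"
    proof -
      have "(3::real) ^ n \<le> 18 ^ (2*n)"
        by (subst power_mult) (rule power_mono, auto)
      moreover have "(0::real) \<le> 18 ^ (2*n)" by simp
      moreover have "(3::real) ^ Suc n = 3 * 3 ^ n" "(18::real) ^ Suc (2*n) = 18 * 18 ^ (2*n)" by simp_all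
      ultimately show ?thesis by linarith
    qed
    then have "2 * (3::real) ^ Suc n * 18 ^ (n*n) \<le> 18 ^ Suc (2 * n) * 18 ^ (n*n)" by (intro mult_right_mono) auto
    also have "\<dots> = 18 ^ (Suc n * Suc n)" by (simp flip: power_add add: algebra_simps)
    finally show ?thesis .
  qed
  then have "l * (3 * e) ^ Suc n / 18 ^ (Suc n * Suc n) \<le> l * (3 * e) ^ Suc n / (2 * (3::real) ^ Suc n * 18 ^ (n*n))"
    using e Suc.prems by (intro divide_left_mono) auto
  also have "\<dots> = (l * e / 2) * e ^ n / 18 ^ (n * n)"
    by (simp add: power_mult_distrib)
  finally have "l * (3 * e) ^ Suc n / 18 ^ (Suc n * Suc n) \<le> (l * e / 2) * e ^ n / 18 ^ (n * n)" .
  moreover have "b - a = 3 * e" using e by simp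
  ultimately show ?case using x a' e by (intro bexI[of _ x]) auto
qed


text \<open>The sets where |f| lies below or above a level are then intervals, so a single cut
  separates them.\<close>

definition monotone_abs :: "(real \<Rightarrow> real) \<Rightarrow> real \<Rightarrow> real \<Rightarrow> bool" where
  "monotone_abs f a b \<longleftrightarrow>
     (\<forall>x\<in>{a..b}. \<forall>y\<in>{a..b}. x \<le> y \<longrightarrow> \<bar>f x\<bar> \<le> \<bar>f y\<bar>) \<or>
     (\<forall>x\<in>{a..b}. \<forall>y\<in>{a..b}. x \<le> y \<longrightarrow> \<bar>f y\<bar> \<le> \<bar>f x\<bar>)"

lemma monotone_abs_subinterval:
  "monotone_abs f a b \<Longrightarrow> a \<le> c \<Longrightarrow> e \<le> b \<Longrightarrow> monotone_abs f c e"
  unfolding monotone_abs_def by fastforce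

lemma poly_constant_sign:
  fixes r :: "real poly"
  assumes "\<And>t. t \<in> {a<..<b} \<Longrightarrow> poly r t \<noteq> 0"
  shows "(\<forall>t\<in>{a..b}. 0 \<le> poly r t) \<or> (\<forall>t\<in>{a..b}. poly r t \<le> 0)"
proof (rule ccontr)
  assume "\<not> ?thesis"
  then obtain x y where xy: "x \<in> {a..b}" "y \<in> {a..b}" "poly r x < 0" "0 < poly r y" by force
  then have "\<exists>z. z \<in> {a<..<b} \<and> poly r z = 0"
  proof (cases "x < y")
    case True
    from poly_IVT_pos[OF this xy(3,4)] show ?thesis using xy by force
  next
    case False
    then have "y < x" using xy by (cases "x = y") auto
    from poly_IVT_neg[OF this xy(4,3)] show ?thesis using xy by force
  qed
  with assms show False by blast
qed

lemma poly_monotone_abs: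
  fixes r :: "real poly"
  assumes "(\<forall>t\<in>{a..b}. 0 \<le> poly r t) \<or> (\<forall>t\<in>{a..b}. poly r t \<le> 0)"
    and "(\<forall>t\<in>{a..b}. 0 \<le> poly (pderiv r) t) \<or> (\<forall>t\<in>{a..b}. poly (pderiv r) t \<le> 0)"
  shows "monotone_abs (poly r) a b"
proof -
  have "(\<forall>x\<in>{a..b}. \<forall>y\<in>{a..b}. x \<le> y \<longrightarrow> poly r x \<le> poly r y) \<or>
        (\<forall>x\<in>{a..b}. \<forall>y\<in>{a..b}. x \<le> y \<longrightarrow> poly r y \<le> poly r x)"
    using assms(2)
  proof
    assume *: "\<forall>t\<in>{a..b}. 0 \<le> poly (pderiv r) t"
    have "poly r x \<le> poly r y" if "x \<in> {a..b}" "y \<in> {a..b}" "x \<le> y" for x y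
    proof (cases "x = y")
      case False
      then have "x < y" using that by auto
      from poly_mean_value[OF this, of r] obtain z
        where z: "x < z" "z < y" "poly r y - poly r x = (y - x) * poly (pderiv r) z" .
      have "0 \<le> (y - x) * poly (pderiv r) z" using * z that by (intro mult_nonneg_nonneg) auto
      with z show ?thesis by linarith
    qed auto
    then show ?thesis by blast
  next
    assume *: "\<forall>t\<in>{a..b}. poly (pderiv r) t \<le> 0"
    have "poly r y \<le> poly r x" if "x \<in> {a..b}" "y \<in> {a..b}" "x \<le> y" for x y
    proof (cases "x = y")
      case False
      then have "x < y" using that by auto
      from poly_mean_value[OF this, of r] obtain z
        where z: "x < z" "z < y" "poly r y - poly r x = (y - x) * poly (pderiv r) z" .
      have "(y - x) * poly (pderiv r) z \<le> 0" using * z that by (intro mult_nonneg_nonpos) auto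
      with z show ?thesis by linarith
    qed auto
    then show ?thesis by blast
  qed
  with assms(1) show ?thesis
    unfolding monotone_abs_def by (elim disjE) auto
qed

text \<open>At the midpoint some derivative of order j has size H^j, and j is not 1. Monotonicity
  keeps it that large on one half of the interval. Were this half much longer than 1/H,
  \<open>poly_large_of_higher_deriv_large\<close> for q' with n = j - 1 would push |q'| above
  H/2.\<close>

lemma sublevel_interval_short:
  fixes q :: "real poly"
  assumes uv: "u \<le> v" "0 \<le> u" "v \<le> 1" and H: "0 < H"
    and small: "\<And>t. t \<in> {u..v} \<Longrightarrow> \<bar>poly (pderiv q) t\<bar> \<le> H / 2"
    and mono: "\<And>j. j \<in> {1..d} \<Longrightarrow> monotone_abs (poly ((pderiv ^^ j) q)) u v"
    and ex: "\<And>t. t \<in> {0..1} \<Longrightarrow> \<exists>j\<in>{1..d}. H ^ j \<le> \<bar>poly ((pderiv ^^ j) q) t\<bar>"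
  shows "v - u \<le> 2 * 18 ^ (d * d) / H"
proof -
  define m where "m = (u + v) / 2"
  have m: "m \<in> {u..v}" "m \<in> {0..1}" using uv by (auto simp: m_def)
  obtain j where j: "j \<in> {1..d}" "H ^ j \<le> \<bar>poly ((pderiv ^^ j) q) m\<bar>" using ex m by blast
  have "j \<noteq> 1" using small[of m] j m H by auto
  then obtain n where n: "j = Suc n" "1 \<le> n" "n < d" using j by (cases j) auto
  have "(\<forall>t\<in>{u..m}. H ^ j \<le> \<bar>poly ((pderiv ^^ j) q) t\<bar>) \<or> (\<forall>t\<in>{m..v}. H ^ j \<le> \<bar>poly ((pderiv ^^ j) q) t\<bar>)"
    using mono[OF j(1)] unfolding monotone_abs_def
  proof
    assume *: "\<forall>x\<in>{u..v}. \<forall>y\<in>{u..v}. x \<le> y \<longrightarrow> \<bar>poly ((pderiv ^^ j) q) x\<bar> \<le> \<bar>poly ((pderiv ^^ j) q) y\<bar>"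
    have "H ^ j \<le> \<bar>poly ((pderiv ^^ j) q) t\<bar>" if "t \<in> {m..v}" for t
      using *[rule_format, of m t] that m j(2) by auto
    then show ?thesis by blast
  next
    assume *: "\<forall>x\<in>{u..v}. \<forall>y\<in>{u..v}. x \<le> y \<longrightarrow> \<bar>poly ((pderiv ^^ j) q) y\<bar> \<le> \<bar>poly ((pderiv ^^ j) q) x\<bar>"
    have "H ^ j \<le> \<bar>poly ((pderiv ^^ j) q) t\<bar>" if "t \<in> {u..m}" for t
      using *[rule_format, of t m] that m j(2) by auto
    then show ?thesis by blast
  qed
  then obtain a b where ab: "u \<le> a" "b \<le> v" "b - a = (v - u) / 2"
      "\<And>t. t \<in> {a..b} \<Longrightarrow> H ^ j \<le> \<bar>poly ((pderiv ^^ j) q) t\<bar>"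
  proof
    assume "\<forall>t\<in>{u..m}. H ^ j \<le> \<bar>poly ((pderiv ^^ j) q) t\<bar>"
    then show ?thesis by (intro that[of u m]) (use uv in \<open>auto simp: m_def field_simps\<close>)
  next
    assume "\<forall>t\<in>{m..v}. H ^ j \<le> \<bar>poly ((pderiv ^^ j) q) t\<bar>"
    then show ?thesis by (intro that[of m v]) (use uv in \<open>auto simp: m_def field_simps\<close>)
  qed
  have jn: "(pderiv ^^ j) q = (pderiv ^^ n) (pderiv q)" by (simp only: n funpow_Suc_right o_apply)
  have "\<exists>x\<in>{a..b}. H ^ j * (b - a) ^ n / 18 ^ (n * n) \<le> \<bar>poly (pderiv q) x\<bar>"
    by (rule poly_large_of_higher_deriv_large) (use ab uv H in \<open>auto simp: jn[symmetric]\<close>)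
  then obtain x where x: "x \<in> {a..b}" "H ^ j * (b - a) ^ n / 18 ^ (n * n) \<le> \<bar>poly (pderiv q) x\<bar>" by blast
  have "H ^ j * (b - a) ^ n / 18 ^ (n * n) \<le> H / 2"
    using order_trans[OF x(2) small[of x]] x(1) ab(1,2) by simp
  then have "H * (H * (b - a)) ^ n \<le> H * (18 ^ (n * n) / 2)"
    unfolding power_mult_distrib by (simp add: n field_simps)
  then have "(H * (b - a)) ^ n \<le> 18 ^ (n * n) / 2" using H by simp
  also have "\<dots> \<le> (18 ^ (d * d)) ^ 1"
  proof -
    have "(18::real) ^ (n * n) \<le> 18 ^ (d * d)" using n by (intro power_increasing mult_mono) auto
    moreover have "(0::real) \<le> 18 ^ (d * d)" by simp
    ultimately show ?thesis unfolding power_one_right by linarith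
  qed
  also have "\<dots> \<le> (18 ^ (d * d)) ^ n" using n by (intro power_increasing) auto
  finally have "H * (b - a) \<le> 18 ^ (d * d)"
    using n by (rule_tac power_le_imp_le_base[of _ "n - 1"]) auto
  then show ?thesis using H ab by (simp add: field_simps)
qed

text \<open>The guards \<open>a < e\<close> and \<open>e < b\<close> let one side be degenerate when
  the level is never crossed; at such a single point its inequality may fail.\<close>

lemma monotone_abs_level_split:
  assumes ab: "a \<le> b" and c: "continuous_on {a..b} f" and m: "monotone_abs f a b"
  obtains e where "a \<le> e" "e \<le> b"
    "(a < e \<longrightarrow> (\<forall>t\<in>{a..e}. \<bar>f t\<bar> \<le> l)) \<and> (e < b \<longrightarrow> (\<forall>t\<in>{e..b}. l \<le> \<bar>f t\<bar>)) \<or>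
     (a < e \<longrightarrow> (\<forall>t\<in>{a..e}. l \<le> \<bar>f t\<bar>)) \<and> (e < b \<longrightarrow> (\<forall>t\<in>{e..b}. \<bar>f t\<bar> \<le> l))"
proof -
  have c': "continuous_on {a..b} (\<lambda>t. \<bar>f t\<bar>)" using c by (intro continuous_intros)
  consider (ge) "\<forall>t\<in>{a..b}. l \<le> \<bar>f t\<bar>" | (le) "\<forall>t\<in>{a..b}. \<bar>f t\<bar> \<le> l"
    | (mix) x y where "x \<in> {a..b}" "\<bar>f x\<bar> < l" "y \<in> {a..b}" "l < \<bar>f y\<bar>"
    by (meson not_le)
  then show ?thesis
  proof cases
    case ge
    then show ?thesis using ab by (intro that[of b]) auto
  next
    case le
    then show ?thesis using ab by (intro that[of b]) auto
  next
    case mix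
    from m consider (inc) "\<forall>x\<in>{a..b}. \<forall>y\<in>{a..b}. x \<le> y \<longrightarrow> \<bar>f x\<bar> \<le> \<bar>f y\<bar>"
      | (dec) "\<forall>x\<in>{a..b}. \<forall>y\<in>{a..b}. x \<le> y \<longrightarrow> \<bar>f y\<bar> \<le> \<bar>f x\<bar>"
      unfolding monotone_abs_def by blast
    then show ?thesis
    proof cases
      case inc
      have "\<bar>f a\<bar> \<le> \<bar>f x\<bar>" "\<bar>f y\<bar> \<le> \<bar>f b\<bar>" using inc mix ab by auto
      then obtain e where "a \<le> e" "e \<le> b" "\<bar>f e\<bar> = l"
        using IVT'[of "\<lambda>t. \<bar>f t\<bar>" a l b] ab c' mix by auto
      then show ?thesis using inc by (intro that[of e]) auto
    next
      case dec
      have "\<bar>f x\<bar> \<ge> \<bar>f b\<bar>" "\<bar>f y\<bar> \<le> \<bar>f a\<bar>" using dec mix ab by auto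
      then obtain e where "a \<le> e" "e \<le> b" "\<bar>f e\<bar> = l"
        using IVT2'[of "\<lambda>t. \<bar>f t\<bar>" b l a] ab c' mix by auto
      then show ?thesis using dec by (intro that[of e]) auto
    qed
  qed
qed

lemma norm_integral_split_le:
  fixes f :: "real \<Rightarrow> complex"
  assumes "a \<le> e" "e \<le> b" "continuous_on {a..b} f"
  shows "norm (integral {a..b} f) \<le> norm (integral {a..e} f) + norm (integral {e..b} f)"
proof -
  have "integral {a..b} f = integral {a..e} f + integral {e..b} f"
    using assms by (intro Henstock_Kurzweil_Integration.integral_combine[symmetric] integrable_continuous_interval)
  then show ?thesis by (simp add: norm_triangle_ineq)
qed

lemma norm_integral_cis_le:
  assumes "a \<le> b" "continuous_on {a..b} f"
  shows "norm (integral {a..b} (\<lambda>t. cis (f t))) \<le> b - a"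
proof -
  have "norm (integral {a..b} (\<lambda>t. cis (f t))) \<le> integral {a..b} (\<lambda>t. 1::real)"
    by (rule integral_norm_bound_integral)
      (use assms in \<open>auto simp: cis_conv_exp intro!: integrable_continuous_interval continuous_intros\<close>)
  then show ?thesis using assms by simp
qed

text \<open>Cut at the largest point of Z inside the interval: the right piece is free of Z and the
  left one contains fewer points, so each induction step pays one more K.\<close>

lemma norm_integral_le_card_split:
  fixes f :: "real \<Rightarrow> complex"
  assumes "finite Z" "a \<le> b" "continuous_on {a..b} f" "card (Z \<inter> {a<..<b}) \<le> n" "0 \<le> K"
    and "\<And>u v. a \<le> u \<Longrightarrow> u \<le> v \<Longrightarrow> v \<le> b \<Longrightarrow> Z \<inter> {u<..<v} = {} \<Longrightarrow> norm (integral {u..v} f) \<le> K"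
  shows "norm (integral {a..b} f) \<le> (real n + 1) * K"
  using assms
proof (induction n arbitrary: a b)
  case 0
  then show ?case by (auto)
next
  case (Suc n)
  show ?case
  proof (cases "Z \<inter> {a<..<b} = {}")
    case True
    then have "norm (integral {a..b} f) \<le> 1 * K" using Suc.prems by auto
    also have "\<dots> \<le> (real (Suc n) + 1) * K" using Suc.prems by (intro mult_right_mono) auto
    finally show ?thesis .
  next
    case False
    define z where "z = Max (Z \<inter> {a<..<b})"
    have z: "z \<in> Z \<inter> {a<..<b}" using False Suc.prems unfolding z_def by (intro Max_in) auto
    have zm: "x \<le> z" if "x \<in> Z \<inter> {a<..<b}" for x using that Suc.prems(1) by (auto simp: z_def)
    have "card (Z \<inter> {a<..<z}) < card (Z \<inter> {a<..<b})"
      using z Suc.prems by (intro psubset_card_mono) auto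
    then have "norm (integral {a..z} f) \<le> (real n + 1) * K"
      using z Suc.prems
      by (intro Suc.IH) (auto intro: continuous_on_subset)
    moreover have "norm (integral {z..b} f) \<le> K"
      using z Suc.prems zm by (intro Suc.prems(6)) force+
    ultimately show ?thesis
      using norm_integral_split_le[of a z b f] z Suc.prems by (auto simp: algebra_simps)
  qed
qed

text \<open>Derivatives that vanish identically are left out: they would make Z infinite, and their
  sign is constant anyway.\<close>

lemma finite_card_deriv_roots:
  fixes q :: "real poly"
  assumes "degree q \<le> d"
  defines "Z \<equiv> (\<Union>j\<in>{j\<in>{1..d}. (pderiv ^^ j) q \<noteq> 0}. {t. poly ((pderiv ^^ j) q) t = 0})"
  shows "finite Z" "card Z \<le> d * d"
proof -
  show "finite Z" unfolding Z_def by (auto intro: poly_roots_finite)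
  have "card Z \<le> (\<Sum>j\<in>{j\<in>{1..d}. (pderiv ^^ j) q \<noteq> 0}. card {t. poly ((pderiv ^^ j) q) t = 0})"
    unfolding Z_def by (rule card_UN_le) auto
  also have "\<dots> \<le> (\<Sum>j\<in>{j\<in>{1..d}. (pderiv ^^ j) q \<noteq> 0}. d)"
  proof (rule sum_mono)
    fix j assume j: "j \<in> {j\<in>{1..d}. (pderiv ^^ j) q \<noteq> 0}"
    have "card {t. poly ((pderiv ^^ j) q) t = 0} \<le> degree ((pderiv ^^ j) q)"
      using j by (intro card_poly_roots_bound) auto
    also have "degree ((pderiv ^^ j) q) \<le> degree q"
      by (induction j) (auto simp: degree_pderiv)
    finally show "card {t. poly ((pderiv ^^ j) q) t = 0} \<le> d" using assms(1) by simp
  qed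
  also have "\<dots> = card {j\<in>{1..d}. (pderiv ^^ j) q \<noteq> 0} * d" by simp
  also have "\<dots> \<le> card {1..d} * d" by (intro mult_right_mono card_mono) auto
  finally show "card Z \<le> d * d" by simp
qed

text \<open>Between consecutive points of Z the derivatives of q have a fixed sign and a monotone
  modulus. One cut at |q'| = H/2 then leaves a piece for van der Corput, worth 8/H, and a short
  piece estimated by its length. There are at most d^2 + 1 gaps.\<close>

theorem poly_oscillatory_integral_bound:
  fixes q :: "real poly"
  assumes deg: "degree q \<le> d" and H: "0 < H"
    and ex: "\<And>t. t \<in> {0..1} \<Longrightarrow> \<exists>j\<in>{1..d}. H ^ j \<le> \<bar>poly ((pderiv ^^ j) q) t\<bar>"
  shows "norm (integral {0..1} (\<lambda>t. cis (poly q t))) \<le> (real (d * d) + 1) * ((2 * 18 ^ (d * d) + 8) / H)"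
proof -
  define Z where "Z = (\<Union>j\<in>{j\<in>{1..d}. (pderiv ^^ j) q \<noteq> 0}. {t. poly ((pderiv ^^ j) q) t = 0})"
  note Z = finite_card_deriv_roots[OF deg, folded Z_def]
  have cont: "continuous_on S (\<lambda>t. cis (poly q t))" for S
    unfolding cis_conv_exp by (intro continuous_intros)
  have d1: "1 \<le> d" using ex[of 0] by (cases d) auto
  show ?thesis
  proof (rule norm_integral_le_card_split[OF Z(1)])
    show "card (Z \<inter> {0<..<1}) \<le> d * d"
      using Z by (meson card_mono inf_le1 order_trans)
    fix u v :: real assume uv: "0 \<le> u" "u \<le> v" "v \<le> 1" and Zuv: "Z \<inter> {u<..<v} = {}"
    have sgn: "(\<forall>t\<in>{u..v}. 0 \<le> poly ((pderiv ^^ j) q) t) \<or> (\<forall>t\<in>{u..v}. poly ((pderiv ^^ j) q) t \<le> 0)"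
      if "1 \<le> j" for j
    proof (cases "(pderiv ^^ j) q = 0")
      case False
      \<comment> \<open>Monotonicity of the derivative of order d needs the sign of order d + 1, so
        orders above d must be covered too; they vanish identically.\<close>
      have "j \<le> d"
      proof (rule ccontr)
        assume "\<not> j \<le> d"
        then obtain i where i: "j = i + Suc d" by (metis add.commute less_iff_Suc_add not_le add_Suc_right)
        have dd: "degree ((pderiv ^^ k) q) = degree q - k" for k
          by (induction k) (auto simp: degree_pderiv)
        have "degree ((pderiv ^^ d) q) = 0" using dd[of d] deg by simp
        then have "(pderiv ^^ Suc d) q = 0" by (simp add: pderiv_eq_0_iff)
        then have "(pderiv ^^ (i + Suc d)) q = 0" unfolding funpow_add o_apply
          by simp
        with False i show False by simp
      qed
      with False that Zuv show ?thesis
        by (intro poly_constant_sign) (auto simp: Z_def)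
    qed auto
    have mono: "monotone_abs (poly ((pderiv ^^ j) q)) u v" if "1 \<le> j" for j
      using sgn[of j] sgn[of "Suc j"] that by (intro poly_monotone_abs) auto
    obtain e where e: "u \<le> e" "e \<le> v"
      "(u < e \<longrightarrow> (\<forall>t\<in>{u..e}. \<bar>poly (pderiv q) t\<bar> \<le> H/2)) \<and> (e < v \<longrightarrow> (\<forall>t\<in>{e..v}. H/2 \<le> \<bar>poly (pderiv q) t\<bar>)) \<or>
       (u < e \<longrightarrow> (\<forall>t\<in>{u..e}. H/2 \<le> \<bar>poly (pderiv q) t\<bar>)) \<and> (e < v \<longrightarrow> (\<forall>t\<in>{e..v}. \<bar>poly (pderiv q) t\<bar> \<le> H/2))"
      by (rule monotone_abs_level_split[of u v "poly (pderiv q)" "H/2"])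
        (use mono[of 1] uv in \<open>auto intro!: continuous_intros\<close>)
    have sgn2: "(\<forall>t\<in>{u..v}. 0 \<le> poly (pderiv (pderiv q)) t) \<or> (\<forall>t\<in>{u..v}. poly (pderiv (pderiv q)) t \<le> 0)"
      using sgn[of 2] by (simp add: numeral_2_eq_2)
    have big: "norm (integral {a..b} (\<lambda>t. cis (poly q t))) \<le> 8 / H"
      if "u \<le> a" "a \<le> b" "b \<le> v" "a < b \<longrightarrow> (\<forall>t\<in>{a..b}. H/2 \<le> \<bar>poly (pderiv q) t\<bar>)" for a b
    proof (cases "a = b")
      case False
      have "(\<forall>t\<in>{a..b}. 0 \<le> poly (pderiv (pderiv q)) t) \<or> (\<forall>t\<in>{a..b}. poly (pderiv (pderiv q)) t \<le> 0)"
        using sgn2 that by (elim disjE) auto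
      then have "norm (integral {a..b} (\<lambda>t. cis (poly q t))) \<le> 4 / (H / 2)"
        using False that H by (intro van_der_Corput_poly) auto
      then show ?thesis by simp
    qed (use H in auto)
    have small: "norm (integral {a..b} (\<lambda>t. cis (poly q t))) \<le> 2 * 18 ^ (d * d) / H"
      if ab: "u \<le> a" "a \<le> b" "b \<le> v" "a < b \<longrightarrow> (\<forall>t\<in>{a..b}. \<bar>poly (pderiv q) t\<bar> \<le> H/2)" for a b
    proof (cases "a = b")
      case False
      have "b - a \<le> 2 * 18 ^ (d * d) / H"
      proof (rule sublevel_interval_short[where q = q])
        show "monotone_abs (poly ((pderiv ^^ j) q)) a b" if "j \<in> {1..d}" for j
          using mono[of j] that ab monotone_abs_subinterval by auto
      qed (use ab False H ex uv in auto)
      moreover have "norm (integral {a..b} (\<lambda>t. cis (poly q t))) \<le> b - a"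
        by (rule norm_integral_cis_le) (use ab in \<open>auto intro!: continuous_intros\<close>)
      ultimately show ?thesis by linarith
    qed (use H in auto)
    have "norm (integral {u..e} (\<lambda>t. cis (poly q t))) + norm (integral {e..v} (\<lambda>t. cis (poly q t)))
        \<le> 2 * 18 ^ (d * d) / H + 8 / H"
      using e(3)
    proof
      assume *: "(u < e \<longrightarrow> (\<forall>t\<in>{u..e}. \<bar>poly (pderiv q) t\<bar> \<le> H/2)) \<and> (e < v \<longrightarrow> (\<forall>t\<in>{e..v}. H/2 \<le> \<bar>poly (pderiv q) t\<bar>))"
      show ?thesis by (intro add_mono small big) (use * e in auto)
    next
      assume *: "(u < e \<longrightarrow> (\<forall>t\<in>{u..e}. H/2 \<le> \<bar>poly (pderiv q) t\<bar>)) \<and> (e < v \<longrightarrow> (\<forall>t\<in>{e..v}. \<bar>poly (pderiv q) t\<bar> \<le> H/2))"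
      show ?thesis by (subst add.commute, intro add_mono small big) (use * e in auto)
    qed
    then show "norm (integral {u..v} (\<lambda>t. cis (poly q t))) \<le> (2 * 18 ^ (d * d) + 8) / H"
      using norm_integral_split_le[OF e(1,2) cont] by (simp add: add_divide_distrib)
  qed (use H cont in auto)
qed

section \<open>The phase of the moment curve and its Taylor shifts\<close>

text \<open>The k-th derivative of x^n / n! at t. As a matrix in (k, n) this is exp(t J) for the
  nilpotent shift J.\<close>

definition taylor_coeff :: "real \<Rightarrow> nat \<Rightarrow> nat \<Rightarrow> real" where
  "taylor_coeff t k n = (if k \<le> n then t ^ (n - k) / fact (n - k) else 0)"

lemma poly_higher_pderiv_monom:
  "poly ((pderiv ^^ k) (monom c n)) t = c * fact n * taylor_coeff t k n"
proof (induction k arbitrary: c n)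
  case 0
  then show ?case by (simp add: taylor_coeff_def poly_monom)
next
  case (Suc k)
  have "(pderiv ^^ Suc k) (monom c n) = (pderiv ^^ k) (monom (of_nat n * c) (n - 1))"
    by (simp only: funpow_Suc_right o_apply pderiv_monom)
  then show ?case
    by (cases n) (auto simp: Suc.IH taylor_coeff_def)
qed

text \<open>The binomial theorem divided by (b - a)!, which is the group law of these
  matrices.\<close>

lemma taylor_coeff_add:
  assumes "b \<le> d"
  shows "(\<Sum>k\<in>{a..d}. taylor_coeff h a k * taylor_coeff t k b) = taylor_coeff (h + t) a b"
proof (cases "a \<le> b")
  case True
  have "(\<Sum>k\<in>{a..d}. taylor_coeff h a k * taylor_coeff t k b) = (\<Sum>k\<in>{a..b}. taylor_coeff h a k * taylor_coeff t k b)"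
    using assms by (intro sum.mono_neutral_right) (auto simp: taylor_coeff_def)
  also have "\<dots> = (\<Sum>i\<le>b - a. h ^ i / fact i * (t ^ (b - a - i) / fact (b - a - i)))"
    using True
    by (intro sum.reindex_bij_witness[of _ "\<lambda>i. i + a" "\<lambda>k. k - a"]) (auto simp: taylor_coeff_def)
  also have "\<dots> = (\<Sum>i\<le>b - a. of_nat ((b - a) choose i) * h ^ i * t ^ (b - a - i)) / fact (b - a)"
    unfolding sum_divide_distrib
    by (intro sum.cong) (auto simp: binomial_fact)
  also have "\<dots> = (h + t) ^ (b - a) / fact (b - a)" by (simp add: binomial_ring)
  finally show ?thesis using True by (simp add: taylor_coeff_def)
next
  case False
  then show ?thesis by (auto simp: taylor_coeff_def intro!: sum.neutral)
qed

text \<open>The factorials cancel those produced by differentiation, so the derivatives at 0 are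
  exactly the coordinates of \<xi>.\<close>

definition phase_poly :: "('n::finite \<Rightarrow> nat) \<Rightarrow> real ^ 'n \<Rightarrow> real poly" where
  "phase_poly idx \<xi> = (\<Sum>i\<in>UNIV. monom (\<xi> $ i / fact (idx i)) (idx i))"

definition taylor_matrix :: "('n::finite \<Rightarrow> nat) \<Rightarrow> real \<Rightarrow> real ^ 'n ^ 'n" where
  "taylor_matrix idx t = (\<chi> i j. taylor_coeff t (idx i) (idx j))"

definition taylor_shift :: "('n::finite \<Rightarrow> nat) \<Rightarrow> real \<Rightarrow> real ^ 'n \<Rightarrow> real ^ 'n" where
  "taylor_shift idx t \<xi> = taylor_matrix idx t *v \<xi>"

lemma taylor_shift_nth:
  "taylor_shift idx t \<xi> $ i = (\<Sum>j\<in>UNIV. taylor_coeff t (idx i) (idx j) * \<xi> $ j)"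
  by (simp add: taylor_shift_def taylor_matrix_def matrix_vector_mult_def)

lemma poly_pderiv_phase_poly:
  "poly ((pderiv ^^ k) (phase_poly idx \<xi>)) t = (\<Sum>j\<in>UNIV. taylor_coeff t k (idx j) * \<xi> $ j)"
  by (simp add: phase_poly_def higher_pderiv_sum poly_sum poly_higher_pderiv_monom mult.commute)

lemma poly_pderiv_phase_poly_idx:
  "poly ((pderiv ^^ idx i) (phase_poly idx \<xi>)) t = taylor_shift idx t \<xi> $ i"
  by (simp add: poly_pderiv_phase_poly taylor_shift_nth)

lemma poly_phase_poly:
  "poly (phase_poly idx \<xi>) t = (\<Sum>j\<in>UNIV. taylor_coeff t 0 (idx j) * \<xi> $ j)"
  using poly_pderiv_phase_poly[of 0] by simp

lemma inner_moment_map: "\<xi> \<bullet> moment_map idx t = poly (phase_poly idx \<xi>) t"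
  by (simp add: inner_vec_def moment_map_def poly_phase_poly taylor_coeff_def mult.commute)

lemma continuous_on_moment_map: "continuous_on S (moment_map idx)"
  unfolding moment_map_def
  by (intro continuous_on_vec_lambda continuous_intros) auto

lemma continuous_on_taylor_coeff [continuous_intros]:
  "continuous_on S f \<Longrightarrow> continuous_on S (\<lambda>x. taylor_coeff (f x) k n)"
  unfolding taylor_coeff_def by (cases "k \<le> n") (auto intro!: continuous_intros)

lemma borel_measurable_moment_map [measurable]: "moment_map idx \<in> borel_measurable borel"
  by (rule borel_measurable_continuous_onI[OF continuous_on_moment_map])

lemma finite_measure_moment_measure: "finite_measure (moment_measure idx)"
  unfolding moment_measure_def
proof (rule finite_measure.finite_measure_distr)
  show "finite_measure (restrict_space lborel {0..1::real})"
    by (rule finite_measureI) (simp add: emeasure_restrict_space space_restrict_space)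
  show "moment_map idx \<in> restrict_space lborel {0..1} \<rightarrow>\<^sub>M borel"
    by (rule measurable_restrict_space1) simp
qed

lemma fourier_transform_moment_measure:
  "fourier_transform (moment_measure idx) \<xi> = integral {0..1} (\<lambda>t. cis (- 2 * pi * poly (phase_poly idx \<xi>) t))"
proof -
  have [measurable]: "moment_map idx \<in> restrict_space lborel {0..1} \<rightarrow>\<^sub>M borel"
    by (rule measurable_restrict_space1) simp
  define f where "f t = cis (- 2 * pi * poly (phase_poly idx \<xi>) t)" for t
  have f: "exp (- 2 * of_real pi * \<i> * of_real (\<xi> \<bullet> moment_map idx t)) = f t" for t
    by (simp add: f_def cis_conv_exp inner_moment_map mult_ac)
  have "fourier_transform (moment_measure idx) \<xi>
      = (\<integral>t. exp (- 2 * of_real pi * \<i> * of_real (\<xi> \<bullet> moment_map idx t)) \<partial>restrict_space lborel {0..1})"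
    unfolding fourier_transform_def moment_measure_def by (rule integral_distr) measurable
  also have "\<dots> = (LINT t:{0..1}|lborel. f t)"
    unfolding f by (subst integral_restrict_space) (simp_all add: set_lebesgue_integral_def)
  also have "\<dots> = integral {0..1} f"
  proof (rule set_borel_integral_eq_integral)
    show "set_integrable lborel {0..1} f"
      unfolding f_def cis_conv_exp
      by (intro borel_integrable_atLeastAtMost' continuous_intros)
  qed
  finally show ?thesis by (simp add: f_def[abs_def])
qed

lemma borel_measurable_fourier_transform:
  assumes "finite_measure \<mu>" and [measurable_cong]: "sets \<mu> = sets borel"
  shows "fourier_transform \<mu> \<in> borel_measurable borel"
proof -
  interpret finite_measure \<mu> by fact
  show ?thesis unfolding fourier_transform_def[abs_def]
    by (intro borel_measurable_lebesgue_integral) measurable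
qed

lemma borel_measurable_fourier_moment [measurable]:
  "fourier_transform (moment_measure idx) \<in> borel_measurable borel"
  by (rule borel_measurable_fourier_transform[OF finite_measure_moment_measure])
    (simp add: moment_measure_def)

section \<open>Lebesgue measure under translations and shears\<close>

lemma nn_integral_lborel_translate:
  fixes c :: "'a::euclidean_space"
  assumes [measurable]: "f \<in> borel_measurable borel"
  shows "(\<integral>\<^sup>+x. f (x + c) \<partial>lborel) = (\<integral>\<^sup>+x. f x \<partial>lborel)"
proof -
  have "(\<integral>\<^sup>+x. f x \<partial>distr lborel borel ((+) c)) = (\<integral>\<^sup>+x. f (c + x) \<partial>lborel)"
    by (rule nn_integral_distr) measurable
  then show ?thesis by (simp add: lborel_distr_plus add.commute)
qed

text \<open>Averaging over translations along \<open>e\<close> absorbs the shear into a one-dimensional translation.\<close>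

lemma nn_integral_shear:
  fixes e :: "'a::euclidean_space" and f :: "'a \<Rightarrow> ennreal"
  assumes e: "e \<in> Basis" and f [measurable]: "f \<in> borel_measurable borel"
    and "\<phi> \<in> borel_measurable borel" and "\<And>x \<tau>. \<phi> (x + \<tau> *\<^sub>R e) = \<phi> x"
  shows "(\<integral>\<^sup>+x. f (x + \<phi> x *\<^sub>R e) \<partial>lborel) = (\<integral>\<^sup>+x. f x \<partial>lborel)"
proof -
  \<comment> \<open>The right-hand side does not contain \<phi>, so using this for \<phi> and for 0
    gives the claim. The factor 1 inserted in the proof is the integral over \<tau> of a unit window
    in the coordinate along \<open>e\<close>.\<close>
  have key: "(\<integral>\<^sup>+x. f (x + \<phi> x *\<^sub>R e) \<partial>lborel)
      = (\<integral>\<^sup>+x. indicator {0..1} (x \<bullet> e) * (\<integral>\<^sup>+\<tau>. f (x + \<tau> *\<^sub>R e) \<partial>lborel) \<partial>lborel)"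
    if [measurable]: "\<phi> \<in> borel_measurable borel" and inv: "\<And>x \<tau>. \<phi> (x + \<tau> *\<^sub>R e) = \<phi> x" for \<phi>
  proof -
    have ee: "e \<bullet> e = 1" using e by simp
    have "(\<integral>\<^sup>+\<tau>. indicator {0..1} (x \<bullet> e + \<tau>) \<partial>lborel) = (1::ennreal)" for x
    proof -
      have "(\<integral>\<^sup>+\<tau>. indicator {0..1} (x \<bullet> e + \<tau>) \<partial>lborel) = (\<integral>\<^sup>+\<tau>. indicator {- (x \<bullet> e)..1 - x \<bullet> e} \<tau> \<partial>lborel :: ennreal)"
        by (intro nn_integral_cong) (auto split: split_indicator)
      then show ?thesis by simp
    qed
    then have "(\<integral>\<^sup>+x. f (x + \<phi> x *\<^sub>R e) \<partial>lborel)
       = (\<integral>\<^sup>+x. (\<integral>\<^sup>+\<tau>. f (x + \<phi> x *\<^sub>R e) * indicator {0..1} (x \<bullet> e + \<tau>) \<partial>lborel) \<partial>lborel)"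
      by (simp add: nn_integral_cmult)
    also have "\<dots> = (\<integral>\<^sup>+\<tau>. (\<integral>\<^sup>+x. f (x + \<phi> x *\<^sub>R e) * indicator {0..1} (x \<bullet> e + \<tau>) \<partial>lborel) \<partial>lborel)"
      by (rule lborel_pair.Fubini'[symmetric]) measurable
    also have "\<dots> = (\<integral>\<^sup>+\<tau>. (\<integral>\<^sup>+x. f (x + (\<phi> x - \<tau>) *\<^sub>R e) * indicator {0..1} (x \<bullet> e) \<partial>lborel) \<partial>lborel)"
    proof (rule nn_integral_cong)
      fix \<tau> :: real
      have "(\<integral>\<^sup>+x. f (x + \<phi> x *\<^sub>R e) * indicator {0..1} (x \<bullet> e + \<tau>) \<partial>lborel)
        = (\<integral>\<^sup>+x. f ((x + (- \<tau>) *\<^sub>R e) + \<phi> (x + (- \<tau>) *\<^sub>R e) *\<^sub>R e) * indicator {0..1} ((x + (- \<tau>) *\<^sub>R e) \<bullet> e + \<tau>) \<partial>lborel)"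
        by (rule nn_integral_lborel_translate[symmetric]) measurable
      also have "\<dots> = (\<integral>\<^sup>+x. f (x + (\<phi> x - \<tau>) *\<^sub>R e) * indicator {0..1} (x \<bullet> e) \<partial>lborel)"
        unfolding inv by (simp add: inner_add_left ee algebra_simps)
      finally show "(\<integral>\<^sup>+x. f (x + \<phi> x *\<^sub>R e) * indicator {0..1} (x \<bullet> e + \<tau>) \<partial>lborel)
        = (\<integral>\<^sup>+x. f (x + (\<phi> x - \<tau>) *\<^sub>R e) * indicator {0..1} (x \<bullet> e) \<partial>lborel)" .
    qed
    also have "\<dots> = (\<integral>\<^sup>+x. (\<integral>\<^sup>+\<tau>. f (x + (\<phi> x - \<tau>) *\<^sub>R e) * indicator {0..1} (x \<bullet> e) \<partial>lborel) \<partial>lborel)"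
      by (rule lborel_pair.Fubini') measurable
    also have "\<dots> = (\<integral>\<^sup>+x. indicator {0..1} (x \<bullet> e) * (\<integral>\<^sup>+\<tau>. f (x + \<tau> *\<^sub>R e) \<partial>lborel) \<partial>lborel)"
    proof (rule nn_integral_cong)
      fix x :: 'a
      have "(\<integral>\<^sup>+\<tau>. f (x + \<tau> *\<^sub>R e) \<partial>lborel) = ennreal \<bar>-1\<bar> * (\<integral>\<^sup>+\<tau>. f (x + (\<phi> x + (-1) * \<tau>) *\<^sub>R e) \<partial>lborel)"
        by (rule nn_integral_real_affine) auto
      then show "(\<integral>\<^sup>+\<tau>. f (x + (\<phi> x - \<tau>) *\<^sub>R e) * indicator {0..1} (x \<bullet> e) \<partial>lborel)
         = indicator {0..1} (x \<bullet> e) * (\<integral>\<^sup>+\<tau>. f (x + \<tau> *\<^sub>R e) \<partial>lborel)"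
        by (subst nn_integral_multc) (simp_all add: mult.commute)
    qed
    finally show ?thesis .
  qed
  have "(\<integral>\<^sup>+x. f x \<partial>lborel) = (\<integral>\<^sup>+x. f (x + 0 *\<^sub>R e) \<partial>lborel)" by simp
  also have "\<dots> = (\<integral>\<^sup>+x. indicator {0..1} (x \<bullet> e) * (\<integral>\<^sup>+\<tau>. f (x + \<tau> *\<^sub>R e) \<partial>lborel) \<partial>lborel)"
    by (rule key) auto
  finally show ?thesis using key[OF assms(3,4)] by simp
qed

section \<open>The group of Taylor shifts\<close>

locale moment_index =
  fixes idx :: "'n::finite \<Rightarrow> nat" and d :: nat
  assumes bij: "bij_betw idx UNIV {1..d}" and d2: "2 \<le> d"
begin

lemma idx_range: "1 \<le> idx i" "idx i \<le> d"
  using bij_betwE[OF bij] by auto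

lemma idx_eq_iff: "idx i = idx j \<longleftrightarrow> i = j"
  using bij_betw_imp_inj_on[OF bij] by (simp add: inj_eq)

lemma card_index: "CARD('n) = d"
  using bij_betw_same_card[OF bij] by simp

lemma ex_idx: "1 \<le> k \<Longrightarrow> k \<le> d \<Longrightarrow> \<exists>i. idx i = k"
  using bij_betw_imp_surj_on[OF bij] by (metis atLeastAtMost_iff imageE)

lemma sum_idx: "(\<Sum>i\<in>UNIV. f (idx i)) = (\<Sum>k\<in>{1..d}. f k)"
  using sum.reindex_bij_betw[OF bij] .

lemma taylor_matrix_mult: "taylor_matrix idx h ** taylor_matrix idx t = taylor_matrix idx (h + t)"
proof -
  have "(\<Sum>k\<in>UNIV. taylor_coeff h (idx i) (idx k) * taylor_coeff t (idx k) (idx j)) = taylor_coeff (h + t) (idx i) (idx j)" for i j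
  proof -
    have "(\<Sum>k\<in>UNIV. taylor_coeff h (idx i) (idx k) * taylor_coeff t (idx k) (idx j))
       = (\<Sum>k\<in>{1..d}. taylor_coeff h (idx i) k * taylor_coeff t k (idx j))" by (rule sum_idx)
    also have "\<dots> = (\<Sum>k\<in>{idx i..d}. taylor_coeff h (idx i) k * taylor_coeff t k (idx j))"
      using idx_range(1)[of i] by (intro sum.mono_neutral_right) (auto simp: taylor_coeff_def)
    finally show ?thesis by (simp add: taylor_coeff_add idx_range)
  qed
  then show ?thesis
    by (simp add: taylor_matrix_def matrix_matrix_mult_def vec_eq_iff)
qed

lemma taylor_matrix_0: "taylor_matrix idx 0 = mat 1"
  by (auto simp: taylor_matrix_def mat_def vec_eq_iff taylor_coeff_def idx_eq_iff dest: le_neq_implies_less)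

lemma taylor_shift_add: "taylor_shift idx h (taylor_shift idx t \<xi>) = taylor_shift idx (h + t) \<xi>"
  by (simp add: taylor_shift_def matrix_vector_mul_assoc taylor_matrix_mult)

lemma taylor_shift_0 [simp]: "taylor_shift idx 0 \<xi> = \<xi>"
  by (simp add: taylor_shift_def taylor_matrix_0)

lemma taylor_shift_inverse [simp]:
  "taylor_shift idx t (taylor_shift idx (- t) \<xi>) = \<xi>" "taylor_shift idx (- t) (taylor_shift idx t \<xi>) = \<xi>"
  by (simp_all add: taylor_shift_add)

text \<open>Taylor expansion at t. The value at t stands apart because the shifted vector records
  only the derivatives of orders 1 to d.\<close>

lemma poly_phase_poly_add:
  "poly (phase_poly idx \<xi>) (t + h) = poly (phase_poly idx \<xi>) t + poly (phase_poly idx (taylor_shift idx t \<xi>)) h"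
proof -
  have *: "taylor_coeff t 0 n + (\<Sum>i\<in>UNIV. taylor_coeff h 0 (idx i) * taylor_coeff t (idx i) n) = taylor_coeff (t + h) 0 n"
    if "n \<le> d" for n
  proof -
    have "taylor_coeff (h + t) 0 n = (\<Sum>k\<in>{0..d}. taylor_coeff h 0 k * taylor_coeff t k n)"
      using taylor_coeff_add[OF that, of h 0 t] by simp
    also have "{0..d} = insert 0 {1..d}" by auto
    finally show ?thesis
      by (simp add: sum_idx[of "\<lambda>k. taylor_coeff h 0 k * taylor_coeff t k n"] add.commute taylor_coeff_def[of h 0 0])
  qed
  have "poly (phase_poly idx (taylor_shift idx t \<xi>)) h
     = (\<Sum>j\<in>UNIV. (\<Sum>i\<in>UNIV. taylor_coeff h 0 (idx i) * taylor_coeff t (idx i) (idx j)) * \<xi> $ j)"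
    unfolding poly_phase_poly taylor_shift_nth sum_distrib_left sum_distrib_right
    by (subst sum.swap) (simp add: mult.assoc)
  then show ?thesis
    unfolding poly_phase_poly
    by (simp add: sum.distrib[symmetric] distrib_right[symmetric] *[OF idx_range(2)])
qed

text \<open>The constant term of the Taylor expansion is a unimodular factor, so the transform can
  be read in the coordinates T_t0 \<xi> centred at t0.\<close>

lemma norm_fourier_moment_eq:
  "cmod (fourier_transform (moment_measure idx) \<xi>)
     = cmod (integral {0..1} (\<lambda>t. cis (- 2 * pi * poly (phase_poly idx (taylor_shift idx t0 \<xi>)) (t - t0))))"
proof -
  have *: "cis (- 2 * pi * poly (phase_poly idx \<xi>) t)
     = cis (- 2 * pi * poly (phase_poly idx \<xi>) t0) * cis (- 2 * pi * poly (phase_poly idx (taylor_shift idx t0 \<xi>)) (t - t0))" for t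
    using poly_phase_poly_add[of \<xi> t0 "t - t0"] by (simp add: cis_mult ring_distribs)
  have "fourier_transform (moment_measure idx) \<xi> = integral {0..1} (\<lambda>t. cis (- 2 * pi * poly (phase_poly idx \<xi>) t0) * cis (- 2 * pi * poly (phase_poly idx (taylor_shift idx t0 \<xi>)) (t - t0)))"
    unfolding fourier_transform_moment_measure by (rule integral_cong) (rule *)
  also have "\<dots> = cis (- 2 * pi * poly (phase_poly idx \<xi>) t0) * integral {0..1} (\<lambda>t. cis (- 2 * pi * poly (phase_poly idx (taylor_shift idx t0 \<xi>)) (t - t0)))"
    by (rule integral_mult_right)
  finally show ?thesis by (simp add: norm_mult)
qed

lemma continuous_on_taylor_shift [continuous_intros]:
  assumes "continuous_on S f" "continuous_on S g"
  shows "continuous_on S (\<lambda>x. taylor_shift idx (f x) (g x))"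
  unfolding taylor_shift_def taylor_matrix_def matrix_vector_mult_def
  using assms by (auto intro!: continuous_intros)

lemma borel_measurable_taylor_shift [measurable]: "taylor_shift idx t \<in> borel_measurable borel"
  by (rule borel_measurable_continuous_onI) (intro continuous_intros)

lemma borel_measurable_taylor_shift_pair [measurable (raw)]:
  assumes "f \<in> borel_measurable M" "g \<in> borel_measurable M"
  shows "(\<lambda>x. taylor_shift idx (f x) (g x)) \<in> borel_measurable M"
proof -
  have "continuous_on UNIV (\<lambda>p. taylor_shift idx (fst p) (snd p))" by (intro continuous_intros)
  from borel_measurable_continuous_Pair[OF assms, of "taylor_shift idx"] this show ?thesis
    by (simp add: split_beta')
qed

lemma nn_integral_taylor_shift:
  assumes f: "f \<in> borel_measurable borel"
  shows "(\<integral>\<^sup>+x. f (taylor_shift idx t x) \<partial>lborel) = (\<integral>\<^sup>+x. f x \<partial>lborel)"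
proof -
  \<comment> \<open>The shift is the composition of the shears that update one coordinate each, in increasing order of \<open>idx\<close>.\<close>
  define T where "T k x = (\<chi> i. if idx i \<le> k then taylor_shift idx t x $ i else x $ i)" for k x
  have "(\<integral>\<^sup>+x. f (T k x) \<partial>lborel) = (\<integral>\<^sup>+x. f x \<partial>lborel)" if "k \<le> d" for k
    using that f
  proof (induction k arbitrary: f)
    case 0
    have "\<not> idx i \<le> 0" for i using idx_range(1)[of i] by simp
    then have "T 0 x = x" for x by (simp only: T_def vec_eq_iff vec_lambda_beta if_False) simp
    then show ?case by simp
  next
    case (Suc k)
    obtain i where i: "idx i = Suc k" using ex_idx[of "Suc k"] Suc.prems by auto
    \<comment> \<open>\<phi> uses only coordinates of order above k + 1. \<open>T k\<close> has not
      changed these, which is why the increasing order works, and \<phi> is constant along the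
      coordinate that is being updated.\<close>
    define \<phi> where "\<phi> x = (\<Sum>j | Suc k < idx j. taylor_coeff t (Suc k) (idx j) * x $ j)" for x :: "real ^ 'n"
    have T: "T (Suc k) x = T k x + \<phi> (T k x) *\<^sub>R axis i 1" for x
    proof (rule vec_eq_iff[THEN iffD2, rule_format])
      fix l
      have h1: "taylor_shift idx t x $ i = x $ i + \<phi> x"
      proof -
        have "(\<Sum>j\<in>UNIV. taylor_coeff t (idx i) (idx j) * x $ j)
            = (\<Sum>j\<in>insert i {j. Suc k < idx j}. taylor_coeff t (idx i) (idx j) * x $ j)"
          using i by (intro sum.mono_neutral_right) (auto simp: taylor_coeff_def idx_eq_iff[symmetric])
        also have "\<dots> = x $ i + \<phi> x"
          using i by (subst sum.insert) (auto simp: \<phi>_def taylor_coeff_def)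
        finally show ?thesis by (simp add: taylor_shift_nth)
      qed
      have h2: "\<phi> (T k x) = \<phi> x"
        unfolding \<phi>_def by (intro sum.cong) (auto simp: T_def)
      show "T (Suc k) x $ l = (T k x + \<phi> (T k x) *\<^sub>R axis i 1) $ l"
      proof (cases "l = i")
        case True
        then show ?thesis unfolding h2 using h1 i by (simp add: T_def)
      next
        case False
        then have "idx l \<noteq> Suc k" using i by (metis idx_eq_iff)
        then show ?thesis using False by (simp add: T_def axis_def le_Suc_eq)
      qed
    qed
    have [measurable]: "\<phi> \<in> borel_measurable borel"
      unfolding \<phi>_def by (intro borel_measurable_continuous_onI continuous_intros)
    have [measurable]: "f \<in> borel_measurable borel" by (rule Suc.prems)
    have "(\<integral>\<^sup>+x. f (T (Suc k) x) \<partial>lborel) = (\<integral>\<^sup>+x. f (T k x + \<phi> (T k x) *\<^sub>R axis i 1) \<partial>lborel)"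
      by (simp only: T)
    also have "\<dots> = (\<integral>\<^sup>+x. f (x + \<phi> x *\<^sub>R axis i 1) \<partial>lborel)"
      by (rule Suc.IH) (use Suc.prems in auto)
    also have "\<dots> = (\<integral>\<^sup>+x. f x \<partial>lborel)"
      by (rule nn_integral_shear[OF axis_in_Basis_iff[THEN iffD2]]) (use i in \<open>auto simp: \<phi>_def axis_def intro!: sum.cong\<close>)
    finally show ?case .
  qed
  from this[of d] have "(\<integral>\<^sup>+x. f (T d x) \<partial>lborel) = (\<integral>\<^sup>+x. f x \<partial>lborel)" by simp
  moreover have "T d x = taylor_shift idx t x" for x
    by (simp add: T_def idx_range)
  ultimately show ?thesis by simp
qed

end

section \<open>The anisotropic gauge and the upper bound for the energy\<close>

lemma gauss_sum_real: "(\<Sum>j\<in>{1..k}. real j) = real k * (real k + 1) / 2"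
  by (induction k) (auto simp: field_simps)

text \<open>To be applied with M, L and y_k the logarithms of the gauge, the sup gauge and the
  coordinates. In the worst case y_k = min(k M, L); then the left side is piecewise linear in L for
  fixed M, with breaks at L = k M, and \<open>cond\<close> says that it is nonpositive at these
  breaks.\<close>

lemma sum_le_piecewise_linear_bound:
  fixes M L A a \<beta> :: real and y :: "nat \<Rightarrow> real"
  assumes d: "1 \<le> d" and M: "0 \<le> M" "M \<le> L" "L \<le> real d * M" and \<beta>: "0 \<le> \<beta>"
    and y: "\<And>k. k \<in> {1..d} \<Longrightarrow> y k \<le> real k * M" "\<And>k. k \<in> {1..d} \<Longrightarrow> y k \<le> L"
    and cond: "\<And>k. k \<in> {1..d} \<Longrightarrow> A + a * real k + \<beta> * (real k * (real k + 1) / 2 + (real d - real k) * real k) \<le> 0"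
  shows "A * M + a * L + \<beta> * (\<Sum>k\<in>{1..d}. y k) \<le> 0"
proof -
  \<comment> \<open>For M > 0, the \<open>k\<close> defined next is the integer part of L /
    M.\<close>
  define K where "K = {k \<in> {1..d}. real k * M \<le> L}"
  define k where "k = Max K"
  have "1 \<in> K" using d M by (auto simp: K_def)
  then have kK: "k \<in> K" unfolding k_def by (intro Max_in) (auto simp: K_def)
  have kmax: "j \<le> k" if "j \<in> K" for j using that by (auto simp: k_def K_def)
  have k: "1 \<le> k" "k \<le> d" "real k * M \<le> L" using kK by (auto simp: K_def)
  have "(\<Sum>j\<in>{1..d}. y j) = (\<Sum>j\<in>{1..k}. y j) + (\<Sum>j\<in>{Suc k..d}. y j)"
    using k by (subst sum.union_disjoint[symmetric]) (auto intro!: sum.cong)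
  also have "\<dots> \<le> (\<Sum>j\<in>{1..k}. real j * M) + (\<Sum>j\<in>{Suc k..d}. L)"
    using k by (intro add_mono sum_mono y) auto
  also have "\<dots> = real k * (real k + 1) / 2 * M + (real d - real k) * L"
    unfolding sum_distrib_right[symmetric] gauss_sum_real using k by (simp add: of_nat_diff)
  finally have "\<beta> * (\<Sum>j\<in>{1..d}. y j) \<le> \<beta> * (real k * (real k + 1) / 2 * M + (real d - real k) * L)"
    using \<beta> by (rule mult_left_mono)
  moreover
  define X where "X = A + \<beta> * (real k * (real k + 1) / 2)"
  define Y where "Y = a + \<beta> * (real d - real k)"
  \<comment> \<open>\<open>c1\<close> and \<open>c2\<close> give the sign of the linear function X M
    + Y L at the two ends L = k M and L = (k + 1) M of the segment that contains L.\<close>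
  have c1: "X + Y * real k \<le> 0" using cond[of k] k by (simp add: X_def Y_def algebra_simps)
  have "X * M + Y * L \<le> 0"
  proof (cases "k = d")
    case True
    then have "L = real k * M" using k M by auto
    then have "X * M + Y * L = (X + Y * real k) * M" by (simp add: algebra_simps)
    then show ?thesis using c1 M by (simp add: mult_nonpos_nonneg)
  next
    case False
    then have c2: "X + Y * (real k + 1) \<le> 0"
      using cond[of "Suc k"] k by (simp add: X_def Y_def algebra_simps) (simp add: field_simps)
    have "Suc k \<notin> K" using kmax[of "Suc k"] by auto
    then have L: "L \<le> (real k + 1) * M" using False k by (auto simp: K_def algebra_simps)
    show ?thesis
    proof (cases "0 \<le> Y")
      case True
      have "X * M + Y * L \<le> X * M + Y * ((real k + 1) * M)" using True L by (intro add_left_mono mult_left_mono)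
      also have "\<dots> = (X + Y * (real k + 1)) * M" by (simp add: algebra_simps)
      also have "\<dots> \<le> 0" using c2 M by (simp add: mult_nonpos_nonneg)
      finally show ?thesis .
    next
      case False
      then have "X * M + Y * L \<le> X * M + Y * (real k * M)" using k by (intro add_left_mono mult_left_mono_neg) auto
      also have "\<dots> = (X + Y * real k) * M" by (simp add: algebra_simps)
      also have "\<dots> \<le> 0" using c1 M by (simp add: mult_nonpos_nonneg)
      finally show ?thesis .
    qed
  qed
  ultimately show ?thesis by (simp add: X_def Y_def algebra_simps)
qed

section \<open>Integrability of product weights and of powers of the norm\<close>

lemma nn_integral_vec_prod:
  fixes f :: "real \<Rightarrow> ennreal"
  assumes [measurable]: "f \<in> borel_measurable borel"
  shows "(\<integral>\<^sup>+x. (\<Prod>i\<in>UNIV. f (x $ i)) \<partial>(lborel :: (real ^ 'n) measure)) = (\<integral>\<^sup>+x. f x \<partial>lborel) ^ CARD('n)"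
proof -
  have B: "(Basis :: (real ^ 'n) set) = range (\<lambda>i. axis i 1)"
    by (auto simp: Basis_vec_def)
  have inj: "inj (\<lambda>i::'n. axis i (1::real))" by (auto simp: inj_def axis_eq_axis)
  have "(\<Prod>i\<in>UNIV. f (x $ i)) = (\<Prod>b\<in>Basis. f (x \<bullet> b))" for x :: "real ^ 'n"
    unfolding B by (subst prod.reindex[OF inj]) (simp add: inner_axis)
  then have "(\<integral>\<^sup>+x. (\<Prod>i\<in>UNIV. f (x $ i)) \<partial>(lborel :: (real ^ 'n) measure))
     = (\<integral>\<^sup>+x. (\<Prod>b\<in>Basis. f (x \<bullet> b)) \<partial>(lborel :: (real ^ 'n) measure))"
    by (simp only:)
  also have "\<dots> = (\<Prod>b\<in>(Basis :: (real ^ 'n) set). (\<integral>\<^sup>+x. f x \<partial>lborel))"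
    by (rule nn_integral_lborel_prod) auto
  finally show ?thesis by simp
qed

lemma nn_integral_even_finite:
  fixes f :: "real \<Rightarrow> ennreal"
  assumes [measurable]: "f \<in> borel_measurable borel"
    and "(\<integral>\<^sup>+x. f x * indicator {0..} x \<partial>lborel) < \<infinity>"
  shows "(\<integral>\<^sup>+x. f \<bar>x\<bar> \<partial>lborel) < \<infinity>"
proof -
  have "(\<integral>\<^sup>+x. f x * indicator {0..} x \<partial>lborel) = ennreal \<bar>-1\<bar> * (\<integral>\<^sup>+x. f (0 + (-1) * x) * indicator {0..} (0 + (-1) * x) \<partial>lborel)"
    by (rule nn_integral_real_affine) auto
  then have r: "(\<integral>\<^sup>+x. f (- x) * indicator {0..} (- x) \<partial>lborel) < \<infinity>" using assms(2) by simp
  have "(\<integral>\<^sup>+x. f \<bar>x\<bar> \<partial>lborel) \<le> (\<integral>\<^sup>+x. (f x * indicator {0..} x + f (- x) * indicator {0..} (- x)) \<partial>lborel)"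
    by (intro nn_integral_mono) (auto split: split_indicator)
  also have "\<dots> = (\<integral>\<^sup>+x. f x * indicator {0..} x \<partial>lborel) + (\<integral>\<^sup>+x. f (- x) * indicator {0..} (- x) \<partial>lborel)"
    by (intro nn_integral_add) auto
  also have "\<dots> < \<infinity>" using assms(2) r by simp
  finally show ?thesis .
qed

lemma nn_integral_max_powr_finite:
  assumes "1 < b"
  shows "(\<integral>\<^sup>+x. ennreal (max 1 \<bar>x\<bar> powr (- b)) \<partial>lborel) < \<infinity>"
proof (rule nn_integral_even_finite)
  have "((\<lambda>x. x powr (- b)) has_integral - (1 powr (- b + 1)) / (- b + 1)) {1::real..}"
    using has_integral_powr_to_inf[of "-b" 1] assms by simp
  from nn_integral_has_integral_lebesgue'[OF _ this]
  have 1: "(\<integral>\<^sup>+x. ennreal (x powr (- b)) * indicator {1..} x \<partial>lborel) < \<infinity>" by simp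
  have "(\<integral>\<^sup>+x. ennreal (max 1 x powr (- b)) * indicator {0..} x \<partial>lborel)
     \<le> (\<integral>\<^sup>+x. (indicator {0..1} x + ennreal (x powr (- b)) * indicator {1..} x) \<partial>lborel)"
    by (intro nn_integral_mono) (auto split: split_indicator simp: max_def)
  also have "\<dots> = (\<integral>\<^sup>+x. indicator {0..1::real} x \<partial>lborel) + (\<integral>\<^sup>+x. ennreal (x powr (- b)) * indicator {1..} x \<partial>lborel)"
    by (intro nn_integral_add) auto
  also have "\<dots> < \<infinity>" using 1 by simp
  finally show "(\<integral>\<^sup>+x. ennreal (max 1 x powr (- b)) * indicator {0..} x \<partial>lborel) < \<infinity>" .
qed measurable

lemma nn_integral_powr_near_0_finite:
  assumes "-1 < b"
  shows "(\<integral>\<^sup>+x. (if x = 0 then \<infinity> else if \<bar>x\<bar> \<le> 1 then ennreal (\<bar>x\<bar> powr b) else 0) \<partial>lborel) < \<infinity>"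
proof -
  have "(\<lambda>x. x powr b) integrable_on {0..1::real}"
    using assms by (intro integrable_on_powr_from_0) auto
  then obtain I where "((\<lambda>x. x powr b) has_integral I) {0..1::real}" by (auto simp: integrable_on_def)
  from nn_integral_has_integral_lebesgue'[OF _ this]
  have 1: "(\<integral>\<^sup>+x. ennreal (x powr b) * indicator {0..1} x \<partial>lborel) < \<infinity>" by simp
  have "(\<integral>\<^sup>+x. ennreal (\<bar>x\<bar> powr b) * indicator {0..1} \<bar>x\<bar> \<partial>lborel) < \<infinity>"
    by (rule nn_integral_even_finite)
      (measurable, rule le_less_trans[OF nn_integral_mono 1], auto split: split_indicator)
  also have "(\<integral>\<^sup>+x. ennreal (\<bar>x\<bar> powr b) * indicator {0..1} \<bar>x\<bar> \<partial>lborel)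
     = (\<integral>\<^sup>+x. (if x = 0 then \<infinity> else if \<bar>x\<bar> \<le> 1 then ennreal (\<bar>x\<bar> powr b) else 0) \<partial>lborel)"
    by (rule nn_integral_cong_AE) (use AE_lborel_singleton[of "0::real"] in \<open>auto elim!: eventually_mono split: split_indicator\<close>)
  finally show ?thesis .
qed

text \<open>For negative a and n coordinates, |x|^a is a product of n factors |x|^(a/n), each at
  most |x_i|^(a/n). Since a/n > -1, each of these is integrable near 0 in its own variable.\<close>

lemma nn_integral_norm_powr_unit_ball_finite:
  assumes "- real CARD('n) < a"
  shows "(\<integral>\<^sup>+x. ennreal (norm x powr a) * indicator {x. norm x < 1} x \<partial>(lborel :: (real ^ 'n) measure)) < \<infinity>"
proof (cases "0 \<le> a")
  case True
  have "(\<integral>\<^sup>+x. ennreal (norm x powr a) * indicator {x. norm x < 1} x \<partial>(lborel :: (real ^ 'n) measure))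
     \<le> (\<integral>\<^sup>+x. indicator (cball 0 1) x \<partial>(lborel :: (real ^ 'n) measure))"
    by (intro nn_integral_mono) (auto split: split_indicator simp: True intro!: powr_le1)
  also have "\<dots> < \<infinity>" using emeasure_lborel_cball_finite[of "0 :: real ^ 'n" 1] by simp
  finally show ?thesis .
next
  case False
  define b where "b = a / real CARD('n)"
  have b: "-1 < b" "b < 0" using assms False by (auto simp: b_def field_simps)
  \<comment> \<open>The value \<open>\<infinity>\<close> at \<open>0\<close> keeps the product dominating when a coordinate vanishes, where \<open>0 powr b = 0\<close>.\<close>
  define f where "f x = (if x = 0 then \<infinity> else if \<bar>x\<bar> \<le> 1 then ennreal (\<bar>x\<bar> powr b) else 0)" for x :: real
  have [measurable]: "f \<in> borel_measurable borel" unfolding f_def by measurable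
  have "ennreal (norm x powr a) * indicator {x. norm x < 1} x \<le> (\<Prod>i\<in>UNIV. f (x $ i))" for x :: "real ^ 'n"
  proof (cases "norm x < 1")
    case True
    have xi: "\<bar>x $ i\<bar> \<le> norm x" for i by (rule component_le_norm_cart)
    have nz: "f (x $ i) \<noteq> 0" for i
      using order_trans[OF xi[of i], of 1] True by (auto simp: f_def)
    show ?thesis
    proof (cases "\<exists>i. x $ i = 0")
      case True
      then obtain i where "x $ i = 0" by blast
      then have "(\<Prod>i\<in>UNIV. f (x $ i)) = \<infinity> * (\<Prod>i\<in>UNIV - {i}. f (x $ i))"
        by (subst prod.remove[of _ i]) (auto simp: f_def)
      moreover have "(\<Prod>i\<in>UNIV - {i}. f (x $ i)) \<noteq> 0" using nz by (simp add: prod_zero_iff)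
      ultimately show ?thesis by (simp add: ennreal_top_mult)
    next
      case False
      then have x0: "0 < norm x" by auto
      have "norm x powr a = (\<Prod>i\<in>(UNIV::'n set). norm x powr b)"
        using x0 by (simp add: b_def powr_powr flip: powr_realpow)
      then have "ennreal (norm x powr a) = (\<Prod>i\<in>(UNIV::'n set). ennreal (norm x powr b))"
        by (simp add: prod_ennreal ennreal_power)
      also have "\<dots> \<le> (\<Prod>i\<in>UNIV. f (x $ i))"
      proof (rule prod_mono_ennreal)
        fix i
        have "norm x powr b \<le> \<bar>x $ i\<bar> powr b"
          using b False xi[of i] by (intro powr_mono2') auto
        then show "ennreal (norm x powr b) \<le> f (x $ i)"
          using False order_trans[OF xi[of i], of 1] \<open>norm x < 1\<close> by (auto simp: f_def ennreal_leI)
      qed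
      finally show ?thesis using \<open>norm x < 1\<close> by simp
    qed
  qed simp
  then have "(\<integral>\<^sup>+x. ennreal (norm x powr a) * indicator {x. norm x < 1} x \<partial>(lborel :: (real ^ 'n) measure))
     \<le> (\<integral>\<^sup>+x. (\<Prod>i\<in>UNIV. f (x $ i)) \<partial>(lborel :: (real ^ 'n) measure))"
    by (intro nn_integral_mono)
  also have "\<dots> = (\<integral>\<^sup>+x. f x \<partial>lborel) ^ CARD('n)" by (rule nn_integral_vec_prod) measurable
  also have "\<dots> < \<infinity>" using nn_integral_powr_near_0_finite[OF b(1)] unfolding f_def
    by (simp add: power_less_top_ennreal)
  finally show ?thesis .
qed

lemma powr_comparable:
  fixes x y K a :: real
  assumes "0 < x" "0 < y" "x \<le> K * y" "y \<le> K * x"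
  shows "x powr a \<le> K powr \<bar>a\<bar> * y powr a"
proof -
  have K: "0 < K" using assms by (smt (verit) mult_nonneg_nonpos mult_nonneg_nonpos2)
  show ?thesis
  proof (cases "0 \<le> a")
    case True
    have "x powr a \<le> (K * y) powr a" using True assms by (intro powr_mono2) auto
    then show ?thesis using True K assms by (simp add: powr_mult)
  next
    case False
    have "x powr a \<le> (y / K) powr a"
      using False assms K by (intro powr_mono2') (auto simp: field_simps)
    also have "\<dots> = K powr \<bar>a\<bar> * y powr a" using False K assms by (simp add: powr_divide powr_minus field_simps)
    finally show ?thesis .
  qed
qed


section \<open>Gauges and the pointwise estimate of the transform\<close>

context moment_index
begin

text \<open>Above its floor 1 it is homogeneous under the dilations that multiply the coordinate of
  order j by the j-th power of the factor. The floor keeps negative powers bounded near the origin,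
  and it keeps the reciprocal, which serves as a length of time, at most 1.\<close>

definition aniso_gauge :: "real ^ 'n \<Rightarrow> real" where
  "aniso_gauge \<eta> = max 1 (Max (range (\<lambda>i. \<bar>\<eta> $ i\<bar> powr (1 / real (idx i)))))"

text \<open>Stands for max(1, |\<eta>|). Built from the coordinates, it compares with the gauge N
  without constants: it lies between N and N^d.\<close>

definition sup_gauge :: "real ^ 'n \<Rightarrow> real" where
  "sup_gauge \<eta> = max 1 (Max (range (\<lambda>i. \<bar>\<eta> $ i\<bar>)))"

lemma borel_measurable_aniso_gauge [measurable]: "aniso_gauge \<in> borel_measurable borel"
  unfolding aniso_gauge_def[abs_def]
  by (intro borel_measurable_max borel_measurable_const borel_measurable_Max)
    (auto intro!: powr_real_measurable borel_measurable_abs borel_measurable_continuous_onI[of "\<lambda>x. x $ _"] continuous_intros)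

lemma borel_measurable_sup_gauge [measurable]: "sup_gauge \<in> borel_measurable borel"
  unfolding sup_gauge_def[abs_def]
  by (intro borel_measurable_max borel_measurable_const borel_measurable_Max)
    (auto intro!: borel_measurable_continuous_onI continuous_intros)

lemma gauge_ge_1: "1 \<le> aniso_gauge \<eta>" and sup_gauge_ge_1: "1 \<le> sup_gauge \<eta>"
  by (simp_all add: aniso_gauge_def sup_gauge_def)

lemma abs_component_le_gauge: "\<bar>\<eta> $ i\<bar> \<le> aniso_gauge \<eta> ^ idx i"
proof -
  have "\<bar>\<eta> $ i\<bar> powr (1 / real (idx i)) \<le> aniso_gauge \<eta>"
    unfolding aniso_gauge_def by (rule max.coboundedI2) (auto intro: Max_ge)
  then have "(\<bar>\<eta> $ i\<bar> powr (1 / real (idx i))) ^ idx i \<le> aniso_gauge \<eta> ^ idx i"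
    by (intro power_mono) auto
  moreover have "(\<bar>\<eta> $ i\<bar> powr (1 / real (idx i))) ^ idx i = \<bar>\<eta> $ i\<bar>"
    using idx_range(1)[of i] by (cases "\<eta> $ i = 0") (auto simp: powr_powr simp flip: powr_realpow)
  ultimately show ?thesis by simp
qed

lemma gauge_le:
  assumes "1 \<le> H" "\<And>i. \<bar>\<eta> $ i\<bar> \<le> H ^ idx i"
  shows "aniso_gauge \<eta> \<le> H"
proof -
  have "\<bar>\<eta> $ i\<bar> powr (1 / real (idx i)) \<le> H" for i
  proof -
    have "\<bar>\<eta> $ i\<bar> powr (1 / real (idx i)) \<le> (H ^ idx i) powr (1 / real (idx i))"
      using assms(2) by (intro powr_mono2) auto
    also have "\<dots> = H" using assms(1) idx_range(1)[of i] by (simp add: powr_powr flip: powr_realpow)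
    finally show ?thesis .
  qed
  then show ?thesis using assms(1) unfolding aniso_gauge_def by (auto intro!: Max.boundedI)
qed

lemma abs_component_le_sup_gauge: "\<bar>\<eta> $ i\<bar> \<le> sup_gauge \<eta>"
  unfolding sup_gauge_def by (rule max.coboundedI2) (auto intro: Max_ge)

lemma sup_gauge_le: "1 \<le> H \<Longrightarrow> (\<And>i. \<bar>\<eta> $ i\<bar> \<le> H) \<Longrightarrow> sup_gauge \<eta> \<le> H"
  unfolding sup_gauge_def by (auto intro!: Max.boundedI)

lemma gauge_le_sup_gauge: "aniso_gauge \<eta> \<le> sup_gauge \<eta>"
proof (rule gauge_le[OF sup_gauge_ge_1])
  fix i
  have "\<bar>\<eta> $ i\<bar> \<le> sup_gauge \<eta> ^ 1" using abs_component_le_sup_gauge by simp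
  also have "\<dots> \<le> sup_gauge \<eta> ^ idx i" by (rule power_increasing[OF idx_range(1) sup_gauge_ge_1])
  finally show "\<bar>\<eta> $ i\<bar> \<le> sup_gauge \<eta> ^ idx i" .
qed

lemma sup_gauge_le_gauge_power: "sup_gauge \<eta> \<le> aniso_gauge \<eta> ^ d"
proof (rule sup_gauge_le)
  show "1 \<le> aniso_gauge \<eta> ^ d" using gauge_ge_1 by (rule one_le_power)
  show "\<bar>\<eta> $ i\<bar> \<le> aniso_gauge \<eta> ^ d" for i
    using abs_component_le_gauge[of \<eta> i] power_increasing[OF idx_range(2)[of i] gauge_ge_1[of \<eta>]] by linarith
qed

definition osc_const :: real where
  "osc_const = (real (d * d) + 1) * (2 * 18 ^ (d * d) + 8)"

lemma osc_const_ge_1: "1 \<le> osc_const"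
proof -
  have "1 * 1 \<le> (real (d * d) + 1) * (2 * 18 ^ (d * d) + 8)"
    by (intro mult_mono) (auto intro: add_increasing)
  then show ?thesis by (simp add: osc_const_def)
qed

lemma norm_fourier_moment_le_1: "cmod (fourier_transform (moment_measure idx) \<xi>) \<le> 1"
proof -
  have "continuous_on {0..1} (\<lambda>t. - 2 * pi * poly (phase_poly idx \<xi>) t)" by (intro continuous_intros)
  from norm_integral_cis_le[OF _ this] show ?thesis by (simp add: fourier_transform_moment_measure)
qed

text \<open>A gauge of at least H at time t means that some derivative of order j of the phase
  reaches H^j there; the factor 2 pi only enlarges it.\<close>

lemma norm_fourier_moment_le:
  assumes H: "1 \<le> H" and low: "\<And>t. t \<in> {0..1} \<Longrightarrow> H \<le> aniso_gauge (taylor_shift idx t \<xi>)"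
  shows "cmod (fourier_transform (moment_measure idx) \<xi>) \<le> osc_const / H"
\<comment> \<open>The gauge is never below 1, so for H = 1 small derivatives would not contradict
  \<open>low\<close>; the trivial bound 1 serves instead.\<close>
proof (cases "H = 1")
  case True
  then show ?thesis using osc_const_ge_1 norm_fourier_moment_le_1[of \<xi>] by simp
next
  case False
  define q where "q = smult (- 2 * pi) (phase_poly idx \<xi>)"
  have "norm (integral {0..1} (\<lambda>t. cis (poly q t))) \<le> (real (d * d) + 1) * ((2 * 18 ^ (d * d) + 8) / H)"
  proof (rule poly_oscillatory_integral_bound)
    have "degree (phase_poly idx \<xi>) \<le> d" unfolding phase_poly_def
      using idx_range(2) by (intro degree_sum_le) (auto intro: order_trans[OF degree_monom_le])
    then show "degree q \<le> d" by (simp add: q_def)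
    show "\<exists>j\<in>{1..d}. H ^ j \<le> \<bar>poly ((pderiv ^^ j) q) t\<bar>" if t: "t \<in> {0..1}" for t
    proof (rule ccontr)
      assume neg: "\<not> ?thesis"
      define \<eta> where "\<eta> = taylor_shift idx t \<xi>"
      have lt: "\<bar>\<eta> $ i\<bar> < H ^ idx i" for i
      proof -
        have "\<bar>poly ((pderiv ^^ idx i) q) t\<bar> < H ^ idx i"
          using neg idx_range[of i] by (auto simp: not_le)
        moreover have "\<bar>poly ((pderiv ^^ idx i) q) t\<bar> = 2 * pi * \<bar>\<eta> $ i\<bar>"
          unfolding q_def higher_pderiv_smult poly_smult poly_pderiv_phase_poly_idx \<eta>_def by (simp add: abs_mult)
        moreover have "1 * \<bar>\<eta> $ i\<bar> \<le> 2 * pi * \<bar>\<eta> $ i\<bar>"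
          using pi_ge_two by (intro mult_right_mono) auto
        ultimately show ?thesis by linarith
      qed
      have "\<bar>\<eta> $ i\<bar> powr (1 / real (idx i)) < H" for i
      proof -
        have "\<bar>\<eta> $ i\<bar> powr (1 / real (idx i)) < (H ^ idx i) powr (1 / real (idx i))"
          using lt idx_range(1)[of i] by (intro powr_less_mono2) auto
        also have "\<dots> = H" using H idx_range(1)[of i] by (simp add: powr_powr flip: powr_realpow)
        finally show ?thesis .
      qed
      then have "aniso_gauge \<eta> < H" using H False unfolding aniso_gauge_def by (subst max_less_iff_conj) (auto simp: Max_less_iff)
      with low[OF t] show False by (simp add: \<eta>_def)
    qed
  qed (use H in auto)
  then show ?thesis by (simp add: fourier_transform_moment_measure q_def osc_const_def)
qed

text \<open>A Taylor term |h|^(j-i) |\<eta>_j| is at most (|h| H)^(j-i) H^i \<le> H^i, and summing d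
  terms costs d \<le> d^i. So the gauge varies slowly over times of order 1/H.\<close>

lemma gauge_taylor_shift_le:
  assumes "aniso_gauge \<eta> \<le> H" "\<bar>h\<bar> * H \<le> 1"
  shows "aniso_gauge (taylor_shift idx h \<eta>) \<le> real d * H"
proof (rule gauge_le)
  have H: "1 \<le> H" using gauge_ge_1[of \<eta>] assms by linarith
  have d1: "1 \<le> real d" using d2 by simp
  show "1 \<le> real d * H" using mult_mono[OF d1 H] by simp
  fix i
  have "\<bar>taylor_coeff h (idx i) (idx j) * \<eta> $ j\<bar> \<le> H ^ idx i" for j
  proof (cases "idx i \<le> idx j")
    case True
    have "\<bar>taylor_coeff h (idx i) (idx j) * \<eta> $ j\<bar> = \<bar>h\<bar> ^ (idx j - idx i) / fact (idx j - idx i) * \<bar>\<eta> $ j\<bar>"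
      using True by (simp add: taylor_coeff_def abs_mult power_abs)
    also have "\<dots> \<le> \<bar>h\<bar> ^ (idx j - idx i) / 1 * H ^ idx j"
      using abs_component_le_gauge[of \<eta> j] power_mono[OF assms(1), of "idx j"] gauge_ge_1[of \<eta>]
      by (intro mult_mono divide_left_mono) (auto simp: fact_ge_1)
    also have "\<dots> = (\<bar>h\<bar> * H) ^ (idx j - idx i) * H ^ idx i"
      using True by (simp add: power_mult_distrib power_add[symmetric])
    also have "\<dots> \<le> 1 * H ^ idx i"
      using assms H by (intro mult_right_mono power_le_one) auto
    finally show ?thesis by simp
  qed (use H in \<open>simp add: taylor_coeff_def\<close>)
  then have "\<bar>taylor_shift idx h \<eta> $ i\<bar> \<le> (\<Sum>j\<in>(UNIV::'n set). H ^ idx i)"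
    unfolding taylor_shift_nth by (intro order_trans[OF sum_abs] sum_mono)
  also have "\<dots> = real d ^ 1 * H ^ idx i" by (simp add: card_index)
  also have "\<dots> \<le> real d ^ idx i * H ^ idx i"
    using idx_range(1)[of i] d1 H by (intro mult_right_mono power_increasing) auto
  finally show "\<bar>taylor_shift idx h \<eta> $ i\<bar> \<le> (real d * H) ^ idx i" by (simp add: power_mult_distrib)
qed

lemma norm_taylor_shift_le:
  assumes "\<bar>h\<bar> \<le> 1"
  shows "norm (taylor_shift idx h \<eta>) \<le> real d ^ 2 * norm \<eta>"
proof -
  have "\<bar>taylor_coeff h k n\<bar> \<le> 1" for k n
  proof (cases "k \<le> n")
    case True
    have "\<bar>h\<bar> ^ (n - k) / fact (n - k) \<le> 1 / 1"
      using assms by (intro frac_le power_le_one fact_ge_1) auto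
    then show ?thesis using True by (simp add: taylor_coeff_def power_abs)
  qed (simp add: taylor_coeff_def)
  then have "\<bar>taylor_coeff h (idx i) (idx j) * \<eta> $ j\<bar> \<le> 1 * norm \<eta>" for i j
    unfolding abs_mult by (intro mult_mono component_le_norm_cart) auto
  then have "\<bar>taylor_shift idx h \<eta> $ i\<bar> \<le> (\<Sum>j\<in>(UNIV::'n set). norm \<eta>)" for i
    unfolding taylor_shift_nth by (intro order_trans[OF sum_abs] sum_mono) auto
  then have "\<bar>taylor_shift idx h \<eta> $ i\<bar> \<le> real d * norm \<eta>" for i by (simp add: card_index)
  then have "(\<Sum>i\<in>UNIV. \<bar>taylor_shift idx h \<eta> $ i\<bar>) \<le> (\<Sum>i\<in>(UNIV::'n set). real d * norm \<eta>)"
    by (intro sum_mono)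
  with norm_le_l1_cart[of "taylor_shift idx h \<eta>"] show ?thesis
    by (simp add: card_index power2_eq_square)
qed

lemma norm_le_taylor_shift:
  assumes "\<bar>h\<bar> \<le> 1"
  shows "norm \<eta> \<le> real d ^ 2 * norm (taylor_shift idx h \<eta>)"
  using norm_taylor_shift_le[of "- h" "taylor_shift idx h \<eta>"] assms by simp

end

section \<open>Finiteness of the energy integral\<close>

context moment_index
begin

text \<open>The factor 2 makes it unnecessary that the infimum be attained; it is available because
  the infimum is at least 1, hence positive.\<close>

lemma ex_near_minimal_gauge:
  obtains H t0 where "1 \<le> H" "\<forall>t\<in>{0..1}. H \<le> aniso_gauge (taylor_shift idx t \<xi>)"
    "t0 \<in> {0..1}" "aniso_gauge (taylor_shift idx t0 \<xi>) \<le> 2 * H"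
proof -
  define S where "S = (\<lambda>t. aniso_gauge (taylor_shift idx t \<xi>)) ` {0..1}"
  have bb: "bdd_below S" using gauge_ge_1 by (auto simp: S_def intro!: bdd_belowI[of _ 1])
  have ne: "S \<noteq> {}" by (auto simp: S_def)
  have H: "1 \<le> Inf S" using ne gauge_ge_1 by (intro cInf_greatest) (auto simp: S_def)
  then have "Inf S < 2 * Inf S" by simp
  then obtain x where "x \<in> S" "x < 2 * Inf S" using cInf_lessD[OF ne] by blast
  then obtain t0 where t0: "t0 \<in> {0..1}" "aniso_gauge (taylor_shift idx t0 \<xi>) \<le> 2 * Inf S" by (auto simp: S_def)
  have "Inf S \<le> aniso_gauge (taylor_shift idx t \<xi>)" if "t \<in> {0..1}" for t
    using that by (intro cInf_lower bb) (auto simp: S_def)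
  with H t0 that show ?thesis by blast
qed

text \<open>The infimum of the gauge along the orbit of \<open>\<xi>\<close> is nearly attained on an interval of
  length comparable to its reciprocal, so the supremum bound for the transform may be averaged.\<close>

lemma norm_fourier_moment_powr_le_average:
  assumes p: "1 \<le> p"
  shows "ennreal (cmod (fourier_transform (moment_measure idx) \<xi>) powr p)
    \<le> ennreal (osc_const powr p * 2 * (2 * real d) powr (p - 1)) *
       (\<integral>\<^sup>+t. ennreal (aniso_gauge (taylor_shift idx t \<xi>) powr (1 - p)) * indicator {0..1} t \<partial>lborel)"
proof -
  obtain H t0 where H: "1 \<le> H" "\<forall>t\<in>{0..1}. H \<le> aniso_gauge (taylor_shift idx t \<xi>)"
    and t0: "t0 \<in> {0..1}" "aniso_gauge (taylor_shift idx t0 \<xi>) \<le> 2 * H"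
    using ex_near_minimal_gauge[of \<xi>] by metis
  define r where "r = 1 / (2 * H)"
  have r: "0 < r" "r \<le> 1 / 2" "r * (2 * H) = 1" using H(1) by (auto simp: r_def field_simps)
  \<comment> \<open>A one-sided interval at t0, on the side where it fits into [0, 1]; one side does
    because r \<le> 1/2.\<close>
  define u where "u = (if t0 \<le> 1 / 2 then t0 else t0 - r)"
  have u: "0 \<le> u" "u + r \<le> 1" "\<And>t. t \<in> {u..u + r} \<Longrightarrow> \<bar>t - t0\<bar> \<le> r"
    using t0(1) r by (auto simp: u_def split: if_splits)
  have d1: "1 \<le> real d" using d2 by simp
  have g: "aniso_gauge (taylor_shift idx t \<xi>) \<le> 2 * real d * H" if "t \<in> {u..u + r}" for t
  proof -
    have "\<bar>t - t0\<bar> * (2 * H) \<le> r * (2 * H)" using u(3)[OF that] H by (intro mult_right_mono) auto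
    then have "aniso_gauge (taylor_shift idx (t - t0) (taylor_shift idx t0 \<xi>)) \<le> real d * (2 * H)"
      using t0 r by (intro gauge_taylor_shift_le) auto
    then show ?thesis by (simp add: taylor_shift_add mult_ac)
  qed
  have "cmod (fourier_transform (moment_measure idx) \<xi>) powr p \<le> (osc_const / H) powr p"
    using norm_fourier_moment_le[OF H(1) H(2)[rule_format]] p by (intro powr_mono2) auto
  \<comment> \<open>Up to constants, H^(-p) is the length r = 1/(2H) times (2dH)^(1-p), the lower
    bound for the integrand on the interval.\<close>
  also have "\<dots> = (osc_const powr p * 2 * (2 * real d) powr (p - 1)) * ((2 * real d * H) powr (1 - p) * r)"
    using H(1) osc_const_ge_1 d1 by (simp add: powr_divide powr_mult r_def powr_diff powr_minus field_simps)
  finally have "ennreal (cmod (fourier_transform (moment_measure idx) \<xi>) powr p)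
     \<le> ennreal (osc_const powr p * 2 * (2 * real d) powr (p - 1)) * ennreal ((2 * real d * H) powr (1 - p) * r)"
    by (subst ennreal_mult[symmetric]) (use r in \<open>auto intro!: ennreal_leI\<close>)
  also have "ennreal ((2 * real d * H) powr (1 - p) * r)
     = (\<integral>\<^sup>+t. ennreal ((2 * real d * H) powr (1 - p)) * indicator {u..u + r} t \<partial>lborel)"
    using r by (simp add: nn_integral_cmult_indicator ennreal_mult)
  also have "\<dots> \<le> (\<integral>\<^sup>+t. ennreal (aniso_gauge (taylor_shift idx t \<xi>) powr (1 - p)) * indicator {0..1} t \<partial>lborel)"
  proof (rule nn_integral_mono)
    fix t
    show "ennreal ((2 * real d * H) powr (1 - p)) * indicator {u..u + r} t
       \<le> ennreal (aniso_gauge (taylor_shift idx t \<xi>) powr (1 - p)) * indicator {0..1} t"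
    proof (cases "t \<in> {u..u + r}")
      case True
      have "(2 * real d * H) powr (1 - p) \<le> aniso_gauge (taylor_shift idx t \<xi>) powr (1 - p)"
        using g[OF True] gauge_ge_1[of "taylor_shift idx t \<xi>"] p by (intro powr_mono2') auto
      then show ?thesis using True u by (auto intro!: ennreal_leI)
    qed simp
  qed
  finally show ?thesis by (simp add: mult_left_mono)
qed

text \<open>T_t and its inverse T_(-t) are bounded uniformly in |t| \<le> 1, and |\<xi>| \<ge> 1
  makes the floor of \<open>sup_gauge\<close> harmless.\<close>

lemma sup_gauge_comparable:
  assumes "1 \<le> norm \<xi>" "\<bar>t\<bar> \<le> 1"
  shows "norm \<xi> powr a \<le> (real d ^ 3) powr \<bar>a\<bar> * sup_gauge (taylor_shift idx t \<xi>) powr a"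
proof (rule powr_comparable)
  define \<eta> where "\<eta> = taylor_shift idx t \<xi>"
  have d1: "1 \<le> real d" using d2 by simp
  have "norm \<eta> \<le> (\<Sum>i\<in>UNIV. \<bar>\<eta> $ i\<bar>)" by (rule norm_le_l1_cart)
  also have "\<dots> \<le> (\<Sum>i\<in>(UNIV::'n set). sup_gauge \<eta>)" by (intro sum_mono abs_component_le_sup_gauge)
  finally have "norm \<eta> \<le> real d * sup_gauge \<eta>" by (simp add: card_index)
  then have "real d ^ 2 * norm \<eta> \<le> real d ^ 2 * (real d * sup_gauge \<eta>)" by (rule mult_left_mono) simp
  with norm_le_taylor_shift[OF assms(2), of \<xi>] show "norm \<xi> \<le> real d ^ 3 * sup_gauge (taylor_shift idx t \<xi>)"
    by (simp add: \<eta>_def power2_eq_square power3_eq_cube mult.assoc)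
  have "1 * 1 \<le> real d ^ 2 * norm \<xi>" using assms d1 by (intro mult_mono one_le_power) auto
  then have "sup_gauge \<eta> \<le> real d ^ 2 * norm \<xi>"
    using norm_taylor_shift_le[OF assms(2), of \<xi>] component_le_norm_cart[of \<eta>]
    by (intro sup_gauge_le) (auto simp: \<eta>_def intro: order_trans)
  also have "\<dots> \<le> real d ^ 3 * norm \<xi>" using d1 by (intro mult_right_mono power_increasing) auto
  finally show "sup_gauge (taylor_shift idx t \<xi>) \<le> real d ^ 3 * norm \<xi>" by (simp add: \<eta>_def)
qed (use assms sup_gauge_ge_1[of "taylor_shift idx t \<xi>"] in auto)

text \<open>The logarithm of this inequality is \<open>sum_le_piecewise_linear_bound\<close> with A
  = 1 - p.\<close>

lemma gauge_weight_le_prod: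
  assumes \<beta>: "0 \<le> \<beta>"
    and cond: "\<And>k. k \<in> {1..d} \<Longrightarrow>
       (1 - p) + a * real k + \<beta> * (real k * (real k + 1) / 2 + (real d - real k) * real k) \<le> 0"
  shows "aniso_gauge \<eta> powr (1 - p) * sup_gauge \<eta> powr a \<le> (\<Prod>i\<in>UNIV. max 1 \<bar>\<eta> $ i\<bar> powr (- \<beta>))"
proof -
  have g1: "1 \<le> aniso_gauge \<eta>" and s1: "1 \<le> sup_gauge \<eta>" by (rule gauge_ge_1, rule sup_gauge_ge_1)
  \<comment> \<open>The coordinates are renumbered by their order, since the linear bound sums over
    {1..d}.\<close>
  define y where "y k = ln (max 1 \<bar>\<eta> $ the_inv_into UNIV idx k\<bar>)" for k
  have yi: "y (idx i) = ln (max 1 \<bar>\<eta> $ i\<bar>)" for i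
    using the_inv_into_f_f[OF bij_betw_imp_inj_on[OF bij], of i] by (simp add: y_def)
  have "(1 - p) * ln (aniso_gauge \<eta>) + a * ln (sup_gauge \<eta>) + \<beta> * (\<Sum>k\<in>{1..d}. y k) \<le> 0"
  proof (rule sum_le_piecewise_linear_bound)
    show "ln (aniso_gauge \<eta>) \<le> ln (sup_gauge \<eta>)" using gauge_le_sup_gauge[of \<eta>] g1 s1 by simp
    show "ln (sup_gauge \<eta>) \<le> real d * ln (aniso_gauge \<eta>)"
    proof -
      have "ln (sup_gauge \<eta>) \<le> ln (aniso_gauge \<eta> ^ d)"
        using sup_gauge_le_gauge_power[of \<eta>] g1 s1 by (subst ln_le_cancel_iff) auto
      then show ?thesis using g1 by (simp add: ln_realpow)
    qed
    fix k assume k: "k \<in> {1..d}"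
    then obtain i where i: "idx i = k" using ex_idx[of k] by auto
    have "max 1 \<bar>\<eta> $ i\<bar> \<le> aniso_gauge \<eta> ^ k"
      using abs_component_le_gauge[of \<eta> i] g1 by (simp add: i)
    then have "ln (max 1 \<bar>\<eta> $ i\<bar>) \<le> ln (aniso_gauge \<eta> ^ k)" using g1 by (subst ln_le_cancel_iff) auto
    then show "y k \<le> real k * ln (aniso_gauge \<eta>)" using g1 yi[of i] by (simp add: ln_realpow i)
    have "max 1 \<bar>\<eta> $ i\<bar> \<le> sup_gauge \<eta>" using abs_component_le_sup_gauge[of \<eta> i] s1 by simp
    then have "ln (max 1 \<bar>\<eta> $ i\<bar>) \<le> ln (sup_gauge \<eta>)" using s1 by (subst ln_le_cancel_iff) auto
    then show "y k \<le> ln (sup_gauge \<eta>)" using yi[of i] by (simp add: i)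
  qed (use d2 g1 \<beta> cond in auto)
  moreover have "(\<Sum>k\<in>{1..d}. y k) = (\<Sum>i\<in>UNIV. ln (max 1 \<bar>\<eta> $ i\<bar>))"
    using sum_idx[of y] by (simp add: yi)
  ultimately have "exp ((1 - p) * ln (aniso_gauge \<eta>) + a * ln (sup_gauge \<eta>)) \<le> exp (\<Sum>i\<in>UNIV. - \<beta> * ln (max 1 \<bar>\<eta> $ i\<bar>))"
    by (simp only: sum_distrib_left[symmetric]) simp
  moreover have "exp (\<Sum>i\<in>UNIV. - \<beta> * ln (max 1 \<bar>\<eta> $ i\<bar>)) = (\<Prod>i\<in>UNIV. max 1 \<bar>\<eta> $ i\<bar> powr (- \<beta>))"
    by (subst exp_sum) (auto simp: powr_def intro!: prod.cong)
  moreover have "exp ((1 - p) * ln (aniso_gauge \<eta>) + a * ln (sup_gauge \<eta>)) = aniso_gauge \<eta> powr (1 - p) * sup_gauge \<eta> powr a"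
    using g1 s1 by (simp add: powr_def exp_add)
  ultimately show ?thesis by simp
qed

text \<open>Finitely many strict conditions leave room to multiply the quadratic term by 1 + e; the
  weight is then below the product of the functions max(1, |\<eta>_i|)^(-1-e).\<close>

lemma nn_integral_gauge_weight_finite:
  assumes cond: "\<And>k. k \<in> {1..d} \<Longrightarrow>
       (1 - p) + a * real k + (real k * (real k + 1) / 2 + (real d - real k) * real k) < 0"
  shows "(\<integral>\<^sup>+\<eta>. ennreal (aniso_gauge \<eta> powr (1 - p) * sup_gauge \<eta> powr a) \<partial>lborel) < \<infinity>"
proof -
  define S where "S k = real k * (real k + 1) / 2 + (real d - real k) * real k" for k
  define m where "m = Max ((\<lambda>k. (1 - p) + a * real k + S k) ` {1..d})"
  have ne: "{1..d} \<noteq> {}" using d2 by auto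
  have m: "m < 0" unfolding m_def using cond ne by (subst Max_less_iff) (auto simp: S_def)
  have mk: "(1 - p) + a * real k + S k \<le> m" if "k \<in> {1..d}" for k
    unfolding m_def using that by (intro Max_ge) auto
  have d0: "0 < real d" using d2 by simp
  have S: "S k \<le> real d * real d" "0 \<le> S k" if "k \<in> {1..d}" for k
  proof -
    have "S k = real k * ((2 * real d + 1 - real k) / 2)" by (simp add: S_def field_simps)
    moreover have "\<dots> \<le> real d * real d" using that by (intro mult_mono) auto
    ultimately show "S k \<le> real d * real d" by simp
    show "0 \<le> S k" using that by (auto simp: S_def)
  qed
  \<comment> \<open>As \<open>S k\<close> is at most d^2, this keeps \<open>e * S k\<close> within
    -m, the slack available in every condition.\<close>
  define e where "e = - m / (real d * real d)"
  have e: "0 < e" "e * (real d * real d) = - m" using m d0 by (auto simp: e_def divide_neg_pos)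
  have "(1 - p) + a * real k + (1 + e) * S k \<le> 0" if "k \<in> {1..d}" for k
  proof -
    have "e * S k \<le> e * (real d * real d)" using S[OF that] e by (intro mult_left_mono) auto
    with mk[OF that] e show ?thesis by (simp add: algebra_simps)
  qed
  then have "aniso_gauge \<eta> powr (1 - p) * sup_gauge \<eta> powr a \<le> (\<Prod>i\<in>UNIV. max 1 \<bar>\<eta> $ i\<bar> powr (- (1 + e)))" for \<eta>
    using e by (intro gauge_weight_le_prod) (auto simp: S_def)
  then have "ennreal (aniso_gauge \<eta> powr (1 - p) * sup_gauge \<eta> powr a) \<le> (\<Prod>i\<in>UNIV. ennreal (max 1 \<bar>\<eta> $ i\<bar> powr (- (1 + e))))" for \<eta>
    by (subst prod_ennreal) (auto intro: ennreal_leI)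
  then have "(\<integral>\<^sup>+\<eta>. ennreal (aniso_gauge \<eta> powr (1 - p) * sup_gauge \<eta> powr a) \<partial>lborel)
     \<le> (\<integral>\<^sup>+\<eta>. (\<Prod>i\<in>UNIV. ennreal (max 1 \<bar>\<eta> $ i\<bar> powr (- (1 + e)))) \<partial>(lborel :: (real ^ 'n) measure))"
    by (intro nn_integral_mono)
  also have "\<dots> = (\<integral>\<^sup>+x. ennreal (max 1 \<bar>x\<bar> powr (- (1 + e))) \<partial>lborel) ^ CARD('n)"
    by (rule nn_integral_vec_prod) measurable
  also have "\<dots> < \<infinity>" using nn_integral_max_powr_finite[of "1 + e"] e
    by (simp add: power_less_top_ennreal)
  finally show ?thesis .
qed

lemma fourier_moment_power_integral_finite:
  assumes p: "1 \<le> p" and a: "- real d < a"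
    and cond: "\<And>k. k \<in> {1..d} \<Longrightarrow>
       (1 - p) + a * real k + (real k * (real k + 1) / 2 + (real d - real k) * real k) < 0"
  shows "(\<integral>\<^sup>+\<xi>. ennreal (cmod (fourier_transform (moment_measure idx) \<xi>) powr p * norm \<xi> powr a) \<partial>lborel) < \<infinity>"
proof -
  let ?F = "\<lambda>\<xi>. cmod (fourier_transform (moment_measure idx) \<xi>)"
  define C where "C = osc_const powr p * 2 * (2 * real d) powr (p - 1)"
  define K where "K = (real d ^ 3) powr \<bar>a\<bar>"
  define \<Phi> where "\<Phi> \<eta> = aniso_gauge \<eta> powr (1 - p) * sup_gauge \<eta> powr a" for \<eta>
  have CK: "0 \<le> C" "0 \<le> K" using osc_const_ge_1 by (auto simp: C_def K_def)
  have [measurable]: "\<Phi> \<in> borel_measurable borel" unfolding \<Phi>_def by measurable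
  \<comment> \<open>Near the origin the weight is not comparable to a power of
    \<open>sup_gauge\<close>; there the bound 1 for the transform and a > -d suffice.\<close>
  have pt: "ennreal (?F \<xi> powr p * norm \<xi> powr a)
     \<le> ennreal (norm \<xi> powr a) * indicator {\<xi>. norm \<xi> < 1} \<xi>
       + ennreal (C * K) * (\<integral>\<^sup>+t. ennreal (\<Phi> (taylor_shift idx t \<xi>)) * indicator {0..1} t \<partial>lborel)" for \<xi>
  proof (cases "norm \<xi> < 1")
    case True
    have "?F \<xi> powr p * norm \<xi> powr a \<le> 1 * norm \<xi> powr a"
      using norm_fourier_moment_le_1[of \<xi>] p by (intro mult_right_mono powr_le1) auto
    then show ?thesis using True by (auto intro!: add_increasing2 ennreal_leI)
  next
    case False
    have "ennreal (?F \<xi> powr p * norm \<xi> powr a) = ennreal (?F \<xi> powr p) * ennreal (norm \<xi> powr a)"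
      by (rule ennreal_mult) auto
    also have "\<dots> \<le> ennreal C * (\<integral>\<^sup>+t. ennreal (aniso_gauge (taylor_shift idx t \<xi>) powr (1 - p)) * indicator {0..1} t \<partial>lborel) * ennreal (norm \<xi> powr a)"
      unfolding C_def by (intro mult_right_mono norm_fourier_moment_powr_le_average p) auto
    also have "\<dots> = ennreal C * (\<integral>\<^sup>+t. ennreal (aniso_gauge (taylor_shift idx t \<xi>) powr (1 - p)) * indicator {0..1} t * ennreal (norm \<xi> powr a) \<partial>lborel)"
      by (subst nn_integral_multc) (auto simp: mult.assoc)
    also have "\<dots> \<le> ennreal C * (\<integral>\<^sup>+t. ennreal K * (ennreal (\<Phi> (taylor_shift idx t \<xi>)) * indicator {0..1} t) \<partial>lborel)"
    proof (intro mult_left_mono nn_integral_mono)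
      fix t :: real
      show "ennreal (aniso_gauge (taylor_shift idx t \<xi>) powr (1 - p)) * indicator {0..1} t * ennreal (norm \<xi> powr a)
         \<le> ennreal K * (ennreal (\<Phi> (taylor_shift idx t \<xi>)) * indicator {0..1} t)"
      proof (cases "t \<in> {0..1}")
        case True
        have "norm \<xi> powr a \<le> K * sup_gauge (taylor_shift idx t \<xi>) powr a"
          unfolding K_def using True False by (intro sup_gauge_comparable) auto
        then have "aniso_gauge (taylor_shift idx t \<xi>) powr (1 - p) * norm \<xi> powr a
            \<le> aniso_gauge (taylor_shift idx t \<xi>) powr (1 - p) * (K * sup_gauge (taylor_shift idx t \<xi>) powr a)"
          by (intro mult_left_mono) auto
        then show ?thesis using True CK
          by (simp add: \<Phi>_def mult_ac flip: ennreal_mult)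
      qed simp
    qed auto
    also have "\<dots> = ennreal (C * K) * (\<integral>\<^sup>+t. ennreal (\<Phi> (taylor_shift idx t \<xi>)) * indicator {0..1} t \<partial>lborel)"
      using CK by (subst nn_integral_cmult) (auto simp: ennreal_mult mult.assoc)
    finally show ?thesis by (auto intro: add_increasing)
  qed
  have "(\<integral>\<^sup>+\<xi>. (\<integral>\<^sup>+t. ennreal (\<Phi> (taylor_shift idx t \<xi>)) * indicator {0..1} t \<partial>lborel) \<partial>lborel)
     = (\<integral>\<^sup>+t. (\<integral>\<^sup>+\<xi>. ennreal (\<Phi> (taylor_shift idx t \<xi>)) * indicator {0..1} t \<partial>lborel) \<partial>lborel)"
    by (rule lborel_pair.Fubini') measurable
  also have "\<dots> = (\<integral>\<^sup>+t. (\<integral>\<^sup>+\<eta>. ennreal (\<Phi> \<eta>) \<partial>lborel) * indicator {0..1::real} t \<partial>lborel)"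
  proof (intro nn_integral_cong)
    fix t :: real
    have "(\<integral>\<^sup>+\<xi>. ennreal (\<Phi> (taylor_shift idx t \<xi>)) * indicator {0..1} t \<partial>lborel)
      = (\<integral>\<^sup>+\<xi>. ennreal (\<Phi> (taylor_shift idx t \<xi>)) \<partial>lborel) * indicator {0..1} t"
      by (rule nn_integral_multc) measurable
    also have "(\<integral>\<^sup>+\<xi>. ennreal (\<Phi> (taylor_shift idx t \<xi>)) \<partial>lborel) = (\<integral>\<^sup>+\<eta>. ennreal (\<Phi> \<eta>) \<partial>lborel)"
      by (rule nn_integral_taylor_shift[of "\<lambda>\<eta>. ennreal (\<Phi> \<eta>)"]) measurable
    finally show "(\<integral>\<^sup>+\<xi>. ennreal (\<Phi> (taylor_shift idx t \<xi>)) * indicator {0..1} t \<partial>lborel)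
      = (\<integral>\<^sup>+\<eta>. ennreal (\<Phi> \<eta>) \<partial>lborel) * indicator {0..1} t" .
  qed
  also have "\<dots> = (\<integral>\<^sup>+\<eta>. ennreal (\<Phi> \<eta>) \<partial>lborel)"
    by (simp add: nn_integral_cmult_indicator)
  also have "\<dots> < \<infinity>" unfolding \<Phi>_def by (rule nn_integral_gauge_weight_finite[OF cond])
  finally have fin: "(\<integral>\<^sup>+\<xi>. (\<integral>\<^sup>+t. ennreal (\<Phi> (taylor_shift idx t \<xi>)) * indicator {0..1} t \<partial>lborel) \<partial>lborel) < \<infinity>" .
  have "(\<integral>\<^sup>+\<xi>. ennreal (?F \<xi> powr p * norm \<xi> powr a) \<partial>lborel)
     \<le> (\<integral>\<^sup>+\<xi>. (ennreal (norm \<xi> powr a) * indicator {\<xi>. norm \<xi> < 1} \<xi>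
       + ennreal (C * K) * (\<integral>\<^sup>+t. ennreal (\<Phi> (taylor_shift idx t \<xi>)) * indicator {0..1} t \<partial>lborel)) \<partial>lborel)"
    by (intro nn_integral_mono pt)
  also have "\<dots> = (\<integral>\<^sup>+\<xi>. ennreal (norm \<xi> powr a) * indicator {\<xi>. norm \<xi> < 1} \<xi> \<partial>(lborel :: (real ^ 'n) measure))
       + ennreal (C * K) * (\<integral>\<^sup>+\<xi>. (\<integral>\<^sup>+t. ennreal (\<Phi> (taylor_shift idx t \<xi>)) * indicator {0..1} t \<partial>lborel) \<partial>lborel)"
    by (subst nn_integral_add) (auto simp: nn_integral_cmult)
  also have "\<dots> < \<infinity>"
    using fin nn_integral_norm_powr_unit_ball_finite[where 'n = 'n and a = a] a
    by (simp add: card_index ennreal_mult_less_top)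
  finally show ?thesis .
qed

text \<open>At a near-minimal time, |\<xi>| is at most a constant times the sup gauge, which is at
  most (2H)^d; this bounds 1/H by a constant times |\<xi>|^(-1/d). Serves the case \<theta> =
  0.\<close>

lemma norm_fourier_moment_decay:
  assumes "1 \<le> norm \<xi>"
  shows "cmod (fourier_transform (moment_measure idx) \<xi>) \<le> osc_const * 2 * real d ^ 3 * norm \<xi> powr (- 1 / real d)"
proof -
  obtain H t0 where H: "1 \<le> H" "\<forall>t\<in>{0..1}. H \<le> aniso_gauge (taylor_shift idx t \<xi>)"
    and t0: "t0 \<in> {0..1}" "aniso_gauge (taylor_shift idx t0 \<xi>) \<le> 2 * H"
    using ex_near_minimal_gauge[of \<xi>] by metis
  have d0: "2 \<le> real d" using d2 by simp
  have "norm \<xi> powr 1 \<le> (real d ^ 3) powr \<bar>1\<bar> * sup_gauge (taylor_shift idx t0 \<xi>) powr 1"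
    using assms t0 by (intro sup_gauge_comparable) auto
  then have "norm \<xi> \<le> real d ^ 3 * sup_gauge (taylor_shift idx t0 \<xi>)" using d0 assms sup_gauge_ge_1[of "taylor_shift idx t0 \<xi>"] by simp
  also have "\<dots> \<le> real d ^ 3 * (2 * H) ^ d"
    using sup_gauge_le_gauge_power[of "taylor_shift idx t0 \<xi>"] power_mono[OF t0(2), of d] gauge_ge_1[of "taylor_shift idx t0 \<xi>"]
    by (intro mult_left_mono) auto
  also have "\<dots> \<le> (real d ^ 3) ^ d * (2 * H) ^ d"
  proof (intro mult_right_mono)
    have "(real d ^ 3) ^ 1 \<le> (real d ^ 3) ^ d" using d0 by (intro power_increasing one_le_power) auto
    then show "real d ^ 3 \<le> (real d ^ 3) ^ d" by simp
  qed (use H in auto)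
  also have "\<dots> = (2 * real d ^ 3 * H) ^ d" unfolding power_mult_distrib[symmetric] by (simp add: mult_ac)
  finally have "norm \<xi> powr (1 / real d) \<le> ((2 * real d ^ 3 * H) ^ d) powr (1 / real d)"
    using assms by (intro powr_mono2) auto
  also have "\<dots> = 2 * real d ^ 3 * H"
  proof -
    have "(B ^ d) powr (1 / real d) = B" if "0 < B" for B :: real
      using that d0 by (simp add: powr_powr flip: powr_realpow)
    then show ?thesis using d0 H(1) by simp
  qed
  finally have X: "norm \<xi> powr (1 / real d) \<le> 2 * real d ^ 3 * H" .
  define Y where "Y = norm \<xi> powr (1 / real d)"
  have Y: "norm \<xi> powr (- 1 / real d) = 1 / Y" "0 < Y" "Y \<le> 2 * real d ^ 3 * H"
    using X assms by (auto simp: Y_def powr_minus_divide)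
  have "1 / H \<le> 2 * real d ^ 3 * norm \<xi> powr (- 1 / real d)"
    unfolding Y(1) using H(1) Y(2,3) by (simp add: field_simps)
  then have "osc_const * (1 / H) \<le> osc_const * (2 * real d ^ 3 * norm \<xi> powr (- 1 / real d))"
    using osc_const_ge_1 by (intro mult_left_mono) auto
  with norm_fourier_moment_le[OF H(1) H(2)[rule_format]] show ?thesis by (simp add: mult.assoc)
qed

end

section \<open>A lower bound for degenerate oscillatory integrals\<close>

text \<open>Supported on [1, 4], with slope jumps 1, -3/2, 1/2 at 1, 2, 4.\<close>

definition tent :: "real \<Rightarrow> real" where
  "tent y = max 0 (min (y - 1) (2 - y / 2))"

definition tent_cos :: "real \<Rightarrow> real" where
  "tent_cos v = integral {1..4} (\<lambda>y. tent y * cos (v * y))"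

lemma tent_bounds: "0 \<le> tent y" "tent y \<le> 1"
  by (auto simp: tent_def min_def max_def)

lemma continuous_on_tent [continuous_intros]: "continuous_on S f \<Longrightarrow> continuous_on S (\<lambda>x. tent (f x))"
  unfolding tent_def by (intro continuous_intros) auto

text \<open>Two integrations by parts leave only the slope jumps of the tent, each with the cosine
  at its node.\<close>

lemma tent_cos_eq:
  assumes v: "v \<noteq> 0"
  shows "tent_cos v = (3 / 2 * cos (2 * v) - cos v - cos (4 * v) / 2) / v\<^sup>2"
proof -
  define F where "F y = (y - 1) * sin (v * y) / v + cos (v * y) / v\<^sup>2" for y
  define G where "G y = (2 - y / 2) * sin (v * y) / v - cos (v * y) / (2 * v\<^sup>2)" for y
  have F: "((\<lambda>y. tent y * cos (v * y)) has_integral (F 2 - F 1)) {1..2}"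
  proof (rule has_integral_eq[of _ "\<lambda>y. (y - 1) * cos (v * y)"])
    show "((\<lambda>y. (y - 1) * cos (v * y)) has_integral (F 2 - F 1)) {1..2}"
      unfolding F_def
      by (rule fundamental_theorem_of_calculus)
        (auto simp: has_real_derivative_iff_has_vector_derivative[symmetric] v power2_eq_square field_simps
          intro!: derivative_eq_intros)
  qed (auto simp: tent_def)
  have G: "((\<lambda>y. tent y * cos (v * y)) has_integral (G 4 - G 2)) {2..4}"
  proof (rule has_integral_eq[of _ "\<lambda>y. (2 - y / 2) * cos (v * y)"])
    show "((\<lambda>y. (2 - y / 2) * cos (v * y)) has_integral (G 4 - G 2)) {2..4}"
      unfolding G_def
      by (rule fundamental_theorem_of_calculus)
        (auto simp: has_real_derivative_iff_has_vector_derivative[symmetric] v power2_eq_square field_simps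
          intro!: derivative_eq_intros)
  qed (auto simp: tent_def)
  have "((\<lambda>y. tent y * cos (v * y)) has_integral ((F 2 - F 1) + (G 4 - G 2))) {1..4}"
    by (rule has_integral_combine[OF _ _ F G]) auto
  then have "tent_cos v = (F 2 - F 1) + (G 4 - G 2)"
    unfolding tent_cos_def by (rule integral_unique)
  also have "\<dots> = (3 / 2 * cos (2 * v) - cos v - cos (4 * v) / 2) / v\<^sup>2"
    by (simp add: F_def G_def mult.commute add_divide_distrib diff_divide_distrib)
  finally show ?thesis .
qed

lemma one_minus_cos_le: "1 - cos v \<le> v\<^sup>2 / 2" for v :: real
proof -
  have "1 - cos v = 2 * (sin (v / 2))\<^sup>2" using cos_double_sin[of "v / 2"] by simp
  also have "(sin (v / 2))\<^sup>2 \<le> (v / 2)\<^sup>2"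
    using abs_sin_x_le_abs_x[of "v / 2"] by (simp add: abs_le_square_iff[symmetric])
  finally show ?thesis by (simp add: power2_eq_square)
qed

lemma tent_cos_continuous: "continuous_on S tent_cos"
proof -
  have "continuous_on UNIV (\<lambda>v. integral (cbox 1 4) (\<lambda>y. tent y * cos (v * y)))"
    by (rule integral_continuous_on_param) (auto simp: split_beta' intro!: continuous_intros)
  then show ?thesis unfolding tent_cos_def[abs_def] by (auto intro: continuous_on_subset)
qed

text \<open>The trivial bound is the length 3 of [1, 4]; the decay 3 / v^2 has the constant 3/2 + 1
  + 1/2 from the three cosines.\<close>

lemma abs_tent_cos_le: "\<bar>tent_cos v\<bar> \<le> 6 / (1 + v\<^sup>2)"
proof -
  have "norm (tent_cos v) \<le> integral {1..4} (\<lambda>y::real. 1)"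
    unfolding tent_cos_def
  proof (rule integral_norm_bound_integral)
    show "(\<lambda>y. tent y * cos (v * y)) integrable_on {1..4}"
      by (intro integrable_continuous_interval continuous_intros)
    show "norm (tent y * cos (v * y)) \<le> 1" for y
      using tent_bounds[of y] mult_mono[of "tent y" 1 "\<bar>cos (v * y)\<bar>" 1] by (simp add: abs_mult)
  qed auto
  then have 1: "\<bar>tent_cos v\<bar> \<le> 3" by simp
  have 2: "\<bar>tent_cos v\<bar> * v\<^sup>2 \<le> 3"
  proof (cases "v = 0")
    case False
    have "\<bar>tent_cos v\<bar> * v\<^sup>2 = \<bar>3 / 2 * cos (2 * v) - cos v - cos (4 * v) / 2\<bar>"
      using False by (simp add: tent_cos_eq abs_div)
    also have "\<dots> \<le> 3"
      using abs_cos_le_one[of "2 * v"] abs_cos_le_one[of v] abs_cos_le_one[of "4 * v"] by linarith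
    finally show ?thesis .
  qed simp
  have "\<bar>tent_cos v\<bar> * (1 + v\<^sup>2) \<le> 6" using 1 2 by (simp add: algebra_simps)
  moreover have "0 < 1 + v\<^sup>2" by (simp add: add_pos_nonneg)
  ultimately show ?thesis by (simp add: pos_le_divide_eq)
qed

lemma nn_integral_inverse_power_finite:
  assumes k: "2 \<le> k"
  shows "(\<integral>\<^sup>+x. ennreal (1 / (1 + \<bar>x\<bar> ^ k)) \<partial>lborel) < \<infinity>"
proof -
  have "1 / (1 + \<bar>x\<bar> ^ k) \<le> max 1 \<bar>x\<bar> powr (- 2)" for x :: real
  proof (cases "\<bar>x\<bar> \<le> 1")
    case False
    have "\<bar>x\<bar>\<^sup>2 \<le> \<bar>x\<bar> ^ k" using False k by (intro power_increasing) auto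
    then have "1 / (1 + \<bar>x\<bar> ^ k) \<le> 1 / \<bar>x\<bar>\<^sup>2" using False by (intro divide_left_mono) (auto intro!: mult_pos_pos add_pos_pos)
    also have "\<dots> = max 1 \<bar>x\<bar> powr (- 2)" using False by (simp add: powr_minus_divide)
    finally show ?thesis .
  qed (auto simp: max_def divide_le_eq_1)
  then have "(\<integral>\<^sup>+x. ennreal (1 / (1 + \<bar>x\<bar> ^ k)) \<partial>lborel) \<le> (\<integral>\<^sup>+x. ennreal (max 1 \<bar>x\<bar> powr (- 2)) \<partial>lborel)"
    by (intro nn_integral_mono ennreal_leI)
  also have "\<dots> < \<infinity>" by (rule nn_integral_max_powr_finite) simp
  finally show ?thesis .
qed

lemma integrable_inverse_power:
  assumes "2 \<le> k" shows "integrable lborel (\<lambda>x::real. 1 / (1 + \<bar>x\<bar> ^ k))"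
  by (rule integrableI_bounded) (use nn_integral_inverse_power_finite[OF assms] in \<open>auto simp: abs_div\<close>)

lemma inverse_one_plus_square_le:
  fixes u :: real
  shows "1 / (1 + (u ^ k)\<^sup>2) \<le> 2 / (1 + \<bar>u\<bar> ^ k)"
proof -
  define v where "v = \<bar>u\<bar> ^ k"
  have "(u ^ k)\<^sup>2 = v\<^sup>2" by (metis v_def power_abs power2_abs)
  moreover have v: "0 \<le> v" by (simp add: v_def)
  moreover have "1 + v \<le> 2 * (1 + v\<^sup>2)"
  proof -
    have "0 \<le> (v - 1)\<^sup>2" by simp
    then have "2 * v \<le> 1 + v * v" by (simp add: power2_eq_square algebra_simps)
    then show ?thesis unfolding power2_eq_square using v zero_le_square[of v] by (smt (verit))
  qed
  moreover have "0 < 1 + v\<^sup>2" by (simp add: add_pos_nonneg)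
  ultimately show ?thesis by (simp add: v_def[symmetric] divide_simps)
qed

lemma integrable_bounded_by_inverse_power:
  fixes f :: "real \<Rightarrow> 'b::{banach, second_countable_topology}"
  assumes "2 \<le> k" "f \<in> borel_measurable borel" "\<And>u. norm (f u) \<le> C / (1 + (u ^ k)\<^sup>2)"
  shows "integrable lborel f"
proof (rule Bochner_Integration.integrable_bound)
  show "integrable lborel (\<lambda>u. \<bar>C\<bar> * 2 * (1 / (1 + \<bar>u\<bar> ^ k)))"
    by (intro integrable_mult_right integrable_inverse_power assms)
  show "AE u in lborel. norm (f u) \<le> norm (\<bar>C\<bar> * 2 * (1 / (1 + \<bar>u\<bar> ^ k)))"
  proof (rule AE_I2)
    fix u :: real
    have "norm (f u) \<le> \<bar>C\<bar> * (1 / (1 + (u ^ k)\<^sup>2))"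
      using order_trans[OF assms(3)[of u], of "\<bar>C\<bar> / (1 + (u ^ k)\<^sup>2)"] by (simp add: divide_right_mono)
    also have "\<dots> \<le> \<bar>C\<bar> * (2 / (1 + \<bar>u\<bar> ^ k))"
      by (intro mult_left_mono inverse_one_plus_square_le) auto
    also have "\<dots> = norm (\<bar>C\<bar> * 2 * (1 / (1 + \<bar>u\<bar> ^ k)))"
      by (simp add: abs_mult abs_div)
    finally show "norm (f u) \<le> norm (\<bar>C\<bar> * 2 * (1 / (1 + \<bar>u\<bar> ^ k)))" .
  qed
qed (use assms in auto)

text \<open>A single cosine over u^(2k) is not integrable at 0. As 1 - 3/2 + 1/2 = 0,
  \<open>tent_cos (u ^ k)\<close> is the combination with these coefficients of the integrands for L
  = 1, 2, 4, each of which is integrable and scales in L. Division by zero gives the integrand the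
  value 0 at u = 0, a null set.\<close>

definition cos_moment :: "nat \<Rightarrow> real \<Rightarrow> real" where
  "cos_moment k L = (LINT u|lborel. (1 - cos (L * u ^ k)) / (u ^ k)\<^sup>2)"

lemma integrable_cos_moment:
  fixes L :: real
  assumes k: "2 \<le> k" and L: "0 \<le> L"
  shows "integrable lborel (\<lambda>u. (1 - cos (L * u ^ k)) / (u ^ k)\<^sup>2)"
proof (rule integrable_bounded_by_inverse_power[OF k])
  fix u :: real
  define v where "v = u ^ k"
  show "norm ((1 - cos (L * u ^ k)) / (u ^ k)\<^sup>2) \<le> (2 + L\<^sup>2) / (1 + (u ^ k)\<^sup>2)"
  proof (cases "v = 0")
    case False
    have "1 - cos (L * v) \<le> (L\<^sup>2) * v\<^sup>2"
      using one_minus_cos_le[of "L * v"] zero_le_power2[of "L * v"] by (simp only: power_mult_distrib)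
    moreover have "(1 - cos (L * v)) * v\<^sup>2 \<le> 2 * v\<^sup>2" 
      using cos_ge_minus_one[of "L * v"] by (intro mult_right_mono) auto
    ultimately have "(1 - cos (L * v)) * (1 + v\<^sup>2) \<le> (2 + L\<^sup>2) * v\<^sup>2" by (simp add: algebra_simps)
    moreover have "0 < 1 + v\<^sup>2" "0 < v\<^sup>2" using False by (auto simp: add_pos_nonneg)
    moreover have "a / x \<le> b / w" if "a * w \<le> b * x" "0 < w" "0 < x" for a b w x :: real
      using that by (simp add: field_simps)
    ultimately have "(1 - cos (L * v)) / v\<^sup>2 \<le> (2 + L\<^sup>2) / (1 + v\<^sup>2)"
      by blast
    moreover have "norm ((1 - cos (L * v)) / v\<^sup>2) = (1 - cos (L * v)) / v\<^sup>2" by (simp add: abs_div)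
    ultimately show ?thesis by (simp add: v_def)
  qed (simp flip: v_def)
qed measurable

text \<open>The substitution h = m^(-1/k) u, the source of the factor m^(-1/k) in the lower bounds
  below.\<close>

lemma integral_scaled_power:
  fixes f :: "real \<Rightarrow> real"
  assumes k: "2 \<le> k" and m: "0 < m"
  shows "(LINT h|lborel. f (m * h ^ k)) = m powr (- 1 / real k) * (LINT u|lborel. f (u ^ k))"
proof -
  define c where "c = m powr (- 1 / real k)"
  have c: "0 < c" "m * c ^ k = 1"
  proof -
    show c0: "0 < c" using m by (simp add: c_def)
    then have "c ^ k = c powr real k" by (simp add: powr_realpow)
    also have "\<dots> = m powr (- 1 / real k * real k)" by (simp only: c_def powr_powr)
    also have "- 1 / real k * real k = - 1" using k by simp
    finally show "m * c ^ k = 1" using m by (simp add: powr_minus_divide)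
  qed
  have "(LINT h|lborel. f (m * h ^ k)) = \<bar>c\<bar> *\<^sub>R (LINT u|lborel. f (m * (0 + c * u) ^ k))"
    by (rule lborel_integral_real_affine) (use c in simp)
  moreover have "m * (0 + c * u) ^ k = u ^ k" for u
    using c(2) by (simp add: power_mult_distrib mult.assoc[symmetric])
  ultimately show ?thesis using c(1) by (simp add: c_def)
qed


lemma cos_moment_scale:
  assumes k: "2 \<le> k" and L: "0 < L"
  shows "cos_moment k L = L powr (2 - 1 / real k) * cos_moment k 1"
proof -
  have "cos_moment k L = (LINT u|lborel. L\<^sup>2 * ((1 - cos (L * u ^ k)) / (L * u ^ k)\<^sup>2))"
    using L by (simp add: cos_moment_def power_mult_distrib)
  also have "\<dots> = L powr (- 1 / real k) * (LINT u|lborel. L\<^sup>2 * ((1 - cos (u ^ k)) / (u ^ k)\<^sup>2))"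
    by (rule integral_scaled_power[OF k L, of "\<lambda>v. L\<^sup>2 * ((1 - cos v) / v\<^sup>2)"])
  also have "\<dots> = (L powr (- 1 / real k) * L\<^sup>2) * cos_moment k 1"
    unfolding cos_moment_def integral_mult_right_zero by simp
  also have "L powr (- 1 / real k) * L\<^sup>2 = L powr (2 - 1 / real k)"
    using L by (simp add: powr_diff powr_minus_divide)
  finally show ?thesis .
qed

lemma cos_moment_pos:
  assumes k: "2 \<le> k"
  shows "0 < cos_moment k 1"
proof -
  define c where "c = 1 - cos ((1 / 2) ^ k :: real)"
  have hk: "0 < (1 / 2 :: real) ^ k" "(1 / 2 :: real) ^ k \<le> 1" by (auto intro: power_le_one)
  have "cos ((1 / 2) ^ k :: real) < cos 0"
    using hk pi_gt3 by (intro cos_monotone_0_pi) auto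
  then have c: "0 < c" by (simp add: c_def)
  have "c * (1 / 2) = (LINT u|lborel. c * indicator {1 / 2..1::real} u)" by simp
  also have "\<dots> \<le> cos_moment k 1"
    unfolding cos_moment_def
  proof (rule integral_mono)
    show "integrable lborel (\<lambda>u. c * indicator {1 / 2..1::real} u)"
      using emeasure_lborel_cbox_finite[of "1 / 2" "1 :: real"]
      by (intro integrable_mult_right integrable_real_indicator) simp_all
    show "integrable lborel (\<lambda>u::real. (1 - cos (1 * u ^ k)) / (u ^ k)\<^sup>2)"
      using integrable_cos_moment[OF k, of 1] by simp
    fix u :: real
    show "c * indicator {1 / 2..1} u \<le> (1 - cos (1 * u ^ k)) / (u ^ k)\<^sup>2"
    proof (cases "u \<in> {1 / 2..1}")
      case True
      have u: "(1 / 2) ^ k \<le> u ^ k" "u ^ k \<le> 1" using True by (auto intro: power_mono power_le_one)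
      have "cos (u ^ k) \<le> cos ((1 / 2) ^ k)" using u hk pi_gt3 by (intro cos_monotone_0_pi_le) auto
      then have "c \<le> 1 - cos (u ^ k)" by (simp add: c_def)
      also have "\<dots> \<le> (1 - cos (u ^ k)) / (u ^ k)\<^sup>2"
      proof -
        have "0 < (u ^ k)\<^sup>2" "(u ^ k)\<^sup>2 \<le> 1" using True u hk by (auto intro!: power_le_one)
        then show ?thesis by (simp add: divide_simps mult_left_le)
      qed
      finally show ?thesis using True by simp
    qed simp
  qed
  finally show ?thesis using c by simp
qed

lemma integrable_tent_cos_power:
  "2 \<le> k \<Longrightarrow> integrable lborel (\<lambda>u. tent_cos (u ^ k))"
proof (rule integrable_bounded_by_inverse_power[where C = 6])
  show "(\<lambda>u. tent_cos (u ^ k)) \<in> borel_measurable borel"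
    by (rule borel_measurable_continuous_onI)
      (rule continuous_on_compose2[OF tent_cos_continuous[of UNIV]], auto intro!: continuous_intros)
qed (use abs_tent_cos_le in auto)

text \<open>This is the leading coefficient of the averaged oscillatory integral.
  \<open>tent_cos\<close> changes sign, so positivity is not visible pointwise; the scaling law of
  \<open>cos_moment\<close> decides it.\<close>

lemma integral_tent_cos_power_pos:
  assumes k: "2 \<le> k"
  shows "0 < (LINT u|lborel. tent_cos (u ^ k))"
proof -
  let ?g = "\<lambda>(L::real) (u::real). (1 - cos (L * u ^ k)) / (u ^ k)\<^sup>2"
  have "(LINT u|lborel. tent_cos (u ^ k)) = (LINT u|lborel. ?g 1 u - 3 / 2 * ?g 2 u + 1 / 2 * ?g 4 u)"
  proof (rule integral_cong_AE)
    show "AE u in lborel. tent_cos (u ^ k) = ?g 1 u - 3 / 2 * ?g 2 u + 1 / 2 * ?g 4 u"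
      using AE_lborel_singleton[of "0::real"]
    proof eventually_elim
      case (elim u)
      then show ?case by (simp add: tent_cos_eq divide_simps)
    qed
    show "(\<lambda>u. tent_cos (u ^ k)) \<in> borel_measurable lborel"
      using integrable_tent_cos_power[OF k] by auto
  qed measurable
  also have "\<dots> = cos_moment k 1 - 3 / 2 * cos_moment k 2 + 1 / 2 * cos_moment k 4"
  proof -
    have i: "integrable lborel (?g 1)" "integrable lborel (\<lambda>u. 3 / 2 * ?g 2 u)" "integrable lborel (\<lambda>u. 1 / 2 * ?g 4 u)"
      by (intro integrable_mult_right integrable_cos_moment k; simp)+
    have "(LINT u|lborel. ?g 1 u - 3 / 2 * ?g 2 u + 1 / 2 * ?g 4 u)
      = (LINT u|lborel. ?g 1 u - 3 / 2 * ?g 2 u) + (LINT u|lborel. 1 / 2 * ?g 4 u)"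
      by (intro Bochner_Integration.integral_add Bochner_Integration.integrable_diff i)
    also have "(LINT u|lborel. ?g 1 u - 3 / 2 * ?g 2 u) = (LINT u|lborel. ?g 1 u) - (LINT u|lborel. 3 / 2 * ?g 2 u)"
      by (intro Bochner_Integration.integral_diff i)
    finally show ?thesis unfolding cos_moment_def integral_mult_right_zero .
  qed
  \<comment> \<open>By scaling, the combination is a multiple of \<open>(x - 1) (x - 2)\<close> with \<open>x = 2 powr (2 - 1 / k) > 2\<close>; this is why the tent has its nodes at \<open>1\<close>, \<open>2\<close>, \<open>4\<close>.\<close>
  also have "\<dots> = cos_moment k 1 * ((2 powr (2 - 1 / real k) - 1) * (2 powr (2 - 1 / real k) - 2) / 2)"
  proof -
    have "(4::real) powr (2 - 1 / real k) = (2 powr (2 - 1 / real k))\<^sup>2"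
      by (simp add: powr_mult[symmetric] power2_eq_square)
    then show ?thesis using cos_moment_scale[OF k, of 2] cos_moment_scale[OF k, of 4]
      by (simp add: power2_eq_square field_simps)
  qed
  also have "\<dots> > 0"
  proof -
    have "(2::real) powr 1 < 2 powr (2 - 1 / real k)" using k by (intro powr_less_mono) (auto simp: field_simps)
    then show ?thesis using cos_moment_pos[OF k] by simp
  qed
  finally show ?thesis .
qed


text \<open>Along the \<open>k\<close>-th coordinate direction the perturbed phase integrates, against the tent,
  to \<open>tent_cos\<close>; the smallness hypothesis on \<open>Q\<close> makes the perturbation negligible.\<close>

definition perturbed_osc :: "nat \<Rightarrow> real \<Rightarrow> (real \<Rightarrow> real) \<Rightarrow> real \<Rightarrow> real \<Rightarrow> complex" where
  "perturbed_osc k m Q t0 y = integral {0..1} (\<lambda>t. cis (- (m * y * (t - t0) ^ k + Q (t - t0))))"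

lemma perturbed_osc_continuous:
  assumes "continuous_on UNIV Q"
  shows "continuous_on S (perturbed_osc k m Q t0)"
proof -
  have "continuous_on UNIV (\<lambda>y. integral (cbox 0 1) (\<lambda>t. cis (- (m * y * (t - t0) ^ k + Q (t - t0)))))"
    by (rule integral_continuous_on_param)
      (auto simp: split_beta' cis_conv_exp intro!: continuous_intros continuous_on_compose2[OF assms])
  then show ?thesis unfolding perturbed_osc_def[abs_def] by (auto intro: continuous_on_subset)
qed

text \<open>Pairing y with -y turns the leading term into the real factor 2 cos and leaves the
  perturbation outside. Exchanging the integrals then lets the tent act on the cosine alone.\<close>

lemma integral_tent_perturbed_osc:
  assumes Q: "continuous_on UNIV Q"
  shows "integral {1..4} (\<lambda>y. tent y *\<^sub>R (perturbed_osc k m Q t0 y + perturbed_osc k m Q t0 (- y)))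
     = integral {0..1} (\<lambda>t. (2 * tent_cos (m * (t - t0) ^ k)) *\<^sub>R cis (- Q (t - t0)))"
proof -
  note [continuous_intros] = continuous_on_compose2[OF Q _ subset_UNIV]
  define f where "f y t = (2 * tent y * cos (m * (t - t0) ^ k * y)) *\<^sub>R cis (- Q (t - t0))" for y t
  have "tent y *\<^sub>R (perturbed_osc k m Q t0 y + perturbed_osc k m Q t0 (- y)) = integral {0..1} (f y)" for y
  proof -
    have cint: "(\<lambda>t. cis (- (m * z * (t - t0) ^ k + Q (t - t0)))) integrable_on {0..1}" for z
      by (intro integrable_continuous_interval) (auto simp: cis_conv_exp intro!: continuous_intros)
    have "perturbed_osc k m Q t0 y + perturbed_osc k m Q t0 (- y)
       = integral {0..1} (\<lambda>t. cis (- (m * y * (t - t0) ^ k + Q (t - t0))) + cis (- (m * (- y) * (t - t0) ^ k + Q (t - t0))))"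
      unfolding perturbed_osc_def by (rule integral_add[symmetric]) (rule cint)+
    also have "\<dots> = integral {0..1} (\<lambda>t. (2 * cos (m * (t - t0) ^ k * y)) *\<^sub>R cis (- Q (t - t0)))"
    proof (rule integral_cong)
      fix t
      define x z where "x = m * (t - t0) ^ k * y" and "z = Q (t - t0)"
      have "cis (- (x + z)) + cis (- (- x + z)) = (2 * cos x) *\<^sub>R cis (- z)"
        by (simp add: complex_eq_iff cos_add sin_add cos_diff sin_diff algebra_simps)
      then show "cis (- (m * y * (t - t0) ^ k + Q (t - t0))) + cis (- (m * (- y) * (t - t0) ^ k + Q (t - t0)))
         = (2 * cos (m * (t - t0) ^ k * y)) *\<^sub>R cis (- Q (t - t0))"
        by (simp add: x_def z_def mult_ac)
    qed
    finally show ?thesis unfolding f_def by (simp add: mult_ac flip: integral_cmul)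
  qed
  then have "integral {1..4} (\<lambda>y. tent y *\<^sub>R (perturbed_osc k m Q t0 y + perturbed_osc k m Q t0 (- y)))
     = integral (cbox 1 4) (\<lambda>y. integral (cbox 0 1) (f y))" by simp
  also have "\<dots> = integral (cbox 0 1) (\<lambda>t. integral (cbox 1 4) (\<lambda>y. f y t))"
    by (rule integral_swap_continuous)
      (auto simp: f_def split_beta' cis_conv_exp intro!: continuous_intros)
  also have "\<dots> = integral {0..1} (\<lambda>t. (2 * tent_cos (m * (t - t0) ^ k)) *\<^sub>R cis (- Q (t - t0)))"
  proof -
    have "integral {1..4} (\<lambda>y. f y t) = (2 * tent_cos (m * (t - t0) ^ k)) *\<^sub>R cis (- Q (t - t0))" for t
    proof -
      define v where "v = m * (t - t0) ^ k"
      have "((\<lambda>y. tent y * cos (v * y)) has_integral tent_cos v) {1..4}"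
        unfolding tent_cos_def
        by (intro integrable_integral integrable_continuous_interval continuous_intros)
      from has_integral_scaleR_left[OF has_integral_mult_right[OF this, of 2], of "cis (- Q (t - t0))"]
      have "((\<lambda>y. f y t) has_integral ((2 * tent_cos v) *\<^sub>R cis (- Q (t - t0)))) {1..4}"
        by (simp add: f_def v_def mult.assoc)
      then show ?thesis unfolding v_def by (rule integral_unique)
    qed
    then show ?thesis by simp
  qed
  finally show ?thesis .
qed

lemma norm_cis_minus_1_le: "cmod (cis x - 1) \<le> \<bar>x\<bar>"
proof -
  have "(cmod (cis x - 1))\<^sup>2 = (cos x - 1)\<^sup>2 + (sin x)\<^sup>2"
    unfolding cmod_power2 by simp
  also have "\<dots> = 2 * (1 - cos x)"
    using sin_cos_squared_add[of x] by (simp add: power2_eq_square algebra_simps)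
  also have "\<dots> \<le> x\<^sup>2" using one_minus_cos_le[of x] by simp
  finally show ?thesis by (simp add: abs_le_square_iff[symmetric])
qed

text \<open>The average dominates twice the modulus of the integral of g(t - t0) cis(-Q) over
  [0, 1], where g(h) = \<open>tent_cos\<close> (m h^k). Without Q and over the whole line this
  integral is \<kappa> m^(-1/k); smallness of Q and m \<ge> m0 keep the two errors together below
  half of that. The middle third keeps t0 away from the ends of [0, 1].\<close>

lemma perturbed_osc_lower_bound:
  assumes k: "2 \<le> k"
  shows "\<exists>c \<epsilon> m0. 0 < c \<and> 0 < \<epsilon> \<and> 0 < m0 \<and>
    (\<forall>m Q t0. m0 \<le> m \<longrightarrow> continuous_on UNIV Q \<longrightarrow> t0 \<in> {1/3..2/3} \<longrightarrow>
      (\<forall>h. \<bar>h\<bar> \<le> 1 \<longrightarrow> \<bar>Q h\<bar> \<le> \<epsilon> * (1 + m * \<bar>h\<bar> ^ k)) \<longrightarrow>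
      c * m powr (- 1 / real k) \<le>
        integral {1..4} (\<lambda>y. cmod (perturbed_osc k m Q t0 y) + cmod (perturbed_osc k m Q t0 (- y))))"
proof -
  define \<kappa> where "\<kappa> = (LINT u|lborel. tent_cos (u ^ k))"
  have \<kappa>: "0 < \<kappa>" unfolding \<kappa>_def by (rule integral_tent_cos_power_pos[OF k])
  define B where "B = (LINT u|lborel. 1 / (1 + \<bar>(u::real) ^ k\<bar>))"
  have B: "0 \<le> B" unfolding B_def by (intro integral_nonneg_AE) auto
  \<comment> \<open>The errors add up to at most 2 \<epsilon> * 12 * (B + 1) * m^(-1/k); the 48
    makes this half of the main term.\<close>
  define \<epsilon> where "\<epsilon> = \<kappa> / (48 * (B + 1))"
  have \<epsilon>: "0 < \<epsilon>" using \<kappa> B by (simp add: \<epsilon>_def)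
  define m0 where "m0 = max 1 (3 ^ k / \<epsilon>)"
  have m0: "1 \<le> m0" by (simp add: m0_def)
  have main: "\<kappa> * m powr (- 1 / real k) \<le>
        integral {1..4} (\<lambda>y. cmod (perturbed_osc k m Q t0 y) + cmod (perturbed_osc k m Q t0 (- y)))"
    if m: "m0 \<le> m" and Q: "continuous_on UNIV Q" and t0: "t0 \<in> {1/3..2/3}"
      and Qs: "\<forall>h. \<bar>h\<bar> \<le> 1 \<longrightarrow> \<bar>Q h\<bar> \<le> \<epsilon> * (1 + m * \<bar>h\<bar> ^ k)" for m Q t0
  proof -
    note [continuous_intros] = continuous_on_compose2[OF Q _ subset_UNIV]
      continuous_on_compose2[OF tent_cos_continuous _ subset_UNIV]
    have m1: "1 \<le> m" "3 ^ k / m \<le> \<epsilon>"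
    proof -
      show "1 \<le> m" using m m0 by simp
      moreover have "3 ^ k / \<epsilon> \<le> m" using m by (simp add: m0_def)
      ultimately show "3 ^ k / m \<le> \<epsilon>" using \<epsilon> by (simp add: field_simps)
    qed
    define g where "g h = tent_cos (m * h ^ k)" for h
    have gc: "continuous_on S g" for S unfolding g_def by (intro continuous_intros)
    have gi: "integrable lborel g"
    proof (rule integrable_bounded_by_inverse_power[OF k])
      show "g \<in> borel_measurable borel" by (rule borel_measurable_continuous_onI[OF gc])
      fix u :: real
      have "norm (g u) \<le> 6 / (1 + (m * u ^ k)\<^sup>2)" unfolding g_def using abs_tent_cos_le by simp
      also have "\<dots> \<le> 6 / (1 + (u ^ k)\<^sup>2)"
      proof (rule divide_left_mono)
        have "1 * (u ^ k)\<^sup>2 \<le> m\<^sup>2 * (u ^ k)\<^sup>2" using m1 by (intro mult_right_mono one_le_power) auto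
        then show "1 + (u ^ k)\<^sup>2 \<le> 1 + (m * u ^ k)\<^sup>2" by (simp add: power_mult_distrib)
      qed (auto intro!: mult_pos_pos add_pos_nonneg)
      finally show "norm (g u) \<le> 6 / (1 + (u ^ k)\<^sup>2)" .
    qed
    have git: "integrable lborel (\<lambda>t. g (t - t0))"
      using lborel_integrable_real_affine[OF gi, of 1 "- t0"] by simp
    have gint: "(LINT t|lborel. g (t - t0)) = m powr (- 1 / real k) * \<kappa>"
    proof -
      have "(LINT h|lborel. g h) = \<bar>1\<bar> *\<^sub>R (LINT t|lborel. g (- t0 + 1 * t))"
        by (rule lborel_integral_real_affine) simp
      then show ?thesis using m1 integral_scaled_power[OF k, of m tent_cos] by (simp add: g_def \<kappa>_def)
    qed
    define G where "G t = g (t - t0) *\<^sub>R cis (- Q (t - t0))" for t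
    have Gset: "set_integrable lborel {0..1} G"
      unfolding G_def by (intro borel_integrable_atLeastAtMost')
        (auto simp: cis_conv_exp intro!: continuous_intros continuous_on_compose2[OF gc _ subset_UNIV])
    then have Gi: "integrable lborel (\<lambda>t. indicator {0..1} t *\<^sub>R G t)" by (simp add: set_integrable_def)
    have Gint: "integral {0..1} G = (LINT t|lborel. indicator {0..1} t *\<^sub>R G t)"
      using set_borel_integral_eq_integral(2)[OF Gset] by (simp add: set_lebesgue_integral_def)
    \<comment> \<open>A common majorant of both errors: \<epsilon> accounts for Q on [0, 1], and 3^k
      / m for the part outside. The quadratic decay of \<open>tent_cos\<close> pays for the growth 1
      + m |h|^k and still leaves an integrable function.\<close>
    define \<psi> where "\<psi> h = (\<epsilon> + 3 ^ k / m) * 12 * (1 / (1 + \<bar>m * h ^ k\<bar>))" for h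
    have \<psi>i: "integrable lborel (\<lambda>t. \<psi> (t - t0))"
    proof -
      have "integrable lborel (\<lambda>h. 1 / (1 + \<bar>m * h ^ k\<bar>))"
      proof (rule Bochner_Integration.integrable_bound[OF integrable_inverse_power[OF k]])
        show "AE x in lborel. norm (1 / (1 + \<bar>m * x ^ k\<bar>)) \<le> norm (1 / (1 + \<bar>x\<bar> ^ k))"
        proof (rule AE_I2)
          fix x :: real
          have "1 * \<bar>x\<bar> ^ k \<le> m * \<bar>x\<bar> ^ k" using m1 by (intro mult_right_mono) auto
          then have "1 + \<bar>x\<bar> ^ k \<le> 1 + \<bar>m * x ^ k\<bar>" using m1 by (simp add: abs_mult power_abs)
          moreover have "0 < 1 + \<bar>x\<bar> ^ k" by (simp add: add_pos_nonneg)
          ultimately show "norm (1 / (1 + \<bar>m * x ^ k\<bar>)) \<le> norm (1 / (1 + \<bar>x\<bar> ^ k))"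
            by (simp add: frac_le)
        qed
      qed measurable
      from lborel_integrable_real_affine[OF this, of 1 "- t0"]
      show ?thesis unfolding \<psi>_def by (intro integrable_mult_right) simp
    qed
    have \<psi>int: "(LINT t|lborel. \<psi> (t - t0)) = (\<epsilon> + 3 ^ k / m) * 12 * (m powr (- 1 / real k) * B)"
    proof -
      have "(LINT h|lborel. \<psi> h) = \<bar>1\<bar> *\<^sub>R (LINT t|lborel. \<psi> (- t0 + 1 * t))"
        by (rule lborel_integral_real_affine) simp
      moreover have "(LINT h|lborel. \<psi> h) = (\<epsilon> + 3 ^ k / m) * 12 * (LINT h|lborel. 1 / (1 + \<bar>m * h ^ k\<bar>))"
        unfolding \<psi>_def by (rule integral_mult_right_zero)
      moreover have "(LINT h|lborel. 1 / (1 + \<bar>m * h ^ k\<bar>)) = m powr (- 1 / real k) * B"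
        using m1 integral_scaled_power[OF k, of m "\<lambda>v. 1 / (1 + \<bar>v\<bar>)"] by (simp add: B_def)
      ultimately show ?thesis by simp
    qed
    have g\<psi>: "(\<epsilon> + 3 ^ k / m) * ((1 + m * \<bar>h\<bar> ^ k) * \<bar>g h\<bar>) \<le> \<psi> h" for h
    proof -
      define x where "x = m * \<bar>h\<bar> ^ k"
      have x: "0 \<le> x" "\<bar>m * h ^ k\<bar> = x" "(m * h ^ k)\<^sup>2 = x\<^sup>2"
        using m1 by (auto simp: x_def abs_mult power_abs power_mult_distrib)
          (metis power_abs power2_abs)
      have "(1 + x) * \<bar>g h\<bar> \<le> (1 + x) * (6 / (1 + x\<^sup>2))"
        using abs_tent_cos_le[of "m * h ^ k"] x by (intro mult_left_mono) (auto simp: g_def)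
      also have "\<dots> \<le> 12 * (1 / (1 + x))"
      proof -
        have "(1 + x) * (1 + x) \<le> 2 * (1 + x\<^sup>2)" using zero_le_power2[of "x - 1"] by (simp add: power2_eq_square algebra_simps)
        moreover have "0 < 1 + x\<^sup>2" "0 < 1 + x" using x by (auto simp: add_pos_nonneg)
        ultimately show ?thesis by (simp add: field_simps)
      qed
      finally have "(\<epsilon> + 3 ^ k / m) * ((1 + x) * \<bar>g h\<bar>) \<le> (\<epsilon> + 3 ^ k / m) * (12 * (1 / (1 + x)))"
        using \<epsilon> m1 by (intro mult_left_mono) auto
      then show ?thesis by (simp add: \<psi>_def x x_def)
    qed
    have "norm ((LINT t|lborel. indicator {0..1} t *\<^sub>R G t) - (LINT t|lborel. complex_of_real (g (t - t0))))
        = norm (LINT t|lborel. indicator {0..1} t *\<^sub>R G t - complex_of_real (g (t - t0)))"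
      using Gi git by (subst Bochner_Integration.integral_diff) (auto intro: integrable_of_real)
    also have "\<dots> \<le> (LINT t|lborel. norm (indicator {0..1} t *\<^sub>R G t - complex_of_real (g (t - t0))))"
      by (rule integral_norm_bound)
    also have "\<dots> \<le> (LINT t|lborel. \<psi> (t - t0))"
    proof (rule integral_mono[OF _ \<psi>i])
      show "integrable lborel (\<lambda>t. norm (indicator {0..1} t *\<^sub>R G t - complex_of_real (g (t - t0))))"
        using Gi git by (intro integrable_norm Bochner_Integration.integrable_diff integrable_of_real)
      fix t :: real
      define h where "h = t - t0"
      have "norm (indicator {0..1} t *\<^sub>R G t - complex_of_real (g h)) \<le> (\<epsilon> + 3 ^ k / m) * ((1 + m * \<bar>h\<bar> ^ k) * \<bar>g h\<bar>)"
      proof (cases "t \<in> {0..1}")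
        case True
        then have h: "\<bar>h\<bar> \<le> 1" using t0 by (auto simp: h_def)
        have "indicator {0..1} t *\<^sub>R G t - complex_of_real (g h) = g h *\<^sub>R (cis (- Q h) - 1)"
          using True by (simp add: G_def h_def scaleR_conv_of_real right_diff_distrib)
        then have "norm (indicator {0..1} t *\<^sub>R G t - complex_of_real (g h)) = \<bar>g h\<bar> * cmod (cis (- Q h) - 1)" by simp
        also have "\<dots> \<le> \<bar>g h\<bar> * (\<epsilon> * (1 + m * \<bar>h\<bar> ^ k))"
          using norm_cis_minus_1_le[of "- Q h"] Qs h by (intro mult_left_mono) (auto intro: order_trans)
        also have "\<dots> = \<epsilon> * ((1 + m * \<bar>h\<bar> ^ k) * \<bar>g h\<bar>)" by simp
        also have "\<dots> \<le> (\<epsilon> + 3 ^ k / m) * ((1 + m * \<bar>h\<bar> ^ k) * \<bar>g h\<bar>)"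
          using m1 by (intro mult_right_mono) auto
        finally show ?thesis .
      next
        case False
        \<comment> \<open>Outside [0, 1] the distance to t0 is at least 1/3, so 1 \<le> 3^k |h|^k;
          writing this through m |h|^k brings in the small factor 3^k / m.\<close>
        then have "1 / 3 \<le> \<bar>h\<bar>" using t0 by (auto simp: h_def abs_real_def)
        then have "(1 / 3) ^ k \<le> \<bar>h\<bar> ^ k" by (intro power_mono) auto
        then have "1 \<le> 3 ^ k * \<bar>h\<bar> ^ k" by (simp add: power_one_over field_simps)
        then have "1 * \<bar>g h\<bar> \<le> (3 ^ k * \<bar>h\<bar> ^ k) * \<bar>g h\<bar>" by (intro mult_right_mono) auto
        also have "\<dots> = (3 ^ k / m) * ((m * \<bar>h\<bar> ^ k) * \<bar>g h\<bar>)" using m1 by simp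
        also have "\<dots> \<le> (\<epsilon> + 3 ^ k / m) * ((1 + m * \<bar>h\<bar> ^ k) * \<bar>g h\<bar>)"
          using m1 \<epsilon> by (intro mult_mono mult_right_mono) auto
        finally show ?thesis using False by simp
      qed
      also have "\<dots> \<le> \<psi> h" by (rule g\<psi>)
      finally show "norm (indicator {0..1} t *\<^sub>R G t - complex_of_real (g (t - t0))) \<le> \<psi> (t - t0)" by (simp add: h_def)
    qed
    also have "\<dots> = (\<epsilon> + 3 ^ k / m) * 12 * (m powr (- 1 / real k) * B)" by (rule \<psi>int)
    also have "\<dots> \<le> (\<epsilon> + \<epsilon>) * 12 * (m powr (- 1 / real k) * (B + 1))"
      using m1 B \<epsilon> by (intro mult_mono add_mono) auto
    also have "\<dots> = \<kappa> / 2 * m powr (- 1 / real k)"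
    proof -
      have "B + 1 \<noteq> 0" using B by linarith
      then have "\<epsilon> * (B + 1) = \<kappa> / 48" unfolding \<epsilon>_def by (simp del: distrib_left_numeral)
      moreover have "(\<epsilon> + \<epsilon>) * 12 * (m powr (- 1 / real k) * (B + 1)) = 24 * (\<epsilon> * (B + 1)) * m powr (- 1 / real k)"
        by (simp add: algebra_simps)
      ultimately show ?thesis by simp
    qed
    finally have "norm ((LINT t|lborel. indicator {0..1} t *\<^sub>R G t) - complex_of_real (m powr (- 1 / real k) * \<kappa>)) \<le> \<kappa> / 2 * m powr (- 1 / real k)"
      using gint by simp
    moreover have "norm (complex_of_real (m powr (- 1 / real k) * \<kappa>)) = m powr (- 1 / real k) * \<kappa>"
      unfolding norm_of_real using \<kappa> by simp
    ultimately have low: "\<kappa> / 2 * m powr (- 1 / real k) \<le> norm (integral {0..1} G)"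
      unfolding Gint
      using norm_triangle_ineq2[of "complex_of_real (m powr (- 1 / real k) * \<kappa>)" "LINT t|lborel. indicator {0..1} t *\<^sub>R G t"]
        mult.commute[of \<kappa> "m powr (- 1 / real k)"]
      unfolding norm_minus_commute[of "complex_of_real (m powr (- 1 / real k) * \<kappa>)"] by linarith
    let ?F = "perturbed_osc k m Q t0"
    have Fc: "continuous_on S (\<lambda>y. ?F y)" "continuous_on S (\<lambda>y. ?F (- y))" for S
      by (rule perturbed_osc_continuous[OF Q])
        (rule continuous_on_compose2[OF perturbed_osc_continuous[OF Q, of UNIV]], auto intro!: continuous_intros)
    have "2 * norm (integral {0..1} G) = norm (integral {1..4} (\<lambda>y. tent y *\<^sub>R (?F y + ?F (- y))))"
    proof -
      have "integral {1..4} (\<lambda>y. tent y *\<^sub>R (?F y + ?F (- y))) = integral {0..1} (\<lambda>t. 2 *\<^sub>R G t)"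
        unfolding integral_tent_perturbed_osc[OF Q] by (simp add: G_def g_def)
      then show ?thesis by simp
    qed
    also have "\<dots> \<le> integral {1..4} (\<lambda>y. cmod (?F y) + cmod (?F (- y)))"
    proof (rule integral_norm_bound_integral)
      fix y :: real
      have "norm (tent y *\<^sub>R (?F y + ?F (- y))) \<le> 1 * (cmod (?F y) + cmod (?F (- y)))"
        using tent_bounds[of y] unfolding norm_scaleR by (intro mult_mono norm_triangle_ineq) auto
      then show "norm (tent y *\<^sub>R (?F y + ?F (- y))) \<le> cmod (?F y) + cmod (?F (- y))" by simp
    qed (auto intro!: integrable_continuous_interval continuous_intros Fc)
    finally show ?thesis using low by simp
  qed
  show ?thesis
    by (rule exI[of _ \<kappa>], rule exI[of _ \<epsilon>], rule exI[of _ m0]) (use main \<kappa> \<epsilon> m0 in auto)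
qed

text \<open>Passes from first to p-th powers by X \<le> \<rho> + \<rho>^(1-p) X^p, in place of
  Holder's inequality. Integrated over length 3 and both signs it gives I \<le> 6 \<rho> +
  \<rho>^(1-p) J.\<close>

lemma perturbed_osc_power_lower_bound:
  assumes k: "2 \<le> k" and p: "1 \<le> p"
  shows "\<exists>c \<epsilon> m0. 0 < c \<and> 0 < \<epsilon> \<and> 0 < m0 \<and>
    (\<forall>m Q t0. m0 \<le> m \<longrightarrow> continuous_on UNIV Q \<longrightarrow> t0 \<in> {1/3..2/3} \<longrightarrow>
      (\<forall>h. \<bar>h\<bar> \<le> 1 \<longrightarrow> \<bar>Q h\<bar> \<le> \<epsilon> * (1 + m * \<bar>h\<bar> ^ k)) \<longrightarrow>
      ennreal (c * m powr (- p / real k)) \<le>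
        (\<integral>\<^sup>+y. ennreal (cmod (perturbed_osc k m Q t0 y) powr p) * indicator ({1..4} \<union> {-4..-1}) y \<partial>lborel))"
proof -
  obtain c \<epsilon> m0 where c: "0 < c" "0 < \<epsilon>" "0 < m0" and
    low: "\<And>m Q t0. m0 \<le> m \<Longrightarrow> continuous_on UNIV Q \<Longrightarrow> t0 \<in> {1/3..2/3} \<Longrightarrow>
      (\<forall>h. \<bar>h\<bar> \<le> 1 \<longrightarrow> \<bar>Q h\<bar> \<le> \<epsilon> * (1 + m * \<bar>h\<bar> ^ k)) \<Longrightarrow>
      c * m powr (- 1 / real k) \<le>
        integral {1..4} (\<lambda>y. cmod (perturbed_osc k m Q t0 y) + cmod (perturbed_osc k m Q t0 (- y)))"
    using perturbed_osc_lower_bound[OF k] by blast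
  have "ennreal ((6 * (c / 12) powr p) * m powr (- p / real k)) \<le>
        (\<integral>\<^sup>+y. ennreal (cmod (perturbed_osc k m Q t0 y) powr p) * indicator ({1..4} \<union> {-4..-1}) y \<partial>lborel)"
    if m: "m0 \<le> m" and Q: "continuous_on UNIV Q" and t0: "t0 \<in> {1/3..2/3}"
      and Qs: "\<forall>h. \<bar>h\<bar> \<le> 1 \<longrightarrow> \<bar>Q h\<bar> \<le> \<epsilon> * (1 + m * \<bar>h\<bar> ^ k)" for m Q t0
  proof -
    let ?F = "perturbed_osc k m Q t0"
    have Fc: "continuous_on S (\<lambda>y. ?F y)" "continuous_on S (\<lambda>y. ?F (- y))" for S
      by (rule perturbed_osc_continuous[OF Q])
        (rule continuous_on_compose2[OF perturbed_osc_continuous[OF Q, of UNIV]], auto intro!: continuous_intros)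
    have [measurable]: "?F \<in> borel_measurable borel" by (rule borel_measurable_continuous_onI[OF Fc(1)])
    define I where "I = c * m powr (- 1 / real k)"
    \<comment> \<open>With this choice 6 \<rho> is half of I and can be absorbed.\<close>
    define \<rho> where "\<rho> = I / 12"
    have m: "0 < m" using m c by simp
    then have I: "0 < I" "0 < \<rho>" using c by (auto simp: I_def \<rho>_def)
    define J where "J = integral {1..4} (\<lambda>y. cmod (?F y) powr p + cmod (?F (- y)) powr p)"
    have pi: "(\<lambda>y. cmod (?F y) powr p + cmod (?F (- y)) powr p) integrable_on {1..4}"
      using p by (intro integrable_continuous_interval continuous_intros continuous_on_powr' Fc) auto
    have pt: "X \<le> \<rho> + \<rho> powr (1 - p) * X powr p" if "0 \<le> X" for X
    proof (cases "X \<le> \<rho>")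
      case False
      have "X = X powr (1 - p) * X powr p" using False I by (simp flip: powr_add)
      also have "\<dots> \<le> \<rho> powr (1 - p) * X powr p"
        using False I p by (intro mult_right_mono powr_mono2') auto
      finally show ?thesis using I by simp
    qed (simp add: add_increasing2)
    have "I \<le> integral {1..4} (\<lambda>y. cmod (?F y) + cmod (?F (- y)))"
      unfolding I_def by (rule low) fact+
    also have "\<dots> \<le> integral {1..4} (\<lambda>y. 2 * \<rho> + \<rho> powr (1 - p) * (cmod (?F y) powr p + cmod (?F (- y)) powr p))"
    proof (rule integral_le)
      show "(\<lambda>y. cmod (?F y) + cmod (?F (- y))) integrable_on {1..4}"
        by (intro integrable_continuous_interval continuous_intros Fc)
      show "(\<lambda>y. 2 * \<rho> + \<rho> powr (1 - p) * (cmod (?F y) powr p + cmod (?F (- y)) powr p)) integrable_on {1..4}"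
        by (intro integrable_add integrable_on_mult_right[OF pi]) auto
      show "cmod (?F y) + cmod (?F (- y)) \<le> 2 * \<rho> + \<rho> powr (1 - p) * (cmod (?F y) powr p + cmod (?F (- y)) powr p)" for y
        using pt[of "cmod (?F y)"] pt[of "cmod (?F (- y))"] by (simp add: ring_distribs)
    qed
    also have "\<dots> = 6 * \<rho> + \<rho> powr (1 - p) * J"
      by (rule integral_unique)
        (use has_integral_add[OF has_integral_const_real[of "2 * \<rho>" 1 4] has_integral_mult_right[OF integrable_integral[OF pi], of "\<rho> powr (1 - p)"]]
          in \<open>simp add: J_def\<close>)
    finally have "6 * \<rho> \<le> \<rho> powr (1 - p) * J" by (simp add: \<rho>_def)
    then have "\<rho> powr (p - 1) * (6 * \<rho>) \<le> \<rho> powr (p - 1) * (\<rho> powr (1 - p) * J)" by (intro mult_left_mono) auto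
    moreover have "\<rho> powr (p - 1) * (6 * \<rho>) = 6 * \<rho> powr p" using I by (simp add: powr_diff)
    moreover have "\<rho> powr (p - 1) * (\<rho> powr (1 - p) * J) = J" using I by (simp add: mult.assoc[symmetric] flip: powr_add)
    ultimately have "6 * \<rho> powr p \<le> J" by simp
    moreover have "\<rho> powr p = (c / 12) powr p * m powr (- p / real k)"
    proof -
      have "\<rho> = (c / 12) * m powr (- 1 / real k)" by (simp add: \<rho>_def I_def)
      then have "\<rho> powr p = (c / 12) powr p * (m powr (- 1 / real k)) powr p"
        using c by (simp only: powr_mult)
      then show ?thesis by (simp add: powr_powr)
    qed
    ultimately have "ennreal ((6 * (c / 12) powr p) * m powr (- p / real k)) \<le> ennreal J"
      by (intro ennreal_leI) (simp add: mult.assoc)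
    also have "ennreal J = (\<integral>\<^sup>+y. ennreal (cmod (?F y) powr p + cmod (?F (- y)) powr p) * indicator {1..4} y \<partial>lborel)"
      unfolding J_def by (rule nn_integral_has_integral_lebesgue'[symmetric]) (use pi in \<open>auto intro: integrable_integral\<close>)
    also have "\<dots> = (\<integral>\<^sup>+y. ennreal (cmod (?F y) powr p) * indicator {1..4} y \<partial>lborel)
        + (\<integral>\<^sup>+y. ennreal (cmod (?F (- y)) powr p) * indicator {1..4} y \<partial>lborel)"
      by (subst nn_integral_add[symmetric]) (auto simp: ring_distribs)
    also have "(\<integral>\<^sup>+y. ennreal (cmod (?F (- y)) powr p) * indicator {1..4} y \<partial>lborel)
        = (\<integral>\<^sup>+y. ennreal (cmod (?F y) powr p) * indicator {-4..-1} y \<partial>lborel)"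
    proof -
      have "(\<integral>\<^sup>+y. ennreal (cmod (?F y) powr p) * indicator {-4..-1} y \<partial>lborel)
         = ennreal \<bar>-1\<bar> * (\<integral>\<^sup>+y. ennreal (cmod (?F (0 + (-1) * y)) powr p) * indicator {-4..-1} (0 + (-1) * y) \<partial>lborel)"
        by (rule nn_integral_real_affine) auto
      moreover have "indicator {-4..-1} (- y) = (indicator {1..4} y :: ennreal)" for y :: real
        by (auto split: split_indicator)
      ultimately show ?thesis by simp
    qed
    also have "(\<integral>\<^sup>+y. ennreal (cmod (?F y) powr p) * indicator {1..4} y \<partial>lborel) + \<dots>
       = (\<integral>\<^sup>+y. ennreal (cmod (?F y) powr p) * indicator ({1..4} \<union> {-4..-1}) y \<partial>lborel)"
      by (subst nn_integral_add[symmetric]) (auto intro!: nn_integral_cong split: split_indicator)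
    finally show ?thesis .
  qed
  then show ?thesis
    by (intro exI[of _ "6 * (c / 12) powr p"] exI[of _ \<epsilon>] exI[of _ m0]) (use c in auto)
qed

section \<open>The lower bound for the energy\<close>

text \<open>The base points fill a set of full dimension instead of a hyperplane, so translation
  invariance replaces a disintegration along \<open>e\<close>; the price is the window length 2
  l.\<close>

lemma nn_integral_slice_lower_bound:
  fixes g :: "'a::euclidean_space \<Rightarrow> ennreal" and e :: 'a
  assumes [measurable]: "g \<in> borel_measurable borel" "A \<in> sets borel" and l: "0 < l"
    and slice: "\<And>x. x \<in> A \<Longrightarrow> c \<le> (\<integral>\<^sup>+\<tau>. g (x + \<tau> *\<^sub>R e) * indicator {-l..l} \<tau> \<partial>lborel)"
  shows "c * emeasure lborel A \<le> ennreal (2 * l) * (\<integral>\<^sup>+x. g x \<partial>lborel)"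
proof -
  have "c * emeasure lborel A = (\<integral>\<^sup>+x. c * indicator A x \<partial>lborel)"
    by (simp add: nn_integral_cmult_indicator)
  also have "\<dots> \<le> (\<integral>\<^sup>+x. (\<integral>\<^sup>+\<tau>. g (x + \<tau> *\<^sub>R e) * indicator {-l..l} \<tau> \<partial>lborel) \<partial>lborel)"
    by (intro nn_integral_mono) (auto split: split_indicator intro: slice)
  also have "\<dots> = (\<integral>\<^sup>+\<tau>. (\<integral>\<^sup>+x. g (x + \<tau> *\<^sub>R e) * indicator {-l..l} \<tau> \<partial>lborel) \<partial>lborel)"
    by (rule lborel_pair.Fubini'[symmetric]) measurable
  also have "\<dots> = (\<integral>\<^sup>+\<tau>. (\<integral>\<^sup>+x. g x \<partial>lborel) * indicator {-l..l} \<tau> \<partial>lborel)"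
  proof (intro nn_integral_cong)
    fix \<tau> :: real
    show "(\<integral>\<^sup>+x. g (x + \<tau> *\<^sub>R e) * indicator {-l..l} \<tau> \<partial>lborel) = (\<integral>\<^sup>+x. g x \<partial>lborel) * indicator {-l..l} \<tau>"
      by (subst nn_integral_multc) (auto simp: nn_integral_lborel_translate)
  qed
  also have "\<dots> = (\<integral>\<^sup>+x. g x \<partial>lborel) * ennreal (2 * l)"
    using l by (simp add: nn_integral_cmult_indicator)
  finally show ?thesis by (simp add: mult.commute)
qed

section \<open>Resonant boxes\<close>

context moment_index
begin

text \<open>The leading term acts at the time scale h ~ l^(-1/k), where h^j l^(j/k) ~ 1; so a
  coordinate of order j < k may have size \<delta> l^(j/k) without disturbing it. Above order k, h^j
  l is dominated by h^k l, and \<delta> l is allowed.\<close>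

definition box_radius :: "nat \<Rightarrow> real \<Rightarrow> real \<Rightarrow> 'n \<Rightarrow> real" where
  "box_radius k \<delta> l j = \<delta> * l powr (real (min (idx j) k) / real k)"

text \<open>The range from l to 4 l, with both signs, is the support [1, 4] of the tent and its
  reflection, scaled by l.\<close>

definition resonant_box :: "nat \<Rightarrow> real \<Rightarrow> real \<Rightarrow> (real ^ 'n) set" where
  "resonant_box k \<delta> l =
     {\<eta>. \<forall>j. if idx j = k then l \<le> \<bar>\<eta> $ j\<bar> \<and> \<bar>\<eta> $ j\<bar> \<le> 4 * l else \<bar>\<eta> $ j\<bar> \<le> box_radius k \<delta> l j}"

lemma borel_resonant_box [measurable]: "resonant_box k \<delta> l \<in> sets borel"
proof -
  have "closed (\<Inter>j. {\<eta> :: real ^ 'n. if idx j = k then l \<le> \<bar>\<eta> $ j\<bar> \<and> \<bar>\<eta> $ j\<bar> \<le> 4 * l else \<bar>\<eta> $ j\<bar> \<le> box_radius k \<delta> l j})"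
  proof (intro closed_INT ballI)
    fix j
    show "closed {\<eta> :: real ^ 'n. if idx j = k then l \<le> \<bar>\<eta> $ j\<bar> \<and> \<bar>\<eta> $ j\<bar> \<le> 4 * l else \<bar>\<eta> $ j\<bar> \<le> box_radius k \<delta> l j}"
      by (cases "idx j = k") (auto intro!: closed_Collect_conj closed_Collect_le continuous_intros)
  qed
  moreover have "resonant_box k \<delta> l = (\<Inter>j. {\<eta>. if idx j = k then l \<le> \<bar>\<eta> $ j\<bar> \<and> \<bar>\<eta> $ j\<bar> \<le> 4 * l else \<bar>\<eta> $ j\<bar> \<le> box_radius k \<delta> l j})"
    by (auto simp: resonant_box_def)
  ultimately show ?thesis by (simp add: borel_closed)
qed

lemma box_radius_le:
  assumes "1 \<le> l" "0 \<le> \<delta>" "1 \<le> k"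
  shows "box_radius k \<delta> l j \<le> \<delta> * l" "0 \<le> box_radius k \<delta> l j"
proof -
  have "l powr (real (min (idx j) k) / real k) \<le> l powr 1"
    using assms by (intro powr_mono) (auto simp: divide_le_eq_1)
  then show "box_radius k \<delta> l j \<le> \<delta> * l" using assms by (auto simp: box_radius_def intro: mult_left_mono)
  show "0 \<le> box_radius k \<delta> l j" using assms by (simp add: box_radius_def)
qed

text \<open>With x = l |h|^k, an order j < k contributes x^(j/k) \<le> 1 + x and an order j > k at
  most x, each times \<delta>.\<close>

lemma perturbation_small:
  assumes k: "1 \<le> k" and l: "1 \<le> l" and \<delta>: "0 \<le> \<delta>" and h: "\<bar>h\<bar> \<le> 1"
    and \<eta>: "\<And>j. idx j \<noteq> k \<Longrightarrow> \<bar>\<eta> $ j\<bar> \<le> box_radius k \<delta> l j"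
  shows "\<bar>\<Sum>j | idx j \<noteq> k. taylor_coeff h 0 (idx j) * \<eta> $ j\<bar> \<le> real d * \<delta> * (1 + l * \<bar>h\<bar> ^ k)"
proof -
  have bound: "\<bar>taylor_coeff h 0 (idx j) * \<eta> $ j\<bar> \<le> \<delta> * (1 + l * \<bar>h\<bar> ^ k)" if j: "idx j \<noteq> k" for j
  proof -
    have "\<bar>h\<bar> ^ idx j * l powr (real (min (idx j) k) / real k) \<le> 1 + l * \<bar>h\<bar> ^ k"
    proof (cases "idx j < k")
      case True
      define x where "x = l * \<bar>h\<bar> ^ k"
      define s where "s = real (idx j) / real k"
      have x: "0 \<le> x" using l by (simp add: x_def)
      have s: "0 < s" "s \<le> 1" using True idx_range(1)[of j] by (auto simp: s_def)
      have "\<bar>h\<bar> ^ idx j * l powr s = x powr s"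
      proof (cases "h = 0")
        case False
        have "x powr s = l powr s * (\<bar>h\<bar> powr real k) powr s"
          using False l by (simp add: x_def powr_mult powr_realpow)
        also have "(\<bar>h\<bar> powr real k) powr s = \<bar>h\<bar> powr (real (idx j))"
          using k by (simp add: powr_powr s_def)
        finally show ?thesis using False by (simp add: powr_realpow mult.commute)
      qed (use idx_range(1)[of j] k in \<open>simp add: x_def zero_power\<close>)
      also have "\<dots> \<le> 1 + x"
      proof (cases "x \<le> 1")
        case True
        then have "x powr s \<le> 1" using x s by (intro powr_le1) auto
        then show ?thesis using x by simp
      next
        case False
        then have "x powr s \<le> x powr 1" using s by (intro powr_mono) auto
        then show ?thesis using False by simp
      qed
      finally show ?thesis using True by (simp add: s_def x_def min_def)
    next
      case False
      then have "\<bar>h\<bar> ^ idx j \<le> \<bar>h\<bar> ^ k" using h by (intro power_decreasing) auto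
      then have "\<bar>h\<bar> ^ idx j * l \<le> \<bar>h\<bar> ^ k * l" using l by (intro mult_right_mono) auto
      moreover have "l powr (real (min (idx j) k) / real k) = l" using False l k by (simp add: min_def)
      ultimately show ?thesis using mult.commute[of l "\<bar>h\<bar> ^ k"] by (simp only:)
    qed
    then have 1: "\<delta> * (\<bar>h\<bar> ^ idx j * l powr (real (min (idx j) k) / real k)) \<le> \<delta> * (1 + l * \<bar>h\<bar> ^ k)"
      using \<delta> by (rule mult_left_mono)
    have "\<bar>taylor_coeff h 0 (idx j) * \<eta> $ j\<bar> = \<bar>h\<bar> ^ idx j / fact (idx j) * \<bar>\<eta> $ j\<bar>"
      by (simp add: taylor_coeff_def abs_mult power_abs)
    also have "\<dots> \<le> \<bar>h\<bar> ^ idx j / 1 * box_radius k \<delta> l j"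
      by (intro mult_mono divide_left_mono \<eta>[OF j]) (auto simp: fact_ge_1)
    finally show ?thesis using 1 by (simp add: box_radius_def mult_ac)
  qed
  have nn: "0 \<le> \<delta> * (1 + l * \<bar>h\<bar> ^ k)" using \<delta> l by simp
  have "\<bar>\<Sum>j | idx j \<noteq> k. taylor_coeff h 0 (idx j) * \<eta> $ j\<bar> \<le> (\<Sum>j | idx j \<noteq> k. \<delta> * (1 + l * \<bar>h\<bar> ^ k))"
    by (intro order_trans[OF sum_abs] sum_mono bound) auto
  also have "\<dots> = real (card {j. idx j \<noteq> k}) * (\<delta> * (1 + l * \<bar>h\<bar> ^ k))" by simp
  also have "\<dots> \<le> real d * (\<delta> * (1 + l * \<bar>h\<bar> ^ k))"
    using nn card_mono[of "UNIV :: 'n set" "{j. idx j \<noteq> k}"] by (intro mult_right_mono) (auto simp: card_index)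
  finally show ?thesis by (simp add: mult.assoc)
qed

text \<open>The coordinate of order k becomes the leading term and the others form the perturbation;
  2 pi and k! move into m.\<close>

lemma norm_fourier_moment_slice:
  assumes i: "idx i = k"
  shows "cmod (fourier_transform (moment_measure idx) (taylor_shift idx (- t0) (\<chi> j. if j = i then l * y else \<eta> $ j)))
    = cmod (perturbed_osc k (2 * pi * l / fact k)
        (\<lambda>h. 2 * pi * (\<Sum>j | idx j \<noteq> k. taylor_coeff h 0 (idx j) * \<eta> $ j)) t0 y)"
proof -
  define \<zeta> where "\<zeta> = (\<chi> j. if j = i then l * y else \<eta> $ j)"
  have "poly (phase_poly idx \<zeta>) h = l * y * h ^ k / fact k + (\<Sum>j | idx j \<noteq> k. taylor_coeff h 0 (idx j) * \<eta> $ j)" for h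
  proof -
    have "poly (phase_poly idx \<zeta>) h = (\<Sum>j\<in>insert i {j. idx j \<noteq> k}. taylor_coeff h 0 (idx j) * \<zeta> $ j)"
      unfolding poly_phase_poly using i idx_eq_iff by (intro sum.cong) auto
    also have "\<dots> = taylor_coeff h 0 k * \<zeta> $ i + (\<Sum>j | idx j \<noteq> k. taylor_coeff h 0 (idx j) * \<zeta> $ j)"
      using i by (subst sum.insert) auto
    also have "(\<Sum>j | idx j \<noteq> k. taylor_coeff h 0 (idx j) * \<zeta> $ j) = (\<Sum>j | idx j \<noteq> k. taylor_coeff h 0 (idx j) * \<eta> $ j)"
      using i by (intro sum.cong) (auto simp: \<zeta>_def)
    finally show ?thesis by (simp add: \<zeta>_def taylor_coeff_def)
  qed
  then show ?thesis
    unfolding norm_fourier_moment_eq[of _ t0] \<zeta>_def[symmetric] taylor_shift_inverse perturbed_osc_def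
    by (simp add: ring_distribs mult.assoc)
qed

text \<open>Look at the coordinate of order k - 1, for which the box allows only \<delta> l^(1 -
  1/k). The shift by h adds h \<eta>_k to it, of size at least |h| l, while
  \<open>real d * \<delta> \<le> 1 / 2\<close> keeps the contribution of the higher orders at most
  half of |h| l.\<close>

lemma resonant_times_close:
  assumes k: "2 \<le> k" "k \<le> d" and l: "1 \<le> l" and \<delta>: "0 \<le> \<delta>" "real d * \<delta> \<le> 1 / 2"
    and h: "\<bar>h\<bar> \<le> 1" and \<eta>: "\<eta> \<in> resonant_box k \<delta> l" "taylor_shift idx h \<eta> \<in> resonant_box k \<delta> l"
  shows "\<bar>h\<bar> \<le> 2 * l powr (- 1 / real k)"
proof -
  obtain i where i: "idx i = k" using ex_idx[of k] k by auto
  obtain i' where i': "idx i' = k - 1" using ex_idx[of "k - 1"] k by (metis Suc_1 diff_le_self diff_le_mono diff_Suc_1 order_trans)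
  define r where "r = \<delta> * l powr (1 - 1 / real k)"
  have "box_radius k \<delta> l i' = r" using i' k by (simp add: box_radius_def r_def of_nat_diff diff_divide_distrib)
  then have c: "\<bar>\<eta> $ i'\<bar> \<le> r" "\<bar>taylor_shift idx h \<eta> $ i'\<bar> \<le> r"
    using \<eta> i' k by (auto simp: resonant_box_def dest!: spec[of _ i'])
  have big: "l \<le> \<bar>\<eta> $ i\<bar>" using \<eta>(1) i by (auto simp: resonant_box_def dest!: spec[of _ i])
  define R where "R = (\<Sum>j | k < idx j. taylor_coeff h (k - 1) (idx j) * \<eta> $ j)"
  have "taylor_shift idx h \<eta> $ i' = \<eta> $ i' + h * \<eta> $ i + R"
  proof -
    have "taylor_shift idx h \<eta> $ i' = (\<Sum>j\<in>insert i' (insert i {j. k < idx j}). taylor_coeff h (k - 1) (idx j) * \<eta> $ j)"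
      unfolding taylor_shift_nth i'
    proof (rule sum.mono_neutral_right)
      show "\<forall>j\<in>UNIV - insert i' (insert i {j. k < idx j}). taylor_coeff h (k - 1) (idx j) * \<eta> $ j = 0"
      proof
        fix j assume "j \<in> UNIV - insert i' (insert i {j. k < idx j})"
        then have "\<not> k - 1 \<le> idx j" using i i' idx_eq_iff[of j i] idx_eq_iff[of j i'] by auto
        then show "taylor_coeff h (k - 1) (idx j) * \<eta> $ j = 0" by (simp add: taylor_coeff_def)
      qed
    qed auto
    also have "\<dots> = taylor_coeff h (k - 1) (idx i') * \<eta> $ i' + (taylor_coeff h (k - 1) (idx i) * \<eta> $ i + R)"
      using i i' k by (subst sum.insert, simp, force, subst sum.insert) (auto simp: R_def)
    also have "\<dots> = \<eta> $ i' + h * \<eta> $ i + R" using i i' k by (simp add: taylor_coeff_def)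
    finally show ?thesis .
  qed
  moreover have "\<bar>R\<bar> \<le> \<bar>h\<bar> * l / 2"
  proof -
    have "\<bar>taylor_coeff h (k - 1) (idx j) * \<eta> $ j\<bar> \<le> \<bar>h\<bar> * (\<delta> * l)" if "k < idx j" for j
    proof -
      have "\<bar>\<eta> $ j\<bar> \<le> box_radius k \<delta> l j" using \<eta>(1) that by (auto simp: resonant_box_def dest!: spec[of _ j])
      then have "\<bar>\<eta> $ j\<bar> \<le> \<delta> * l" using box_radius_le(1)[of l \<delta> k j] l \<delta> k by simp
      moreover have "\<bar>taylor_coeff h (k - 1) (idx j)\<bar> \<le> \<bar>h\<bar>"
      proof -
        define n where "n = idx j - (k - 1)"
        have n: "1 \<le> n" using that by (simp add: n_def)
        have "\<bar>taylor_coeff h (k - 1) (idx j)\<bar> = \<bar>h\<bar> ^ n / fact n" using that by (simp add: taylor_coeff_def n_def power_abs)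
        also have "\<dots> \<le> \<bar>h\<bar> ^ 1 / 1" using h n by (intro frac_le power_decreasing) (auto simp: fact_ge_1)
        finally show ?thesis by simp
      qed
      ultimately show ?thesis unfolding abs_mult by (intro mult_mono) auto
    qed
    then have "\<bar>R\<bar> \<le> (\<Sum>j | k < idx j. \<bar>h\<bar> * (\<delta> * l))" unfolding R_def
      by (intro order_trans[OF sum_abs] sum_mono) auto
    also have "\<dots> = real (card {j. k < idx j}) * (\<bar>h\<bar> * (\<delta> * l))" by simp
    also have "\<dots> \<le> real d * (\<bar>h\<bar> * (\<delta> * l))"
      using \<delta> l card_mono[of "UNIV :: 'n set" "{j. k < idx j}"] by (intro mult_right_mono) (auto simp: card_index)
    also have "\<dots> = (real d * \<delta>) * (\<bar>h\<bar> * l)" by simp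
    also have "\<dots> \<le> 1 / 2 * (\<bar>h\<bar> * l)" using \<delta> l by (intro mult_right_mono) auto
    finally show ?thesis by simp
  qed
  ultimately have "\<bar>h * \<eta> $ i\<bar> \<le> 2 * r + \<bar>h\<bar> * l / 2" using c by linarith
  moreover have "\<bar>h\<bar> * l \<le> \<bar>h * \<eta> $ i\<bar>" unfolding abs_mult using big by (intro mult_left_mono) auto
  ultimately have "\<bar>h\<bar> * l \<le> 4 * r" by linarith
  also have "4 * r = l * (4 * \<delta> * l powr (- 1 / real k))"
    using l by (simp add: r_def powr_diff powr_minus_divide)
  finally have "\<bar>h\<bar> \<le> 4 * \<delta> * l powr (- 1 / real k)" using l by (simp add: mult.commute)
  also have "\<dots> \<le> 2 * l powr (- 1 / real k)"
  proof (rule mult_right_mono)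
    have "2 * \<delta> \<le> real d * \<delta>" using d2 \<delta> by (intro mult_right_mono) auto
    then show "4 * \<delta> \<le> 2" using \<delta> by linarith
  qed simp
  finally show ?thesis .
qed

lemma resonant_times_measure:
  assumes "2 \<le> k" "k \<le> d" "1 \<le> l" "0 \<le> \<delta>" "real d * \<delta> \<le> 1 / 2"
  shows "(\<integral>\<^sup>+t. indicator (resonant_box k \<delta> l) (taylor_shift idx t \<xi>) * indicator {1/3..2/3} t \<partial>lborel)
     \<le> ennreal (4 * l powr (- 1 / real k))"
proof (cases "\<exists>t1\<in>{1/3..2/3}. taylor_shift idx t1 \<xi> \<in> resonant_box k \<delta> l")
  case True
  then obtain t1 where t1: "t1 \<in> {1/3..2/3}" "taylor_shift idx t1 \<xi> \<in> resonant_box k \<delta> l" by blast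
  define D where "D = 2 * l powr (- 1 / real k)"
  have D: "0 \<le> D" by (simp add: D_def)
  have "t \<in> {t1 - D..t1 + D}" if t: "t \<in> {1/3..2/3}" "taylor_shift idx t \<xi> \<in> resonant_box k \<delta> l" for t
  proof -
    have "\<bar>t - t1\<bar> \<le> D" unfolding D_def
      by (rule resonant_times_close[OF assms _ t1(2)]) (use t t1 in \<open>auto simp: taylor_shift_add\<close>)
    then show ?thesis by auto
  qed
  then have "(\<integral>\<^sup>+t. indicator (resonant_box k \<delta> l) (taylor_shift idx t \<xi>) * indicator {1/3..2/3} t \<partial>lborel)
     \<le> (\<integral>\<^sup>+t. indicator {t1 - D..t1 + D} t \<partial>lborel)"
    by (intro nn_integral_mono) (auto split: split_indicator)
  also have "\<dots> = ennreal (4 * l powr (- 1 / real k))" using D by (simp add: D_def)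
  finally show ?thesis .
next
  case False
  then have "indicator (resonant_box k \<delta> l) (taylor_shift idx t \<xi>) * indicator {1/3..2/3} t = (0::ennreal)" for t
    by (auto split: split_indicator)
  then have "(\<integral>\<^sup>+t. indicator (resonant_box k \<delta> l) (taylor_shift idx t \<xi>) * indicator {1/3..2/3} t \<partial>lborel)
     = (\<integral>\<^sup>+(t::real). 0 \<partial>lborel)" by (intro nn_integral_cong)
  then show ?thesis by simp
qed


lemma emeasure_coordinate_box_ge:
  assumes "0 \<le> \<delta>" "\<delta> \<le> 1" "1 \<le> l" "1 \<le> k"
  shows "ennreal (\<delta> ^ d * l powr (\<Sum>j\<in>UNIV. real (min (idx j) k) / real k))
     \<le> emeasure lborel (cbox (\<chi> j. - box_radius k \<delta> l j) (\<chi> j. box_radius k \<delta> l j))"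
proof -
  have r: "0 \<le> box_radius k \<delta> l j" for j using box_radius_le(2)[of l \<delta> k j] assms by simp
  let ?A = "cbox (\<chi> j. - box_radius k \<delta> l j) (\<chi> j. box_radius k \<delta> l j) :: (real ^ 'n) set"
  have ne: "?A \<noteq> {}" using r by (auto simp: mem_box_cart intro!: exI[of _ 0] simp flip: ex_in_conv)
  have "\<delta> ^ d * l powr (\<Sum>j\<in>UNIV. real (min (idx j) k) / real k) = (\<Prod>j\<in>UNIV. box_radius k \<delta> l j)"
    using assms by (simp add: box_radius_def prod.distrib card_index powr_sum)
  also have "\<dots> \<le> (\<Prod>j\<in>UNIV. 2 * box_radius k \<delta> l j)" using r by (intro prod_mono) auto
  also have "\<dots> = measure lborel ?A" using content_cbox_cart[OF ne] by simp
  finally show ?thesis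
    using emeasure_lborel_cbox_finite[of "\<chi> j. - box_radius k \<delta> l j" "\<chi> j. box_radius k \<delta> l j"]
    by (simp add: emeasure_eq_ennreal_measure ennreal_leI less_top)
qed

text \<open>Slice along the coordinate of order k: every slice based in the coordinate box
  contributes l m^(-p/k) up to constants, and the base box has volume of order l^\<sigma>. Dividing
  by the window length, of order l, leaves l^(\<sigma> - p/k).\<close>

lemma nn_integral_resonant_box_lower_bound:
  assumes k: "2 \<le> k" "k \<le> d" and p: "1 \<le> p"
  shows "\<exists>C \<delta> l0. 0 < C \<and> 0 < \<delta> \<and> real d * \<delta> \<le> 1 / 2 \<and> 1 \<le> l0 \<and>
    (\<forall>l t0. l0 \<le> l \<longrightarrow> t0 \<in> {1/3..2/3} \<longrightarrow>
      ennreal (C * l powr ((\<Sum>j\<in>UNIV. real (min (idx j) k) / real k) - p / real k)) \<le>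
      (\<integral>\<^sup>+\<eta>. ennreal (cmod (fourier_transform (moment_measure idx) (taylor_shift idx (- t0) \<eta>)) powr p)
         * indicator (resonant_box k \<delta> l) \<eta> \<partial>lborel))"
proof -
  obtain i where i: "idx i = k" using ex_idx[of k] k by auto
  obtain c \<epsilon> m0 where c: "0 < c" "0 < \<epsilon>" "0 < m0" and
    low: "\<And>m Q t0. m0 \<le> m \<Longrightarrow> continuous_on UNIV Q \<Longrightarrow> t0 \<in> {1/3..2/3} \<Longrightarrow>
      (\<forall>h. \<bar>h\<bar> \<le> 1 \<longrightarrow> \<bar>Q h\<bar> \<le> \<epsilon> * (1 + m * \<bar>h\<bar> ^ k)) \<Longrightarrow>
      ennreal (c * m powr (- p / real k)) \<le>
        (\<integral>\<^sup>+y. ennreal (cmod (perturbed_osc k m Q t0 y) powr p) * indicator ({1..4} \<union> {-4..-1}) y \<partial>lborel)"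
    using perturbed_osc_power_lower_bound[OF k(1) p] by blast
  have d0: "2 \<le> real d" using d2 by simp
  \<comment> \<open>The first bound is the hypothesis of \<open>resonant_times_close\<close>. The
    second brings the perturbation 2 pi d \<delta> (1 + l |h|^k) below \<epsilon> (1 + m |h|^k); the
    k! comes from l \<le> k! m.\<close>
  define \<delta> where "\<delta> = min (1 / (2 * real d)) (\<epsilon> / (2 * pi * real d * fact k))"
  have \<delta>: "0 < \<delta>" "\<delta> \<le> 1 / (2 * real d)" "\<delta> \<le> \<epsilon> / (2 * pi * real d * fact k)"
    using c d0 by (auto simp: \<delta>_def)
  have \<delta>': "real d * \<delta> \<le> 1 / 2" "2 * pi * real d * \<delta> * fact k \<le> \<epsilon>" "\<delta> \<le> 1"
  proof -
    show "real d * \<delta> \<le> 1 / 2" using \<delta>(2) d0 by (simp add: field_simps)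
    have "0 < 2 * pi * real d * fact k" using d0 by simp
    then show "2 * pi * real d * \<delta> * fact k \<le> \<epsilon>" using \<delta>(3) by (simp add: pos_le_divide_eq mult_ac)
    have "2 * \<delta> \<le> real d * \<delta>" using d0 \<delta> by (intro mult_right_mono) auto
    then show "\<delta> \<le> 1" using \<open>real d * \<delta> \<le> 1 / 2\<close> by linarith
  qed
  define l0 where "l0 = max 1 (m0 * fact k)"
  define \<sigma> where "\<sigma> = (\<Sum>j\<in>(UNIV::'n set). real (min (idx j) k) / real k)"
  define C where "C = c * (2 * pi / fact k) powr (- p / real k) * \<delta> ^ d / 10"
  have C: "0 < C" using c \<delta> by (simp add: C_def)
  have main: "ennreal (C * l powr (\<sigma> - p / real k)) \<le>
      (\<integral>\<^sup>+\<eta>. ennreal (cmod (fourier_transform (moment_measure idx) (taylor_shift idx (- t0) \<eta>)) powr p)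
         * indicator (resonant_box k \<delta> l) \<eta> \<partial>lborel)"
    if l: "l0 \<le> l" and t0: "t0 \<in> {1/3..2/3}" for l t0
  proof -
    define g where "g \<eta> = ennreal (cmod (fourier_transform (moment_measure idx) (taylor_shift idx (- t0) \<eta>)) powr p)
         * indicator (resonant_box k \<delta> l) \<eta>" for \<eta>
    have [measurable]: "g \<in> borel_measurable borel" unfolding g_def by measurable
    define m where "m = 2 * pi * l / fact k"
    have l1: "1 \<le> l" "m0 * fact k \<le> l" using l by (auto simp: l0_def)
    have lm: "l \<le> fact k * m"
    proof -
      have "1 * l \<le> 2 * pi * l" using pi_gt3 l1 by (intro mult_right_mono) auto
      then show ?thesis by (simp add: m_def)
    qed
    then have "m0 * fact k \<le> m * fact k" using l1 mult.commute[of "fact k" m] by linarith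
    then have "m0 \<le> m" by (rule mult_right_le_imp_le) simp
    then have mm: "m0 \<le> m" "0 < m" using c(3) by auto
    let ?A = "cbox (\<chi> j. - box_radius k \<delta> l j) (\<chi> j. box_radius k \<delta> l j) :: (real ^ 'n) set"
    \<comment> \<open>The window 5 l covers the move from x_i, with |x_i| \<le> l, to l y, with |l
      y| \<le> 4 l.\<close>
    have "ennreal (l * (c * m powr (- p / real k))) * emeasure lborel ?A \<le> ennreal (2 * (5 * l)) * (\<integral>\<^sup>+x. g x \<partial>lborel)"
    proof (rule nn_integral_slice_lower_bound[where e = "axis i 1"])
      fix x assume "x \<in> ?A"
      then have x: "\<bar>x $ j\<bar> \<le> box_radius k \<delta> l j" for j by (auto simp: mem_box_cart abs_le_iff minus_le_iff)
      define Q where "Q h = 2 * pi * (\<Sum>j | idx j \<noteq> k. taylor_coeff h 0 (idx j) * x $ j)" for h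
      have Qc: "continuous_on UNIV Q" unfolding Q_def by (intro continuous_intros)
      have "\<bar>Q h\<bar> \<le> \<epsilon> * (1 + m * \<bar>h\<bar> ^ k)" if h: "\<bar>h\<bar> \<le> 1" for h
      proof -
        have "\<bar>Q h\<bar> = 2 * pi * \<bar>\<Sum>j | idx j \<noteq> k. taylor_coeff h 0 (idx j) * x $ j\<bar>"
          by (simp add: Q_def abs_mult)
        also have "\<dots> \<le> 2 * pi * (real d * \<delta> * (1 + l * \<bar>h\<bar> ^ k))"
          by (intro mult_left_mono perturbation_small) (use k l1 \<delta> h x in auto)
        also have "\<dots> \<le> 2 * pi * (real d * \<delta> * (fact k * (1 + m * \<bar>h\<bar> ^ k)))"
        proof -
          have "l * \<bar>h\<bar> ^ k \<le> fact k * m * \<bar>h\<bar> ^ k" using lm by (intro mult_right_mono) auto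
          moreover have "(1::real) \<le> fact k" by (rule fact_ge_1)
          ultimately have "1 + l * \<bar>h\<bar> ^ k \<le> fact k + fact k * m * \<bar>h\<bar> ^ k" by (intro add_mono)
          then have "1 + l * \<bar>h\<bar> ^ k \<le> fact k * (1 + m * \<bar>h\<bar> ^ k)" by (simp add: ring_distribs mult.assoc)
          then show ?thesis using d0 \<delta> by (intro mult_left_mono) auto
        qed
        also have "\<dots> = (2 * pi * real d * \<delta> * fact k) * (1 + m * \<bar>h\<bar> ^ k)" by simp
        also have "\<dots> \<le> \<epsilon> * (1 + m * \<bar>h\<bar> ^ k)" using \<delta>' mm by (intro mult_right_mono) auto
        finally show ?thesis .
      qed
      then have 1: "ennreal (c * m powr (- p / real k)) \<le>
        (\<integral>\<^sup>+y. ennreal (cmod (perturbed_osc k m Q t0 y) powr p) * indicator ({1..4} \<union> {-4..-1}) y \<partial>lborel)"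
        by (intro low mm Qc t0) auto
      have "ennreal (l * (c * m powr (- p / real k))) = ennreal l * ennreal (c * m powr (- p / real k))"
        using l1 c by (intro ennreal_mult) auto
      also have "\<dots> \<le> ennreal l * (\<integral>\<^sup>+y. g (x + (- x $ i + l * y) *\<^sub>R axis i 1) * indicator {- (5 * l)..5 * l} (- x $ i + l * y) \<partial>lborel)"
      proof (intro mult_left_mono order_trans[OF 1] nn_integral_mono)
        fix y :: real
        show "ennreal (cmod (perturbed_osc k m Q t0 y) powr p) * indicator ({1..4} \<union> {-4..-1}) y
          \<le> g (x + (- x $ i + l * y) *\<^sub>R axis i 1) * indicator {- (5 * l)..5 * l} (- x $ i + l * y)"
        proof (cases "y \<in> {1..4} \<union> {-4..-1}")
          case True
          have y: "1 \<le> \<bar>y\<bar>" "\<bar>y\<bar> \<le> 4" using True by auto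
          have ly: "l \<le> \<bar>l * y\<bar>" "\<bar>l * y\<bar> \<le> 4 * l"
            using y l1 mult_left_mono[of 1 "\<bar>y\<bar>" l] mult_left_mono[of "\<bar>y\<bar>" 4 l] by (auto simp: abs_mult)
          define \<zeta> where "\<zeta> = (\<chi> j. if j = i then l * y else x $ j)"
          have \<zeta>: "x + (- x $ i + l * y) *\<^sub>R axis i 1 = \<zeta>"
            by (auto simp: \<zeta>_def vec_eq_iff axis_def)
          have "\<zeta> \<in> resonant_box k \<delta> l"
            using x ly i idx_eq_iff by (auto simp: resonant_box_def \<zeta>_def)
          moreover have "cmod (fourier_transform (moment_measure idx) (taylor_shift idx (- t0) \<zeta>)) = cmod (perturbed_osc k m Q t0 y)"
            unfolding \<zeta>_def norm_fourier_moment_slice[OF i] Q_def m_def ..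
          moreover have "- x $ i + l * y \<in> {- (5 * l)..5 * l}"
          proof -
            have "\<bar>x $ i\<bar> \<le> \<delta> * l" using x[of i] box_radius_le(1)[of l \<delta> k i] l1 \<delta> k by simp
            also have "\<dots> \<le> 1 * l" using \<delta>' l1 by (intro mult_right_mono) auto
            finally show ?thesis using ly by (simp add: abs_le_iff)
          qed
          ultimately show ?thesis using True unfolding \<zeta> g_def by simp
        qed simp
      qed auto
      also have "\<dots> = (\<integral>\<^sup>+\<tau>. g (x + \<tau> *\<^sub>R axis i 1) * indicator {- (5 * l)..5 * l} \<tau> \<partial>lborel)"
        using nn_integral_real_affine[of "\<lambda>\<tau>. g (x + \<tau> *\<^sub>R axis i 1) * indicator {- (5 * l)..5 * l} \<tau>" l "- x $ i"] l1
        by simp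
      finally show "ennreal (l * (c * m powr (- p / real k))) \<le> (\<integral>\<^sup>+\<tau>. g (x + \<tau> *\<^sub>R axis i 1) * indicator {- (5 * l)..5 * l} \<tau> \<partial>lborel)" .
    qed (use l1 in auto)
    moreover have "ennreal (l * (c * m powr (- p / real k))) * ennreal (\<delta> ^ d * l powr \<sigma>) \<le> ennreal (l * (c * m powr (- p / real k))) * emeasure lborel ?A"
      unfolding \<sigma>_def by (intro mult_left_mono emeasure_coordinate_box_ge) (use \<delta> \<delta>' l1 k in auto)
    ultimately have "ennreal (l * (c * m powr (- p / real k))) * ennreal (\<delta> ^ d * l powr \<sigma>) \<le> ennreal (10 * l) * (\<integral>\<^sup>+x. g x \<partial>lborel)"
      by simp
    moreover have "ennreal (l * (c * m powr (- p / real k))) * ennreal (\<delta> ^ d * l powr \<sigma>) = ennreal (10 * l) * ennreal (C * l powr (\<sigma> - p / real k))"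
    proof -
      have "m powr (- p / real k) = (2 * pi / fact k) powr (- p / real k) * l powr (- p / real k)"
      proof -
        have "m = (2 * pi / fact k) * l" by (simp add: m_def)
        then show ?thesis by (simp only: powr_mult)
      qed
      moreover have "l powr (\<sigma> - p / real k) = l powr \<sigma> * l powr (- p / real k)"
        by (simp flip: powr_add)
      ultimately have "(l * (c * m powr (- p / real k))) * (\<delta> ^ d * l powr \<sigma>) = (10 * l) * (C * l powr (\<sigma> - p / real k))"
        by (simp add: C_def)
      then show ?thesis using l1 c \<delta> C by (simp flip: ennreal_mult)
    qed
    ultimately have "ennreal (10 * l) * ennreal (C * l powr (\<sigma> - p / real k)) \<le> ennreal (10 * l) * (\<integral>\<^sup>+x. g x \<partial>lborel)" by simp
    then have "ennreal (C * l powr (\<sigma> - p / real k)) \<le> (\<integral>\<^sup>+x. g x \<partial>lborel)"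
      using l1 by (subst (asm) ennreal_mult_le_mult_iff) auto
    then show ?thesis by (simp add: g_def)
  qed
  show ?thesis
    by (rule exI[of _ C], rule exI[of _ \<delta>], rule exI[of _ l0])
      (use main C \<delta> \<delta>' in \<open>auto simp: l0_def \<sigma>_def\<close>)
qed

text \<open>On the box |\<eta>| lies between l and 4 d l, and shifts with |t| \<le> 1 change the
  norm by bounded factors only.\<close>

lemma norm_resonant_comparable:
  assumes k: "2 \<le> k" "k \<le> d" and l: "1 \<le> l" and \<delta>: "0 \<le> \<delta>" "\<delta> \<le> 1"
    and t: "\<bar>t\<bar> \<le> 1" and \<eta>: "\<eta> \<in> resonant_box k \<delta> l"
  shows "l powr a \<le> (4 * real d ^ 3) powr \<bar>a\<bar> * norm (taylor_shift idx t \<eta>) powr a"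
proof (rule powr_comparable)
  obtain i where i: "idx i = k" using ex_idx[of k] k by auto
  have d1: "1 \<le> real d" using d2 by simp
  have li: "l \<le> norm \<eta>"
    using \<eta> i component_le_norm_cart[of \<eta> i] by (auto simp: resonant_box_def dest!: spec[of _ i])
  have "\<bar>\<eta> $ j\<bar> \<le> 4 * l" for j
  proof (cases "idx j = k")
    case False
    then have "\<bar>\<eta> $ j\<bar> \<le> box_radius k \<delta> l j" using \<eta> by (auto simp: resonant_box_def dest!: spec[of _ j])
    also have "\<dots> \<le> \<delta> * l" using box_radius_le(1)[of l \<delta> k j] l \<delta> k by simp
    also have "\<dots> \<le> 1 * l" using \<delta> l by (intro mult_right_mono) auto
    finally show ?thesis using l by simp
  qed (use \<eta> in \<open>auto simp: resonant_box_def dest!: spec[of _ j]\<close>)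
  then have "(\<Sum>j\<in>UNIV. \<bar>\<eta> $ j\<bar>) \<le> (\<Sum>j\<in>(UNIV::'n set). 4 * l)" by (intro sum_mono)
  then have nl: "norm \<eta> \<le> real d * (4 * l)" using norm_le_l1_cart[of \<eta>] by (simp add: card_index)
  have "norm (taylor_shift idx t \<eta>) \<le> real d ^ 2 * norm \<eta>" by (rule norm_taylor_shift_le[OF t])
  also have "\<dots> \<le> real d ^ 2 * (real d * (4 * l))" using nl by (intro mult_left_mono) auto
  finally show "norm (taylor_shift idx t \<eta>) \<le> 4 * real d ^ 3 * l" by (simp add: power2_eq_square power3_eq_cube mult_ac)
  have le: "l \<le> real d ^ 2 * norm (taylor_shift idx t \<eta>)" using li norm_le_taylor_shift[OF t, of \<eta>] by linarith
  also have "\<dots> \<le> (4 * real d ^ 3) * norm (taylor_shift idx t \<eta>)"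
  proof (rule mult_right_mono)
    have "real d ^ 2 \<le> real d ^ 3" using d1 by (intro power_increasing) auto
    then show "real d ^ 2 \<le> 4 * real d ^ 3" using zero_le_power[of "real d" 3] by linarith
  qed auto
  finally show "l \<le> 4 * real d ^ 3 * norm (taylor_shift idx t \<eta>)" .
  show "0 < norm (taylor_shift idx t \<eta>)"
  proof (rule ccontr)
    assume "\<not> ?thesis"
    then have "norm (taylor_shift idx t \<eta>) = 0" by simp
    then show False using le l by simp
  qed
qed (use l in auto)

lemma powr_bounded_imp_nonpos:
  assumes "0 < C" "\<And>l::real. l0 \<le> l \<Longrightarrow> C * l powr x \<le> B"
  shows "x \<le> 0"
proof (rule ccontr)
  assume x: "\<not> x \<le> 0"
  define y where "y = \<bar>B\<bar> / C + 1"
  have y: "1 \<le> y" using assms(1) by (simp add: y_def)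
  define l where "l = max l0 (y powr (1 / x))"
  have "y = (y powr (1 / x)) powr x" using x y by (simp add: powr_powr)
  also have "\<dots> \<le> l powr x" using x by (intro powr_mono2) (auto simp: l_def)
  finally have "y \<le> l powr x" .
  moreover have "B / C + 1 \<le> y" using assms(1) by (simp add: y_def divide_right_mono)
  ultimately have l: "B / C + 1 \<le> l powr x" "l0 \<le> l" by (auto simp: l_def)
  have "C * (B / C + 1) \<le> C * l powr x" using assms l by (intro mult_left_mono) auto
  then show False using assms(2)[OF l(2)] assms(1) by (simp add: ring_distribs)
qed

text \<open>Integrate \<Phi> over the \<xi> with T_t \<xi> in the box, then over t in the middle
  third. For fixed t, invariance gives at least l^(a + \<sigma> - p/k) up to constants; for fixed
  \<xi> the admissible times have measure at most 4 l^(-1/k). This bounded overlap of the shifted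
  boxes is the source of the extra 1/k.\<close>

lemma finite_energy_imp_exponent_le:
  assumes k: "2 \<le> k" "k \<le> d" and p: "1 \<le> p"
    and fin: "(\<integral>\<^sup>+\<xi>. ennreal (cmod (fourier_transform (moment_measure idx) \<xi>) powr p * norm \<xi> powr a) \<partial>lborel) < \<infinity>"
  shows "1 / real k + a - p / real k + (\<Sum>j\<in>UNIV. real (min (idx j) k) / real k) \<le> 0"
proof -
  define \<Phi> where "\<Phi> \<xi> = ennreal (cmod (fourier_transform (moment_measure idx) \<xi>) powr p * norm \<xi> powr a)" for \<xi>
  have [measurable]: "\<Phi> \<in> borel_measurable borel" unfolding \<Phi>_def by measurable
  define \<sigma> where "\<sigma> = (\<Sum>j\<in>(UNIV::'n set). real (min (idx j) k) / real k)"
  obtain C \<delta> l0 where C: "0 < C" "0 < \<delta>" "real d * \<delta> \<le> 1 / 2" "1 \<le> l0" and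
    low: "\<And>l t0. l0 \<le> l \<Longrightarrow> t0 \<in> {1/3..2/3} \<Longrightarrow>
      ennreal (C * l powr (\<sigma> - p / real k)) \<le>
      (\<integral>\<^sup>+\<eta>. ennreal (cmod (fourier_transform (moment_measure idx) (taylor_shift idx (- t0) \<eta>)) powr p)
         * indicator (resonant_box k \<delta> l) \<eta> \<partial>lborel)"
    using nn_integral_resonant_box_lower_bound[OF k p] unfolding \<sigma>_def by blast
  have \<delta>1: "\<delta> \<le> 1"
  proof -
    have "1 * \<delta> \<le> real d * \<delta>" using d2 C by (intro mult_right_mono) auto
    then show ?thesis using C by linarith
  qed
  define K where "K = (4 * real d ^ 3) powr \<bar>a\<bar>"
  have K: "0 < K" using d2 by (simp add: K_def)
  obtain E where E: "(\<integral>\<^sup>+\<xi>. \<Phi> \<xi> \<partial>lborel) = ennreal E" "0 \<le> E"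
    using fin unfolding \<Phi>_def[symmetric] by (cases "\<integral>\<^sup>+\<xi>. \<Phi> \<xi> \<partial>lborel") auto
  have "(C / (3 * K)) * l powr (1 / real k + a - p / real k + \<sigma>) \<le> 4 * E" if l: "l0 \<le> l" for l
  proof -
    have l1: "1 \<le> l" using l C by simp
    let ?B = "resonant_box k \<delta> l"
    have "ennreal (l powr a / K * (C * l powr (\<sigma> - p / real k))) * indicator {1/3..2/3} t
       \<le> (\<integral>\<^sup>+\<xi>. \<Phi> \<xi> * indicator ?B (taylor_shift idx t \<xi>) * indicator {1/3..2/3} t \<partial>lborel)" for t
    proof (cases "t \<in> {1/3..2/3}")
      case True
      have "ennreal (l powr a / K * (C * l powr (\<sigma> - p / real k))) = ennreal (l powr a / K) * ennreal (C * l powr (\<sigma> - p / real k))"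
        using C K by (intro ennreal_mult) auto
      also have "\<dots> \<le> ennreal (l powr a / K) * (\<integral>\<^sup>+\<eta>. ennreal (cmod (fourier_transform (moment_measure idx) (taylor_shift idx (- t) \<eta>)) powr p)
         * indicator ?B \<eta> \<partial>lborel)"
        by (intro mult_left_mono low l True) auto
      also have "\<dots> = (\<integral>\<^sup>+\<eta>. ennreal (l powr a / K) * (ennreal (cmod (fourier_transform (moment_measure idx) (taylor_shift idx (- t) \<eta>)) powr p)
         * indicator ?B \<eta>) \<partial>lborel)"
        by (rule nn_integral_cmult[symmetric]) measurable
      also have "\<dots> \<le> (\<integral>\<^sup>+\<eta>. \<Phi> (taylor_shift idx (- t) \<eta>) * indicator ?B \<eta> \<partial>lborel)"
      proof (rule nn_integral_mono)
        fix \<eta>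
        show "ennreal (l powr a / K) * (ennreal (cmod (fourier_transform (moment_measure idx) (taylor_shift idx (- t) \<eta>)) powr p)
         * indicator ?B \<eta>) \<le> \<Phi> (taylor_shift idx (- t) \<eta>) * indicator ?B \<eta>"
        proof (cases "\<eta> \<in> ?B")
          case \<eta>: True
          have "l powr a \<le> K * norm (taylor_shift idx (- t) \<eta>) powr a"
            unfolding K_def by (rule norm_resonant_comparable[OF k l1 _ \<delta>1 _ \<eta>]) (use C True in auto)
          then have "l powr a / K \<le> norm (taylor_shift idx (- t) \<eta>) powr a" using K by (simp add: field_simps)
          then have "l powr a / K * cmod (fourier_transform (moment_measure idx) (taylor_shift idx (- t) \<eta>)) powr p
             \<le> norm (taylor_shift idx (- t) \<eta>) powr a * cmod (fourier_transform (moment_measure idx) (taylor_shift idx (- t) \<eta>)) powr p"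
            by (intro mult_right_mono) auto
          then show ?thesis using \<eta> K by (simp add: \<Phi>_def mult.commute ennreal_leI flip: ennreal_mult)
        qed simp
      qed
      also have "\<dots> = (\<integral>\<^sup>+\<xi>. \<Phi> (taylor_shift idx (- t) (taylor_shift idx t \<xi>)) * indicator ?B (taylor_shift idx t \<xi>) \<partial>lborel)"
        by (rule nn_integral_taylor_shift[symmetric]) measurable
      finally show ?thesis using True by simp
    qed simp
    then have "(\<integral>\<^sup>+t. ennreal (l powr a / K * (C * l powr (\<sigma> - p / real k))) * indicator {1/3..2/3::real} t \<partial>lborel)
       \<le> (\<integral>\<^sup>+t. (\<integral>\<^sup>+\<xi>. \<Phi> \<xi> * indicator ?B (taylor_shift idx t \<xi>) * indicator {1/3..2/3} t \<partial>lborel) \<partial>lborel)"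
      by (intro nn_integral_mono)
    also have "\<dots> = (\<integral>\<^sup>+\<xi>. (\<integral>\<^sup>+t. \<Phi> \<xi> * indicator ?B (taylor_shift idx t \<xi>) * indicator {1/3..2/3} t \<partial>lborel) \<partial>lborel)"
      by (rule lborel_pair.Fubini') measurable
    also have "\<dots> \<le> (\<integral>\<^sup>+\<xi>. \<Phi> \<xi> * ennreal (4 * l powr (- 1 / real k)) \<partial>lborel)"
    proof (rule nn_integral_mono)
      fix \<xi>
      have "(\<integral>\<^sup>+t. \<Phi> \<xi> * indicator ?B (taylor_shift idx t \<xi>) * indicator {1/3..2/3} t \<partial>lborel)
         = \<Phi> \<xi> * (\<integral>\<^sup>+t. indicator ?B (taylor_shift idx t \<xi>) * indicator {1/3..2/3} t \<partial>lborel)"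
        by (subst nn_integral_cmult[symmetric]) (auto simp: mult.assoc)
      also have "\<dots> \<le> \<Phi> \<xi> * ennreal (4 * l powr (- 1 / real k))"
        by (intro mult_left_mono resonant_times_measure) (use k l1 C in auto)
      finally show "(\<integral>\<^sup>+t. \<Phi> \<xi> * indicator ?B (taylor_shift idx t \<xi>) * indicator {1/3..2/3} t \<partial>lborel)
         \<le> \<Phi> \<xi> * ennreal (4 * l powr (- 1 / real k))" .
    qed
    also have "\<dots> = ennreal (E * (4 * l powr (- 1 / real k)))"
      using E by (simp add: nn_integral_multc ennreal_mult)
    finally have "ennreal (l powr a / K * (C * l powr (\<sigma> - p / real k)) / 3) \<le> ennreal (E * (4 * l powr (- 1 / real k)))"
      using C K by (simp add: nn_integral_cmult_indicator ennreal_mult[symmetric])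
    then have "l powr a / K * (C * l powr (\<sigma> - p / real k)) / 3 \<le> E * (4 * l powr (- 1 / real k))"
      using E by (simp add: ennreal_le_iff)
    then have "(l powr a / K * (C * l powr (\<sigma> - p / real k)) / 3) * l powr (1 / real k) \<le> (E * (4 * l powr (- 1 / real k))) * l powr (1 / real k)"
      by (intro mult_right_mono) auto
    moreover have "l powr (- 1 / real k) * l powr (1 / real k) = 1" using l1 by (simp flip: powr_add)
    moreover have "l powr (1 / real k + a - p / real k + \<sigma>) = l powr a * l powr (\<sigma> - p / real k) * l powr (1 / real k)"
      by (simp flip: powr_add add: algebra_simps)
    ultimately show ?thesis by (simp add: mult_ac)
  qed
  from powr_bounded_imp_nonpos[OF _ this] show ?thesis using C K by (simp add: \<sigma>_def)
qed

end

section \<open>The Fourier spectrum of the moment curve\<close>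

definition spectrum_line :: "nat \<Rightarrow> real \<Rightarrow> real" where
  "spectrum_line k \<theta> = 2 / real k + ((real k)\<^sup>2 - real k - 2) / (2 * real k) * \<theta>"

lemma spectrum_line_2: "spectrum_line 2 \<theta> = 1"
  by (simp add: spectrum_line_def)

lemma spectrum_line_pos:
  assumes "2 \<le> k" "0 \<le> \<theta>"
  shows "0 < spectrum_line k \<theta>"
proof -
  have "0 \<le> (real k - 2) * (real k + 1)" using assms by (intro mult_nonneg_nonneg) auto
  then have "0 \<le> (real k)\<^sup>2 - real k - 2" by (simp add: power2_eq_square algebra_simps)
  then have "0 \<le> ((real k)\<^sup>2 - real k - 2) / (2 * real k) * \<theta>" using assms by (intro mult_nonneg_nonneg divide_nonneg_nonneg) auto
  moreover have "0 < 2 / real k" using assms by simp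
  ultimately show ?thesis unfolding spectrum_line_def by linarith
qed

text \<open>With p = 2/\<theta> and a = s/\<theta> - d, the exponent that decides convergence in
  both directions is a positive multiple of s minus the k-th line; this is where the lines come
  from.\<close>

lemma exponent_eq_spectrum_line:
  assumes k: "1 \<le> k" and \<theta>: "0 < \<theta>"
  shows "(1 - 2 / \<theta>) + (s / \<theta> - d) * real k + (real k * (real k + 1) / 2 + (d - real k) * real k)
    = real k / \<theta> * (s - spectrum_line k \<theta>)"
  using assms by (simp add: spectrum_line_def field_simps power2_eq_square)

lemma ennpowr_finite_iff: "ennpowr x p < \<infinity> \<longleftrightarrow> x < \<infinity>"
  by (auto simp: ennpowr_def less_top)

context moment_index
begin

text \<open>The left side is k times the logarithmic volume of the resonant box, the right side the
  quadratic term of the integrability condition: the two bounds match.\<close>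

lemma sum_min_idx:
  assumes k: "1 \<le> k" "k \<le> d"
  shows "(\<Sum>j\<in>UNIV. real (min (idx j) k)) = real k * (real k + 1) / 2 + (real d - real k) * real k"
proof -
  have "(\<Sum>j\<in>UNIV. real (min (idx j) k)) = (\<Sum>j\<in>{1..d}. real (min j k))"
    by (rule sum_idx[of "\<lambda>j. real (min j k)"])
  also have "\<dots> = (\<Sum>j\<in>{1..k}. real (min j k)) + (\<Sum>j\<in>{Suc k..d}. real (min j k))"
    using k by (subst sum.union_disjoint[symmetric]) (auto intro!: sum.cong)
  also have "(\<Sum>j\<in>{1..k}. real (min j k)) = (\<Sum>j\<in>{1..k}. real j)" by (intro sum.cong) auto
  also have "(\<Sum>j\<in>{Suc k..d}. real (min j k)) = (\<Sum>j\<in>{Suc k..d}. real k)" by (intro sum.cong) auto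
  finally show ?thesis using k unfolding gauss_sum_real by (simp add: of_nat_diff)
qed

lemma fourier_energy_moment_pos:
  assumes "0 < \<theta>"
  shows "fourier_energy s \<theta> (moment_measure idx) < \<infinity> \<longleftrightarrow>
    (\<integral>\<^sup>+\<xi>. ennreal (cmod (fourier_transform (moment_measure idx) \<xi>) powr (2 / \<theta>) * norm \<xi> powr (s / \<theta> - real d)) \<partial>lborel) < \<infinity>"
  using assms by (simp add: fourier_energy_def ennpowr_finite_iff[simplified] card_index)

lemma finite_energy_imp_le_line:
  assumes \<theta>: "0 < \<theta>" "\<theta> \<le> 1" and k: "2 \<le> k" "k \<le> d"
    and fin: "fourier_energy s \<theta> (moment_measure idx) < \<infinity>"
  shows "s \<le> spectrum_line k \<theta>"
proof -
  have p: "1 \<le> 2 / \<theta>" using \<theta> by (simp add: field_simps)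
  have "1 / real k + (s / \<theta> - real d) - 2 / \<theta> / real k + (\<Sum>j\<in>UNIV. real (min (idx j) k) / real k) \<le> 0"
    using fin unfolding fourier_energy_moment_pos[OF \<theta>(1)] by (rule finite_energy_imp_exponent_le[OF k p])
  then have "real k * (1 / real k + (s / \<theta> - real d) - 2 / \<theta> / real k + (\<Sum>j\<in>UNIV. real (min (idx j) k)) / real k) \<le> 0"
    using k by (simp add: mult_nonneg_nonpos sum_divide_distrib)
  also have "real k * (1 / real k + (s / \<theta> - real d) - 2 / \<theta> / real k + (\<Sum>j\<in>UNIV. real (min (idx j) k)) / real k)
     = (1 - 2 / \<theta>) + (s / \<theta> - real d) * real k + (real k * (real k + 1) / 2 + (real d - real k) * real k)"
    proof -
    have "real k * (1 / real k + A - B / real k + S / real k) = (1 - B) + A * real k + S" for A B S :: real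
      using k by (simp add: field_simps)
    moreover have "1 \<le> k" using k by simp
    ultimately show ?thesis using k by (simp only: sum_min_idx)
  qed
  also have "\<dots> = real k / \<theta> * (s - spectrum_line k \<theta>)"
    using k \<theta> by (intro exponent_eq_spectrum_line) auto
  finally have "real k / \<theta> * (s - spectrum_line k \<theta>) \<le> 0" .
  moreover have "0 < real k / \<theta>" using k \<theta> by simp
  ultimately show ?thesis using mult_pos_pos[of "real k / \<theta>" "s - spectrum_line k \<theta>"] by linarith
qed

lemma finite_energy_of_lt_lines:
  assumes \<theta>: "0 < \<theta>" "\<theta> \<le> 1" and s: "0 < s" "\<And>k. k \<in> {2..d} \<Longrightarrow> s < spectrum_line k \<theta>"
  shows "fourier_energy s \<theta> (moment_measure idx) < \<infinity>"
  unfolding fourier_energy_moment_pos[OF \<theta>(1)]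
proof (rule fourier_moment_power_integral_finite)
  show "1 \<le> 2 / \<theta>" using \<theta> by (simp add: field_simps)
  show "- real d < s / \<theta> - real d" using s \<theta> by simp
  fix k assume k: "k \<in> {1..d}"
  have "s < spectrum_line k \<theta>"
  proof (cases "k = 1")
    case True
    have "s < 1" using s(2)[of 2] d2 by (simp add: spectrum_line_2)
    then show ?thesis using True \<theta> by (simp add: spectrum_line_def)
  qed (use k s in auto)
  then have "real k / \<theta> * (s - spectrum_line k \<theta>) < 0" using k \<theta> by (intro mult_pos_neg) auto
  then show "(1 - 2 / \<theta>) + (s / \<theta> - real d) * real k + (real k * (real k + 1) / 2 + (real d - real k) * real k) < 0"
    using k \<theta> by (subst exponent_eq_spectrum_line) auto
qed

text \<open>The squared decay |\<xi>|^(-2/d) balances the weight exactly, so even the critical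
  exponent has finite energy; s \<ge> 0 bounds the weight in the unit ball.\<close>

lemma fourier_energy_zero_finite:
  assumes s: "0 \<le> s" "s \<le> 2 / real d"
  shows "fourier_energy s 0 (moment_measure idx) < \<infinity>"
proof -
  define C where "C = osc_const * 2 * real d ^ 3"
  have "1 * 1 \<le> osc_const * (2 * real d ^ 3)"
  proof (rule mult_mono)
    have "1 \<le> real d ^ 3" using d2 by (intro one_le_power) auto
    then show "1 \<le> 2 * real d ^ 3" by simp
  qed (use osc_const_ge_1 in auto)
  then have C: "1 \<le> C" by (simp add: C_def mult.assoc)
  have "(cmod (fourier_transform (moment_measure idx) \<xi>))\<^sup>2 * norm \<xi> powr s \<le> C\<^sup>2" for \<xi>
  proof (cases "norm \<xi> < 1")
    case True
    have "(cmod (fourier_transform (moment_measure idx) \<xi>))\<^sup>2 * norm \<xi> powr s \<le> 1 * 1"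
      using norm_fourier_moment_le_1 True s by (intro mult_mono power_le_one powr_le1) auto
    also have "\<dots> \<le> C\<^sup>2" using C by (simp add: one_le_power)
    finally show ?thesis .
  next
    case False
    then have n: "1 \<le> norm \<xi>" by simp
    have "(cmod (fourier_transform (moment_measure idx) \<xi>))\<^sup>2 \<le> (C * norm \<xi> powr (- 1 / real d))\<^sup>2"
      using norm_fourier_moment_decay[OF n] by (intro power_mono) (auto simp: C_def)
    moreover have "norm \<xi> powr s \<le> norm \<xi> powr (2 / real d)" using n s by (intro powr_mono) auto
    ultimately have "(cmod (fourier_transform (moment_measure idx) \<xi>))\<^sup>2 * norm \<xi> powr s
        \<le> (C * norm \<xi> powr (- 1 / real d))\<^sup>2 * norm \<xi> powr (2 / real d)"
      by (intro mult_mono) auto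
    also have "\<dots> = C\<^sup>2 * (norm \<xi> powr (- 1 / real d) * norm \<xi> powr (- 1 / real d) * norm \<xi> powr (2 / real d))"
      by (simp add: power2_eq_square)
    also have "norm \<xi> powr (- 1 / real d) * norm \<xi> powr (- 1 / real d) * norm \<xi> powr (2 / real d) = 1"
    proof -
      have "- 1 / real d + - 1 / real d + 2 / real d = 0" by (simp add: add_divide_distrib[symmetric])
      moreover have "norm \<xi> \<noteq> 0" using n by linarith
      ultimately show ?thesis by (simp only: powr_add[symmetric]) simp
    qed
    finally show ?thesis by simp
  qed
  then have "fourier_energy s 0 (moment_measure idx) \<le> ennreal (C\<^sup>2)"
    by (auto simp: fourier_energy_def intro!: SUP_least ennreal_leI)
  then show ?thesis by (rule le_less_trans) simp
qed

text \<open>Since no volume enters, points on the axis of order d suffice, shifted to time 1/2 so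
  that Q = 0. A finite supremum bounds the transform there by a multiple of l^(-s/2), while its
  average is at least of order l^(-1/d).\<close>

lemma fourier_energy_zero_imp_le:
  assumes fin: "fourier_energy s 0 (moment_measure idx) < \<infinity>"
  shows "s \<le> 2 / real d"
proof -
  let ?F = "\<lambda>\<xi>. cmod (fourier_transform (moment_measure idx) \<xi>)"
  have d: "2 \<le> d" by (rule d2)
  obtain i where i: "idx i = d" using ex_idx[of d] d by auto
  obtain E where E: "0 \<le> E" "fourier_energy s 0 (moment_measure idx) = ennreal E"
    using fin by (cases "fourier_energy s 0 (moment_measure idx)") auto
  have bound: "(?F \<xi>)\<^sup>2 * norm \<xi> powr s \<le> E" for \<xi>
  proof -
    have "ennreal ((?F \<xi>)\<^sup>2 * norm \<xi> powr s) \<le> fourier_energy s 0 (moment_measure idx)"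
      by (auto simp: fourier_energy_def intro!: SUP_upper2[of \<xi>])
    then show ?thesis using E by (simp add: ennreal_le_iff)
  qed
  obtain c \<epsilon> m0 where c: "0 < c" "0 < \<epsilon>" "0 < m0" and
    low: "\<And>m Q t0. m0 \<le> m \<Longrightarrow> continuous_on UNIV Q \<Longrightarrow> t0 \<in> {1/3..2/3} \<Longrightarrow>
      (\<forall>h. \<bar>h\<bar> \<le> 1 \<longrightarrow> \<bar>Q h\<bar> \<le> \<epsilon> * (1 + m * \<bar>h\<bar> ^ d)) \<Longrightarrow>
      c * m powr (- 1 / real d) \<le>
        integral {1..4} (\<lambda>y. cmod (perturbed_osc d m Q t0 y) + cmod (perturbed_osc d m Q t0 (- y)))"
    using perturbed_osc_lower_bound[OF d] by blast
  define K where "K = (4 * real d ^ 3) powr \<bar>s\<bar>"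
  have K: "0 < K" using d by (simp add: K_def)
  have main: "c * (2 * pi / fact d) powr (- 1 / real d) * l powr (s / 2 - 1 / real d) \<le> 6 * sqrt (E * K)"
    if l: "max 1 (m0 * fact d) \<le> l" for l
  proof -
    define m where "m = 2 * pi * l / fact d"
    have l1: "1 \<le> l" "m0 * fact d \<le> l" using l by auto
    have "1 * l \<le> 2 * pi * l" using pi_gt3 l1 by (intro mult_right_mono) auto
    moreover have "m * fact d = 2 * pi * l" by (simp add: m_def)
    ultimately have "m0 * fact d \<le> m * fact d" using l1 by linarith
    then have "m0 \<le> m" by (rule mult_right_le_imp_le) simp
    then have mm: "m0 \<le> m" "0 < m" using c(3) by auto
    define G where "G y = cmod (perturbed_osc d m (\<lambda>_. 0) (1/2) y)" for y
    have G: "G y \<le> sqrt (E * K) * l powr (- s / 2)" if y: "1 \<le> \<bar>y\<bar>" "\<bar>y\<bar> \<le> 4" for y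
    proof -
      define \<zeta> where "\<zeta> = (\<chi> j. if j = i then l * y else 0)"
      define \<xi> where "\<xi> = taylor_shift idx (- (1/2)) \<zeta>"
      have GF: "G y = ?F \<xi>"
        using norm_fourier_moment_slice[OF i, of "1/2" l y 0]
        by (simp add: G_def \<xi>_def \<zeta>_def m_def cong: if_cong)
      have ly: "l \<le> \<bar>l * y\<bar>" "\<bar>l * y\<bar> \<le> 4 * l"
        using y l1 mult_left_mono[of 1 "\<bar>y\<bar>" l] mult_left_mono[of "\<bar>y\<bar>" 4 l] by (auto simp: abs_mult)
      \<comment> \<open>With \<delta> = 0 the box lies on the axis of order d, and
        \<open>norm_resonant_comparable\<close> still gives |\<xi>| ~ l.\<close>
      have "\<zeta> \<in> resonant_box d 0 l"
        using ly i idx_eq_iff by (auto simp: resonant_box_def \<zeta>_def box_radius_def)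
      then have "l powr s \<le> K * norm \<xi> powr s"
        unfolding K_def \<xi>_def by (intro norm_resonant_comparable[OF d]) (use l1 in auto)
      then have "(G y)\<^sup>2 * l powr s \<le> (G y)\<^sup>2 * (K * norm \<xi> powr s)" by (intro mult_left_mono) auto
      also have "\<dots> = K * ((?F \<xi>)\<^sup>2 * norm \<xi> powr s)" by (simp add: GF)
      also have "\<dots> \<le> K * E" using bound K by (intro mult_left_mono) auto
      finally have "(G y)\<^sup>2 * l powr s * l powr (- s) \<le> K * E * l powr (- s)" by (intro mult_right_mono) auto
      moreover have "l powr s * l powr (- s) = 1" using l1 by (simp flip: powr_add)
      ultimately have "(G y)\<^sup>2 \<le> K * E * l powr (- s)" by (simp add: mult.assoc)
      also have "\<dots> = (sqrt (E * K) * l powr (- s / 2))\<^sup>2"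
      proof -
        have "(l powr (- s / 2))\<^sup>2 = l powr (- s)" using l1 by (simp add: power2_eq_square flip: powr_add)
        then show ?thesis using E K by (simp add: power_mult_distrib)
      qed
      finally show ?thesis by (rule power2_le_imp_le) (use E K in auto)
    qed
    have "c * m powr (- 1 / real d) \<le> integral {1..4} (\<lambda>y. G y + G (- y))"
      unfolding G_def using mm c by (intro low) auto
    also have "\<dots> \<le> integral {1..4::real} (\<lambda>y. 2 * (sqrt (E * K) * l powr (- s / 2)))"
    proof (rule integral_le)
      have "continuous_on {1..4} (\<lambda>y. G y)" "continuous_on {1..4} (\<lambda>y. G (- y))"
        unfolding G_def
        by (intro continuous_on_norm perturbed_osc_continuous continuous_on_const)
           (intro continuous_on_norm continuous_on_compose2[OF perturbed_osc_continuous[of "\<lambda>_. 0" UNIV]] continuous_intros, auto)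
      then show "(\<lambda>y. G y + G (- y)) integrable_on {1..4}"
        by (intro integrable_continuous_interval continuous_intros)
      show "G y + G (- y) \<le> 2 * (sqrt (E * K) * l powr (- s / 2))" if "y \<in> {1..4}" for y
        using G[of y] G[of "- y"] that by auto
    qed auto
    also have "\<dots> = 6 * sqrt (E * K) * l powr (- s / 2)" by simp
    finally have "c * m powr (- 1 / real d) * l powr (s / 2) \<le> 6 * sqrt (E * K) * l powr (- s / 2) * l powr (s / 2)"
      by (intro mult_right_mono) auto
    moreover have "l powr (- s / 2) * l powr (s / 2) = 1" using l1 by (simp flip: powr_add)
    moreover have "m powr (- 1 / real d) = (2 * pi / fact d) powr (- 1 / real d) * l powr (- 1 / real d)"
    proof -
      have "m = (2 * pi / fact d) * l" by (simp add: m_def)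
      then show ?thesis by (simp only: powr_mult)
    qed
    moreover have "l powr (s / 2 - 1 / real d) = l powr (- 1 / real d) * l powr (s / 2)"
      by (simp flip: powr_add)
    ultimately show ?thesis by (simp add: mult.assoc)
  qed
  have "s / 2 - 1 / real d \<le> 0" by (rule powr_bounded_imp_nonpos[OF _ main]) (use c in simp, assumption)
  then show ?thesis by simp
qed

lemma Min_spectrum_line_0: "(MIN k\<in>{2..d}. spectrum_line k 0) = 2 / real d"
proof (rule Min_eqI)
  show "2 / real d \<in> (\<lambda>k. spectrum_line k 0) ` {2..d}" using d2 by (auto simp: spectrum_line_def)
  show "2 / real d \<le> y" if "y \<in> (\<lambda>k. spectrum_line k 0) ` {2..d}" for y
    using that by (auto simp: spectrum_line_def intro!: divide_left_mono)
qed simp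

theorem fourier_spectrum_moment:
  assumes \<theta>: "\<theta> \<in> {0..1}"
  shows "fourier_spectrum \<theta> (moment_measure idx) = ereal (MIN k\<in>{2..d}. spectrum_line k \<theta>)"
proof (cases "\<theta> = 0")
  case True
  show ?thesis
    unfolding fourier_spectrum_def True Min_spectrum_line_0
  proof (rule antisym)
    show "(SUP s\<in>{s. fourier_energy s 0 (moment_measure idx) < \<infinity>}. ereal s) \<le> ereal (2 / real d)"
      by (rule SUP_least) (use fourier_energy_zero_imp_le in auto)
    show "ereal (2 / real d) \<le> (SUP s\<in>{s. fourier_energy s 0 (moment_measure idx) < \<infinity>}. ereal s)"
      by (rule SUP_upper) (use fourier_energy_zero_finite[of "2 / real d"] in auto)
  qed
next
  case False
  define m where "m = (MIN k\<in>{2..d}. spectrum_line k \<theta>)"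
  have \<theta>: "0 < \<theta>" "\<theta> \<le> 1" using \<theta> False by auto
  have ne: "{2..d} \<noteq> {}" using d2 by auto
  have m: "m \<le> spectrum_line k \<theta>" if "k \<in> {2..d}" for k unfolding m_def using that by (intro Min_le) auto
  have "m \<in> (\<lambda>k. spectrum_line k \<theta>) ` {2..d}" unfolding m_def using ne by (intro Min_in) auto
  then obtain k where k: "k \<in> {2..d}" "m = spectrum_line k \<theta>" by auto
  have m0: "0 < m" unfolding k(2) using k(1) \<theta> by (intro spectrum_line_pos) auto
  show ?thesis
    unfolding fourier_spectrum_def m_def[symmetric]
  proof (rule antisym)
    show "(SUP s\<in>{s. fourier_energy s \<theta> (moment_measure idx) < \<infinity>}. ereal s) \<le> ereal m"
      by (rule SUP_least) (use k finite_energy_imp_le_line[OF \<theta>, of k] in auto)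
    show "ereal m \<le> (SUP s\<in>{s. fourier_energy s \<theta> (moment_measure idx) < \<infinity>}. ereal s)"
      unfolding le_SUP_iff
    proof (intro allI impI)
      fix y assume "y < ereal m"
      then obtain r where r: "y < ereal r" "ereal r < ereal m" using ereal_dense2 by blast
      \<comment> \<open>\<open>finite_energy_of_lt_lines\<close> asks for s > 0, the integrability
        at the origin, but r may be negative; m / 2 repairs this.\<close>
      define s where "s = max r (m / 2)"
      have s: "0 < s" "s < m" "y < ereal s"
        using r m0 by (auto simp: s_def intro: less_le_trans)
      have "fourier_energy s \<theta> (moment_measure idx) < \<infinity>"
        by (rule finite_energy_of_lt_lines[OF \<theta> s(1)]) (use s m in force)
      then show "\<exists>i\<in>{s. fourier_energy s \<theta> (moment_measure idx) < \<infinity>}. y < ereal i" using s by blast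
    qed
  qed
qed

end

section \<open>The Hausdorff dimension of the moment curve\<close>

context moment_index
begin

lemma dist_moment_map_le:
  assumes "t \<in> {0..1}" "u \<in> {0..1}"
  shows "dist (moment_map idx t) (moment_map idx u) \<le> real d * \<bar>t - u\<bar>"
proof -
  have "\<bar>(moment_map idx t - moment_map idx u) $ i\<bar> \<le> \<bar>t - u\<bar>" for i
  proof -
    obtain n where n: "idx i = Suc n" using idx_range(1)[of i] by (cases "idx i") auto
    have "norm (t ^ idx i - u ^ idx i) \<le> real (idx i) * norm (t - u)"
      by (rule norm_power_diff) (use assms in auto)
    also have "\<dots> \<le> fact (idx i) * norm (t - u)"
    proof (rule mult_right_mono)
      have "idx i \<le> fact (idx i)" by (rule fact_ge_self)
      then have "real (idx i) \<le> real (fact (idx i))" by (rule of_nat_mono)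
      then show "real (idx i) \<le> fact (idx i)" by simp
    qed simp
    finally have "\<bar>t ^ idx i - u ^ idx i\<bar> / fact (idx i) \<le> \<bar>t - u\<bar>"
      by (simp add: field_simps)
    then show ?thesis by (simp add: moment_map_def diff_divide_distrib[symmetric])
  qed
  then have "(\<Sum>i\<in>UNIV. \<bar>(moment_map idx t - moment_map idx u) $ i\<bar>) \<le> (\<Sum>i\<in>(UNIV::'n set). \<bar>t - u\<bar>)"
    by (intro sum_mono)
  then show ?thesis
    using norm_le_l1_cart[of "moment_map idx t - moment_map idx u"] by (simp add: dist_norm card_index)
qed

lemma hausdorff_premeasure_moment_curve_le:
  assumes N: "1 \<le> N" "real d / real N \<le> \<delta>" and s: "0 < s"
  shows "hausdorff_premeasure s \<delta> (moment_curve idx) \<le> ennreal (real d powr s * real N powr (1 - s))"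
proof -
  define I where "I i = {real i / real N..(real i + 1) / real N}" for i
  define U where "U i = (if i < N then moment_map idx ` I i else {})" for i
  have I01: "I i \<subseteq> {0..1}" if "i < N" for i
    using that N by (auto simp: I_def field_simps)
  have dU: "dist x y \<le> real d / real N" if xy: "x \<in> U i" "y \<in> U i" for x y i
  proof -
    have i: "i < N" using xy by (auto simp: U_def split: if_splits)
    obtain t u where tu: "t \<in> I i" "u \<in> I i" "x = moment_map idx t" "y = moment_map idx u"
      using xy i unfolding U_def by auto
    have "dist x y \<le> real d * \<bar>t - u\<bar>" unfolding tu using I01[OF i] tu by (intro dist_moment_map_le) auto
    also have "\<dots> \<le> real d * (1 / real N)"
      using tu(1,2) by (intro mult_left_mono) (auto simp: I_def add_divide_distrib)
    finally show ?thesis by simp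
  qed
  have bU: "bounded (U i)" for i
  proof (cases "U i = {}")
    case False
    then obtain x where "x \<in> U i" by blast
    then have "U i \<subseteq> cball x (real d / real N)" using dU by auto
    then show ?thesis by (rule bounded_subset[OF bounded_cball])
  qed simp
  have diam: "diameter (U i) \<le> real d / real N" for i
    by (rule diameter_le) (use dU in \<open>auto simp: dist_norm\<close>)
  have cover: "moment_curve idx \<subseteq> (\<Union>i. U i)"
  proof
    fix x assume "x \<in> moment_curve idx"
    then obtain t where t: "t \<in> {0..1}" "x = moment_map idx t" by (auto simp: moment_curve_def)
    \<comment> \<open>The minimum with N - 1 puts the endpoint t = 1 into the last interval.\<close>
    define i where "i = min (nat \<lfloor>t * real N\<rfloor>) (N - 1)"
    have iN: "i < N" using N by (auto simp: i_def)
    have tN: "0 \<le> t * real N" "t * real N \<le> real N" using t by (auto simp: mult_left_le_one_le)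
    have "real i \<le> t * real N" using tN by (auto simp: i_def min_def) linarith+
    moreover have "t * real N \<le> real i + 1"
      using tN N by (auto simp: i_def min_def of_nat_diff)
    ultimately have "t \<in> I i" using N by (auto simp: I_def field_simps)
    then show "x \<in> (\<Union>i. U i)" using t iN by (auto simp: U_def)
  qed
  have "hausdorff_premeasure s \<delta> (moment_curve idx) \<le> (\<Sum>i. diam_weight s (U i))"
    unfolding hausdorff_premeasure_def
    by (rule INF_lower) (use cover bU diam N in \<open>auto intro: order_trans\<close>)
  also have "\<dots> = (\<Sum>i<N. diam_weight s (U i))"
    by (rule suminf_finite) (auto simp: U_def diam_weight_def)
  also have "\<dots> \<le> (\<Sum>i<N. ennreal ((real d / real N) powr s))"
  proof (rule sum_mono)
    fix i
    show "diam_weight s (U i) \<le> ennreal ((real d / real N) powr s)"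
      using s diam[of i] diameter_ge_0[OF bU[of i]]
      by (auto simp: diam_weight_def intro!: ennreal_leI powr_mono2)
  qed
  also have "\<dots> = ennreal (real N * (real d / real N) powr s)"
    by (simp add: ennreal_mult ennreal_of_nat_eq_real_of_nat)
  also have "real N * (real d / real N) powr s = real d powr s * real N powr (1 - s)"
    using N by (simp add: powr_divide powr_diff)
  finally show ?thesis .
qed

lemma hausdorff_measure_moment_curve_zero:
  assumes s: "1 < s"
  shows "hausdorff_measure s (moment_curve idx) = 0"
proof -
  have "hausdorff_premeasure s \<delta> (moment_curve idx) \<le> 0" if \<delta>: "0 < \<delta>" for \<delta>
  proof (rule ennreal_le_epsilon)
    fix e :: real assume e: "0 < e"
    have "((\<lambda>N. real d powr s * real N powr (1 - s)) \<longlongrightarrow> real d powr s * 0) sequentially"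
      using s by (intro tendsto_mult tendsto_const tendsto_neg_powr filterlim_real_sequentially) auto
    then have "eventually (\<lambda>N. real d powr s * real N powr (1 - s) < e) sequentially"
      using e by (simp add: order_tendstoD)
    moreover have "eventually (\<lambda>N. real d / \<delta> \<le> real N) sequentially"
      using filterlim_real_sequentially by (simp add: filterlim_at_top)
    ultimately have "eventually (\<lambda>N. real d powr s * real N powr (1 - s) < e \<and> real d / \<delta> \<le> real N \<and> 1 \<le> N) sequentially"
      using eventually_ge_at_top[of 1] by eventually_elim auto
    then obtain N where N: "real d powr s * real N powr (1 - s) < e" "real d / \<delta> \<le> real N" "1 \<le> N"
      by (auto simp: eventually_sequentially)
    have "real d / real N \<le> \<delta>" using N \<delta> by (simp add: field_simps)
    then have "hausdorff_premeasure s \<delta> (moment_curve idx) \<le> ennreal (real d powr s * real N powr (1 - s))"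
      using N s by (intro hausdorff_premeasure_moment_curve_le) auto
    also have "\<dots> \<le> ennreal e" using N by (intro ennreal_leI) simp
    finally show "hausdorff_premeasure s \<delta> (moment_curve idx) \<le> 0 + ennreal e" by simp
  qed
  then have "hausdorff_measure s (moment_curve idx) \<le> 0"
    unfolding hausdorff_measure_def by (intro SUP_least) auto
  then show ?thesis by simp
qed

text \<open>The coordinate of order 1 is t itself. A covering set projects into an interval as long
  as its diameter, so the diameters add up to at least 1. For sets of diameter at most 1 and s \<le>
  1 the weight is no smaller than the diameter, so the scale 1 alone is enough.\<close>

lemma hausdorff_measure_moment_curve_pos:
  assumes s: "0 \<le> s" "s \<le> 1"
  shows "1 \<le> hausdorff_measure s (moment_curve idx)"
proof -
  obtain i1 where i1: "idx i1 = 1" using ex_idx[of 1] d2 by auto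
  have "1 \<le> hausdorff_premeasure s 1 (moment_curve idx)"
    unfolding hausdorff_premeasure_def
  proof (rule INF_greatest)
    fix U :: "nat \<Rightarrow> (real ^ 'n) set"
    assume "U \<in> {U. moment_curve idx \<subseteq> (\<Union>i. U i) \<and> (\<forall>i. bounded (U i) \<and> diameter (U i) \<le> 1)}"
    then have cover: "moment_curve idx \<subseteq> (\<Union>i. U i)" and U: "\<And>i. bounded (U i)" "\<And>i. diameter (U i) \<le> 1" by auto
    define J where "J i = (if U i = {} then {} else {Inf ((\<lambda>x. x $ i1) ` U i)..Inf ((\<lambda>x. x $ i1) ` U i) + diameter (U i)})" for i
    have J: "x $ i1 \<in> J i" if x: "x \<in> U i" for x i
    proof -
      have near: "\<bar>x $ i1 - y $ i1\<bar> \<le> diameter (U i)" if "y \<in> U i" for y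
        using component_le_norm_cart[of "x - y" i1] diameter_bounded_bound[OF U(1) x that] by (simp add: dist_norm)
      have ge: "x $ i1 - diameter (U i) \<le> y" if "y \<in> (\<lambda>x. x $ i1) ` U i" for y
        using near that by (force simp: abs_le_iff)
      have "bdd_below ((\<lambda>x. x $ i1) ` U i)" using ge by (rule bdd_belowI)
      then have "Inf ((\<lambda>x. x $ i1) ` U i) \<le> x $ i1" using x by (intro cInf_lower) auto
      moreover have "x $ i1 - diameter (U i) \<le> Inf ((\<lambda>x. x $ i1) ` U i)"
        using x ge by (intro cInf_greatest) auto
      ultimately show ?thesis using x by (auto simp: J_def)
    qed
    have "{0..1} \<subseteq> (\<Union>i. J i)"
    proof
      fix t :: real assume t: "t \<in> {0..1}"
      then have "moment_map idx t \<in> (\<Union>i. U i)" using cover unfolding moment_curve_def by blast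
      then obtain i where "moment_map idx t \<in> U i" by blast
      from J[OF this] show "t \<in> (\<Union>i. J i)" using i1 by (auto simp: moment_map_def)
    qed
    then have "emeasure lborel {0..1::real} \<le> emeasure lborel (\<Union>i. J i)"
      by (rule emeasure_mono) (auto simp: J_def)
    also have "\<dots> \<le> (\<Sum>i. emeasure lborel (J i))"
      by (rule emeasure_subadditive_countably) (auto simp: J_def)
    also have "\<dots> \<le> (\<Sum>i. diam_weight s (U i))"
    proof (rule suminf_le)
      fix i
      show "emeasure lborel (J i) \<le> diam_weight s (U i)"
      proof (cases "U i = {}")
        case False
        have D: "0 \<le> diameter (U i)" by (rule diameter_ge_0[OF U(1)])
        have "diameter (U i) \<le> diameter (U i) powr s" if "s \<noteq> 0"
          using powr_mono'[of s 1 "diameter (U i)"] s D U(2) by simp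
        then show ?thesis using False D U(2)
          by (auto simp: J_def diam_weight_def intro!: ennreal_leI)
      qed (simp add: J_def)
    qed auto
    finally show "1 \<le> (\<Sum>i. diam_weight s (U i))" by simp
  qed
  also have "\<dots> \<le> hausdorff_measure s (moment_curve idx)"
    unfolding hausdorff_measure_def by (rule SUP_upper) simp
  finally show ?thesis .
qed

theorem hausdorff_dim_moment_curve: "hausdorff_dim (moment_curve idx) = 1"
proof -
  have S: "{s. 0 \<le> s \<and> hausdorff_measure s (moment_curve idx) = 0} = {1<..}"
    using hausdorff_measure_moment_curve_zero hausdorff_measure_moment_curve_pos
    by (force simp: not_le[symmetric])
  show ?thesis
    unfolding hausdorff_dim_def S
  proof (rule antisym)
    show "1 \<le> (INF s\<in>{1<..}. ereal s)" by (rule INF_greatest) simp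
    show "(INF s\<in>{1<..}. ereal s) \<le> 1"
    proof (rule ereal_le_epsilon2)
      fix e :: real assume "0 < e"
      then have "(INF s\<in>{1<..}. ereal s) \<le> ereal (1 + e)" by (intro INF_lower) auto
      then show "(INF s\<in>{1<..}. ereal s) \<le> 1 + ereal e" by (simp add: add.commute)
    qed
  qed
qed

end

section \<open>Phase transitions\<close>

text \<open>The point where the lines k - 1 and k cross.\<close>

definition transition_point :: "nat \<Rightarrow> real" where
  "transition_point k = 4 / ((real k)\<^sup>2 - real k + 2)"

lemma transition_denominator_pos: "0 < (real k)\<^sup>2 - real k + 2"
proof -
  have "(real k)\<^sup>2 - real k + 2 = (real k - 1 / 2)\<^sup>2 + 7 / 4" by (simp add: power2_eq_square algebra_simps)
  also have "\<dots> > 0" by (intro add_nonneg_pos) auto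
  finally show ?thesis .
qed

lemma transition_point_strict_antimono:
  assumes "1 \<le> j" "j < k"
  shows "transition_point k < transition_point j"
proof -
  have "(real j)\<^sup>2 - real j < (real k)\<^sup>2 - real k"
  proof -
    have "0 < (real k - real j) * (real k + real j - 1)" using assms by (intro mult_pos_pos) auto
    then show ?thesis by (simp add: power2_eq_square algebra_simps)
  qed
  then show ?thesis unfolding transition_point_def
    using transition_denominator_pos[of j] transition_denominator_pos[of k]
    by (intro divide_strict_left_mono) auto
qed

lemma transition_point_3: "transition_point 3 = 1 / 2"
  by (simp add: transition_point_def)

lemma transition_point_bounds:
  assumes "3 \<le> k" shows "0 < transition_point k" "transition_point k \<le> 1 / 2"
proof -
  show "0 < transition_point k" using transition_denominator_pos by (simp add: transition_point_def)
  show "transition_point k \<le> 1 / 2"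
    using transition_point_strict_antimono[of 3 k] assms by (cases "k = 3") (auto simp: transition_point_3)
qed

lemma spectrum_line_Suc_diff:
  assumes "1 \<le> k"
  shows "spectrum_line (Suc k) \<theta> - spectrum_line k \<theta>
     = ((real (Suc k))\<^sup>2 - real (Suc k) + 2) / (2 * real (Suc k) * real k) * (\<theta> - transition_point (Suc k))"
proof -
  have "(((real (Suc k))\<^sup>2 - real (Suc k) + 2) * transition_point (Suc k)) = 4"
    proof -
    have "x * (4 / x) = 4" if "0 < x" for x :: real using that by simp
    then show ?thesis unfolding transition_point_def using transition_denominator_pos by blast
  qed
  then have "((real (Suc k))\<^sup>2 - real (Suc k) + 2) / (2 * real (Suc k) * real k) * (\<theta> - transition_point (Suc k))
     = (((real (Suc k))\<^sup>2 - real (Suc k) + 2) * \<theta> - 4) / (2 * real (Suc k) * real k)"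
    by (simp only: right_diff_distrib times_divide_eq_left diff_divide_distrib)
  also have "\<dots> = spectrum_line (Suc k) \<theta> - spectrum_line k \<theta>"
  proof -
    define x where "x = real k"
    have "1 \<le> x" "real (Suc k) = x + 1" using assms by (auto simp: x_def)
    then show ?thesis unfolding spectrum_line_def x_def[symmetric] by (simp add: divide_simps) (simp add: power2_eq_square algebra_simps)
  qed
  finally show ?thesis by simp
qed

lemma spectrum_line_slope_gap_pos:
  assumes "1 \<le> k"
  shows "0 < ((real (Suc k))\<^sup>2 - real (Suc k) + 2) / (2 * real (Suc k) * real k)"
  using transition_denominator_pos[of "Suc k"] assms by (intro divide_pos_pos) auto

lemma spectrum_line_step_mono:
  assumes "1 \<le> k" "transition_point (Suc k) \<le> \<theta>"
  shows "spectrum_line k \<theta> \<le> spectrum_line (Suc k) \<theta>"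
proof -
  have "0 \<le> spectrum_line (Suc k) \<theta> - spectrum_line k \<theta>"
    unfolding spectrum_line_Suc_diff[OF assms(1)]
    using spectrum_line_slope_gap_pos[OF assms(1)] assms(2) by (intro mult_nonneg_nonneg) auto
  then show ?thesis by simp
qed

lemma spectrum_line_step_antimono:
  assumes "1 \<le> k" "\<theta> \<le> transition_point (Suc k)"
  shows "spectrum_line (Suc k) \<theta> \<le> spectrum_line k \<theta>"
proof -
  have "spectrum_line (Suc k) \<theta> - spectrum_line k \<theta> \<le> 0"
    unfolding spectrum_line_Suc_diff[OF assms(1)]
    using spectrum_line_slope_gap_pos[OF assms(1)] assms(2) by (intro mult_nonneg_nonpos) auto
  then show ?thesis by simp
qed

text \<open>Transition points decrease with the index, so lying to the right of one means lying to
  the right of all later ones, and the comparisons of consecutive lines chain.\<close>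

lemma spectrum_line_le_of_ge:
  assumes k: "1 \<le> k" "k \<le> j" and \<theta>: "k < j \<longrightarrow> transition_point (Suc k) \<le> \<theta>"
  shows "spectrum_line k \<theta> \<le> spectrum_line j \<theta>"
  using k(2) \<theta>
proof (induction j rule: dec_induct)
  case (step n)
  have "transition_point (Suc n) \<le> \<theta>"
    using step transition_point_strict_antimono[of "Suc k" "Suc n"] by (cases "n = k") auto
  then show ?case using step k spectrum_line_step_mono[of n \<theta>] by fastforce
qed simp

lemma spectrum_line_le_of_le:
  assumes j: "1 \<le> j" "j \<le> k" and \<theta>: "j < k \<longrightarrow> \<theta> \<le> transition_point k"
  shows "spectrum_line k \<theta> \<le> spectrum_line j \<theta>"
  using j(2)
proof (induction j rule: inc_induct)
  case (step n)
  have "\<theta> \<le> transition_point (Suc n)"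
    using step \<theta> transition_point_strict_antimono[of "Suc n" k] j by (cases "Suc n = k") auto
  then show ?case using step j spectrum_line_step_antimono[of n \<theta>] by fastforce
qed simp

text \<open>The lower envelope: line k is lowest between the transition points of k + 1 and k. The
  guards drop the left end for k = d and the right end for k = 2.\<close>

lemma Min_spectrum_line:
  assumes k: "2 \<le> k" "k \<le> d" and "k < d \<longrightarrow> transition_point (Suc k) \<le> \<theta>" "2 < k \<longrightarrow> \<theta> \<le> transition_point k"
  shows "(MIN j\<in>{2..d}. spectrum_line j \<theta>) = spectrum_line k \<theta>"
proof (rule Min_eqI)
  show "spectrum_line k \<theta> \<le> y" if y: "y \<in> (\<lambda>j. spectrum_line j \<theta>) ` {2..d}" for y
  proof -
    obtain j where j: "j \<in> {2..d}" "y = spectrum_line j \<theta>" using y by auto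
    show ?thesis
    proof (cases "k \<le> j")
      case True
      then show ?thesis using j assms by (auto intro: spectrum_line_le_of_ge)
    next
      case False
      then show ?thesis using j assms by (auto intro: spectrum_line_le_of_le)
    qed
  qed
qed (use k in auto)

lemma spectrum_line_has_derivative:
  "((\<lambda>\<theta>. spectrum_line k \<theta>) has_field_derivative ((real k)\<^sup>2 - real k - 2) / (2 * real k)) (at \<theta> within S)"
proof -
  have "((\<lambda>\<theta>. a + b * \<theta>) has_field_derivative b) (at \<theta> within S)" for a b :: real
    by (auto intro!: derivative_eq_intros)
  then show ?thesis unfolding spectrum_line_def .
qed

section \<open>Differentiability of the lower envelope\<close>

context
  fixes d :: nat and f :: "real \<Rightarrow> real"
  assumes d: "2 \<le> d" and f: "\<And>\<theta>. \<theta> \<in> {0..1} \<Longrightarrow> f \<theta> = (MIN k\<in>{2..d}. spectrum_line k \<theta>)"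
begin

lemma differentiable_off_transitions:
  assumes \<theta>: "\<theta> \<in> {0..1}" "\<theta> \<notin> transition_point ` {3..d}"
  shows "f differentiable (at \<theta> within {0..1})"
proof -
  \<comment> \<open>The maximum of this set is the index of the lowest line at \<theta>: the largest
    k whose transition point lies to the right, or 2 if there is none.\<close>
  define K where "K = {k \<in> {2..d}. k = 2 \<or> \<theta> < transition_point k}"
  define k where "k = Max K"
  have "2 \<in> K" using d by (auto simp: K_def)
  then have kK: "k \<in> K" unfolding k_def by (intro Max_in) (auto simp: K_def)
  have kmax: "j \<le> k" if "j \<in> K" for j using that by (auto simp: k_def K_def)
  have k: "2 \<le> k" "k \<le> d" "2 < k \<longrightarrow> \<theta> < transition_point k" using kK by (auto simp: K_def)
  have up: "k < d \<longrightarrow> transition_point (Suc k) < \<theta>"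
  proof
    assume kd: "k < d"
    have "Suc k \<notin> K" using kmax[of "Suc k"] by auto
    then have "transition_point (Suc k) \<le> \<theta>" using kd k by (auto simp: K_def)
    moreover have "transition_point (Suc k) \<noteq> \<theta>" using \<theta>(2) kd k by force
    ultimately show "transition_point (Suc k) < \<theta>" by simp
  qed
  define S where "S = (if k < d then {transition_point (Suc k)<..} else UNIV) \<inter> (if 2 < k then {..<transition_point k} else UNIV)"
  have "open S" "\<theta> \<in> S" using up k by (auto simp: S_def)
  then obtain e where e: "0 < e" "ball \<theta> e \<subseteq> S" by (meson open_contains_ball)
  have "(\<lambda>\<theta>. spectrum_line k \<theta>) differentiable (at \<theta> within {0..1})"
    unfolding real_differentiable_def using spectrum_line_has_derivative by blast
  then show ?thesis
  proof (rule differentiable_transform_within[OF _ e(1) \<theta>(1)])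
    fix x' :: real assume x': "x' \<in> {0..1}" "dist x' \<theta> < e"
    then have "x' \<in> S" using e by (auto simp: dist_commute)
    then have "(MIN j\<in>{2..d}. spectrum_line j x') = spectrum_line k x'"
      by (intro Min_spectrum_line k) (auto simp: S_def split: if_splits)
    then show "spectrum_line k x' = f x'" using f[OF x'(1)] by simp
  qed
qed

text \<open>Line k is lowest just to the left of the point and line k - 1 just to the right, so a
  derivative would have to equal both slopes.\<close>

lemma not_differentiable_at_transition:
  assumes k: "k \<in> {3..d}"
  shows "\<not> f differentiable (at (transition_point k) within {0..1})"
proof
  assume diff: "f differentiable (at (transition_point k) within {0..1})"
  let ?\<theta> = "transition_point k"
  obtain n where n: "k = Suc n" "2 \<le> n" "n < d" using k by (cases k) auto
  have b: "0 < ?\<theta>" "?\<theta> \<le> 1 / 2" using transition_point_bounds[of k] k by auto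
  obtain D where D: "(f has_field_derivative D) (at ?\<theta> within {0..1})"
    using diff by (auto simp: real_differentiable_def)
  \<comment> \<open>At the extremes k = d and n = 2 there is no neighbouring transition point, and
    the ends 0 and 1 take its place.\<close>
  define l where "l = (if k < d then transition_point (Suc k) else 0)"
  define r where "r = (if 2 < n then transition_point n else 1)"
  have l: "0 \<le> l" "l < ?\<theta>"
    using k b transition_point_strict_antimono[of k "Suc k"] transition_point_bounds(1)[of "Suc k"]
    by (auto simp: l_def)
  have r: "?\<theta> < r" "r \<le> 1"
    using n b transition_point_strict_antimono[of n k] transition_point_bounds(2)[of n]
    by (auto simp: r_def)
  have "((\<lambda>\<theta>. spectrum_line k \<theta>) has_field_derivative D) (at ?\<theta> within {l..?\<theta>})"
  proof (rule has_field_derivative_transform_within[where d = 1])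
    show "(f has_field_derivative D) (at ?\<theta> within {l..?\<theta>})"
      by (rule DERIV_subset[OF D]) (use l b in auto)
    fix x assume x: "x \<in> {l..?\<theta>}"
    have "(MIN j\<in>{2..d}. spectrum_line j x) = spectrum_line k x"
      using k x by (intro Min_spectrum_line) (auto simp: l_def split: if_splits)
    then show "f x = spectrum_line k x" using f[of x] x l b by simp
  qed (use l in auto)
  from has_field_derivative_unique[OF this spectrum_line_has_derivative]
  have D1: "D = ((real k)\<^sup>2 - real k - 2) / (2 * real k)"
    using l by (simp add: at_within_Icc_at_left)
  have "((\<lambda>\<theta>. spectrum_line n \<theta>) has_field_derivative D) (at ?\<theta> within {?\<theta>..r})"
  proof (rule has_field_derivative_transform_within[where d = 1])
    show "(f has_field_derivative D) (at ?\<theta> within {?\<theta>..r})"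
      by (rule DERIV_subset[OF D]) (use r b in auto)
    fix x assume x: "x \<in> {?\<theta>..r}"
    have "(MIN j\<in>{2..d}. spectrum_line j x) = spectrum_line n x"
      using n x by (intro Min_spectrum_line) (auto simp: r_def split: if_splits)
    then show "f x = spectrum_line n x" using f[of x] x r b by simp
  qed (use r in auto)
  from has_field_derivative_unique[OF this spectrum_line_has_derivative]
  have D2: "D = ((real n)\<^sup>2 - real n - 2) / (2 * real n)"
    using r by (simp add: at_within_Icc_at_right)
  \<comment> \<open>Equal slopes give the difference of the two lines the same value at 0 and at 1,
    which its factor c > 0 forbids.\<close>
  have "spectrum_line (Suc n) 1 - spectrum_line n 1 = spectrum_line (Suc n) 0 - spectrum_line n 0"
    using D1 D2 n by (simp add: spectrum_line_def)
  moreover define c where "c = ((real (Suc n))\<^sup>2 - real (Suc n) + 2) / (2 * real (Suc n) * real n)"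
  moreover have "spectrum_line (Suc n) t - spectrum_line n t = c * (t - transition_point (Suc n))" for t
    unfolding c_def by (rule spectrum_line_Suc_diff) (use n in simp)
  ultimately have "c * (1 - transition_point (Suc n)) = c * (0 - transition_point (Suc n))" by metis
  then have "c = 0" by (simp add: right_diff_distrib)
  moreover have "0 < c" unfolding c_def by (rule spectrum_line_slope_gap_pos) (use n in simp)
  ultimately show False by simp
qed

end

lemma inj_on_transition_point: "inj_on transition_point {3..d}"
proof (rule inj_onI)
  fix j k assume jk: "j \<in> {3..d}" "k \<in> {3..d}" "transition_point j = transition_point k"
  show "j = k"
    using transition_point_strict_antimono[of j k] transition_point_strict_antimono[of k j] jk
    by (cases j k rule: linorder_cases) auto
qed

text \<open>The bound on \<theta> is \<open>transition_point (Suc d)\<close>. It lies to the left of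
  all actual transitions, so line d is the lowest one, and it is exactly where line d meets d
  \<theta>.\<close>

lemma Min_spectrum_line_gt:
  assumes d: "2 \<le> d" and \<theta>: "0 \<le> \<theta>" "\<theta> < 4 / ((real d)\<^sup>2 + real d + 2)"
  shows "\<theta> \<le> 1" "real d * \<theta> < (MIN k\<in>{2..d}. spectrum_line k \<theta>)"
proof -
  have Suc: "transition_point (Suc d) = 4 / ((real d)\<^sup>2 + real d + 2)"
    by (simp add: transition_point_def power2_eq_square algebra_simps)
  have lt: "\<theta> < transition_point d"
    using \<theta> transition_point_strict_antimono[of d "Suc d"] d by (simp add: Suc)
  have "\<theta> < 1 / 2" using \<theta>(2) transition_point_bounds(2)[of "Suc d"] d unfolding Suc by simp
  then show "\<theta> \<le> 1" by simp
  have "(MIN k\<in>{2..d}. spectrum_line k \<theta>) = spectrum_line d \<theta>"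
    using d lt by (intro Min_spectrum_line) auto
  also have "spectrum_line d \<theta> = real d * \<theta> + (4 - ((real d)\<^sup>2 + real d + 2) * \<theta>) / (2 * real d)"
    using d by (simp add: spectrum_line_def field_simps power2_eq_square)
  also have "\<dots> > real d * \<theta>"
  proof -
    have "0 < (real d)\<^sup>2 + real d + 2" by (intro add_nonneg_pos) auto
    then have "\<theta> * ((real d)\<^sup>2 + real d + 2) < 4" using \<theta>(2) by (simp add: pos_less_divide_eq)
    then show ?thesis using d by (simp add: mult.commute)
  qed
  finally show "real d * \<theta> < (MIN k\<in>{2..d}. spectrum_line k \<theta>)" .
qed

theorem proposition8p1:
  fixes d :: nat and idx :: "'n::finite \<Rightarrow> nat" and \<nu> :: "(real ^ 'n) measure"
  assumes "CARD('n) = d" and "d \<ge> 2" and "bij_betw idx UNIV {1..d}"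
  defines "\<nu> \<equiv> moment_measure idx"
  shows "(\<forall>\<theta>\<in>{0..1}. fourier_spectrum \<theta> \<nu> =
            ereal (MIN k\<in>{2..d}. 2 / real k + ((real k)\<^sup>2 - real k - 2) / (2 * real k) * \<theta>))
    \<and> fourier_dim \<nu> = ereal (2 / real d)
    \<and> hausdorff_dim (moment_curve idx) = 1
    \<and> (\<forall>\<theta>\<in>{1/2..1}. fourier_spectrum \<theta> \<nu> = hausdorff_dim (moment_curve idx))
    \<and> phase_transitions \<nu> = (\<lambda>k. 4 / ((real k)\<^sup>2 - real k + 2)) ` {3..d}
    \<and> card (phase_transitions \<nu>) = d - 2
    \<and> (\<forall>\<theta>::real. 0 \<le> \<theta> \<and> \<theta> < 4 / ((real d)\<^sup>2 + real d + 2) \<longrightarrow>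
          fourier_spectrum \<theta> \<nu> > ereal (real d * \<theta>))"
proof -
  interpret moment_index idx d
    by unfold_locales (use assms in auto)
  have spec: "fourier_spectrum \<theta> \<nu> = ereal (MIN k\<in>{2..d}. spectrum_line k \<theta>)" if "\<theta> \<in> {0..1}" for \<theta>
    using fourier_spectrum_moment[OF that] by (simp add: \<nu>_def)
  have dim: "fourier_dim \<nu> = ereal (2 / real d)"
    unfolding fourier_dim_def using spec[of 0] by (simp add: Min_spectrum_line_0)
  have half: "fourier_spectrum \<theta> \<nu> = hausdorff_dim (moment_curve idx)" if \<theta>: "\<theta> \<in> {1/2..1}" for \<theta>
  proof -
    have "(MIN k\<in>{2..d}. spectrum_line k \<theta>) = spectrum_line 2 \<theta>"
      using \<theta> d2 transition_point_3 by (intro Min_spectrum_line) (auto simp: eval_nat_numeral)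
    then show ?thesis using spec[of \<theta>] \<theta> by (simp add: spectrum_line_2 hausdorff_dim_moment_curve)
  qed
  have f: "real_of_ereal (fourier_spectrum \<theta> \<nu>) = (MIN k\<in>{2..d}. spectrum_line k \<theta>)" if "\<theta> \<in> {0..1}" for \<theta>
    using spec[OF that] by simp
  have phase: "phase_transitions \<nu> = transition_point ` {3..d}"
  proof (intro antisym subsetI)
    fix \<theta> assume "\<theta> \<in> phase_transitions \<nu>"
    then show "\<theta> \<in> transition_point ` {3..d}"
      using differentiable_off_transitions[OF d2 f] by (auto simp: phase_transitions_def)
  next
    fix \<theta> assume "\<theta> \<in> transition_point ` {3..d}"
    then obtain k where k: "k \<in> {3..d}" "\<theta> = transition_point k" by auto
    then show "\<theta> \<in> phase_transitions \<nu>"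
      using not_differentiable_at_transition[OF d2 f k(1)] transition_point_bounds[of k]
      by (auto simp: phase_transitions_def)
  qed
  then have "card (phase_transitions \<nu>) = d - 2"
    using d2 by (simp add: card_image inj_on_transition_point)
  moreover have "fourier_spectrum \<theta> \<nu> > ereal (real d * \<theta>)"
    if "0 \<le> \<theta>" "\<theta> < 4 / ((real d)\<^sup>2 + real d + 2)" for \<theta>
    using Min_spectrum_line_gt[OF d2 that] spec[of \<theta>] that by simp
  ultimately show ?thesis
    using spec dim half hausdorff_dim_moment_curve phase
    unfolding spectrum_line_def transition_point_def[abs_def] by blast
qed

end
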